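(* There exists $\varepsilon>0$ such that for every $m>0$, $H>0$ with $0<m/H<\varepsilon$ the following holds. Let $A$ and $B$ be any two single-mode subsystems of the scalar field, given by smooth compactly supported profiles $\Gamma_I^{(i)}=(G_I^{(i)},F_I^{(i)})$, $I=A,B$, $i=1,2$, with $\int_{\mathbb{R}^3}\big(G_I^{(1)}F_I^{(2)}-F_I^{(1)}G_I^{(2)}\big)\,d^3y=1$, and assume that the modes do not overlap, i.e. the union of the supports of the functions defining $A$ is disjoint from the union of the supports of the functions defining $B$ (with no restriction on the separation between them). Let $A_R,B_R$ be the same modes scaled by the common physical size $R$. Then there exists $\Lambda>0$ (depending on the profiles and on $m/H$) such that for all $R>0$ with $RH\ge\Lambda$, $$\mathrm{LN}^{\mathrm{BD}}(A_R,B_R)\;\le\;\mathrm{LN}^{\mathrm{Mink}}(A_R,B_R),$$ i.e. the entanglement between the two modes, quantified by the logarithmic negativity, is no bigger in the Bunch-Davies vacuum than in the (massless) Minkowski vacuum.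
   Context: Units $\hbar=c=1$. A free real scalar field of mass $m>0$ is considered in the cosmological patch of de Sitter spacetime with Hubble rate $H$, on the constant-time slice $\Sigma\cong\mathbb{R}^3$ on which the scale factor is normalized to $1$ (so coordinates are physical lengths). It is compared with a free massless real scalar field on a constant inertial time slice $\mathbb{R}^3$ of Minkowski spacetime; modes in the two spacetimes are identified when they are defined by the same smearing functions on $\mathbb{R}^3$. Linear observables: for real smooth compactly supported $f,g$ on $\mathbb{R}^3$ and $\gamma=(g,f)$, let $\hat O_\gamma=\int_{\mathbb{R}^3}(f\hat\Phi-g\hat\Pi)\,d^3x$, where $[\hat\Phi(x),\hat\Pi(x')]=i\delta^{(3)}(x-x')$. Thus $[\hat O_\gamma,\hat O_{\gamma'}]=i\int(g f'-f g')\,d^3x$. States: both vacua are zero-mean Gaussian states with symmetrized two-point function $$\langle\{\hat O_\gamma,\hat O_{\gamma'}\}\rangle=2\,\mathrm{Re}\int\frac{d^3k}{(2\pi)^3}\,\big(\tilde f(k)\varphi_k-\tilde g(k)\pi_k\big)\,\overline{\big(\tilde f'(k)\varphi_k-\tilde g'(k)\pi_k\big)},$$ where $\{X,Y\}=XY+YX$, $\tilde f(k)=\int f(x)e^{-ik\cdot x}d^3x$, and, writing $k$ also for $|k|$: - Bunch-Davies vacuum: $\varphi_k=\sqrt{\tfrac{\pi}{4H}}\,H^{(1)}_{n}(k/H)$ and $\pi_k=-\sqrt{\tfrac{\pi H}{4}}\,\big[\mu^2H^{(1)}_{n}(k/H)+\tfrac{k}{H}H^{(1)}_{n-1}(k/H)\big]$,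 where $H^{(1)}_n$ is the Hankel function of the first kind, $\mu^2=\tfrac32-\sqrt{\tfrac94-\tfrac{m^2}{H^2}}$ and $n=\tfrac32-\mu^2$. - Massless Minkowski vacuum: $\varphi_k=1/\sqrt{2k}$, $\pi_k=-i\sqrt{k/2}$. Single-mode subsystem: the algebra generated by two observables $\hat O_{\gamma^{(1)}},\hat O_{\gamma^{(2)}}$ with $[\hat O_{\gamma^{(1)}},\hat O_{\gamma^{(2)}}]=i$. For dimensionless profiles $\Gamma^{(i)}=(G^{(i)},F^{(i)})$ (real, smooth, compactly supported functions on $\mathbb{R}^3$), the mode scaled to size $R>0$ is defined by $\gamma^{(i)}_R=(g_R^{(i)},f_R^{(i)})$ with $f_R^{(i)}(x)=R^{-2}F^{(i)}(x/R)$ and $g_R^{(i)}(x)=R^{-1}G^{(i)}(x/R)$; this preserves the commutation relations. Logarithmic negativity: for two commuting single modes $A,B$, let $\boldsymbol\sigma_{AB}$ be the $4\times4$ matrix with entries $\langle\{\hat R^i,\hat R^j\}\rangle$, where $\hat R=(\hat O_{\gamma_A^{(1)}},\hat O_{\gamma_A^{(2)}},\hat O_{\gamma_B^{(1)}},\hat O_{\gamma_B^{(2)}})$, written in $2\times2$ blocks as $\boldsymbol\sigma_{AB}=\begin{pmatrix}\boldsymbol\sigma_A&\boldsymbol C\\ \boldsymbol C^{\top}&\boldsymbol\sigma_B\end{pmatrix}$. Set $\tilde\Delta=\det\boldsymbol\sigma_A+\det\boldsymbol\sigma_B-2\det\boldsymbol C$, and let $\tilde\nu_->0$ be given by $\tilde\nu_-^2=\tfrac12\big(\tilde\Delta-\sqrt{\tilde\Delta^2-4\det\boldsymbol\sigma_{AB}}\big)$.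 Then $\mathrm{LN}(A,B)=\max\{0,-\log_2\tilde\nu_-\}$. Superscripts BD and Mink indicate the state used. *)

theory Defs
  imports "HOL-Analysis.Analysis"
begin

section \<open>Test functions on three-dimensional space\<close>

primrec higher_differentiable :: "nat \<Rightarrow> (real^3 \<Rightarrow> real) \<Rightarrow> bool" where
  "higher_differentiable 0 f \<longleftrightarrow> continuous_on UNIV f"
| "higher_differentiable (Suc n) f \<longleftrightarrow>
     (\<forall>x. f differentiable (at x)) \<and>
     (\<forall>v. higher_differentiable n (\<lambda>x. frechet_derivative f (at x) v))"

definition smooth :: "(real^3 \<Rightarrow> real) \<Rightarrow> bool" where
  "smooth f \<longleftrightarrow> (\<forall>n. higher_differentiable n f)"

definition supp :: "(real^3 \<Rightarrow> real) \<Rightarrow> (real^3) set" where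
  "supp f = closure (support_on UNIV f)"

definition test_function :: "(real^3 \<Rightarrow> real) \<Rightarrow> bool" where
  "test_function f \<longleftrightarrow> smooth f \<and> compact (supp f)"

definition fourier :: "(real^3 \<Rightarrow> real) \<Rightarrow> real^3 \<Rightarrow> complex" where
  "fourier f k = (LINT x|lborel. complex_of_real (f x) * exp (- (\<i> * complex_of_real (k \<bullet> x))))"

section \<open>Linear observables and single modes\<close>

text \<open>
  A pair \<open>\<gamma> = (g, f)\<close> stands for the linear observable obtained by smearing the field with \<open>f\<close> and
  its conjugate momentum with \<open>- g\<close>; note the order of the components.
\<close>

type_synonym observable = "(real^3 \<Rightarrow> real) \<times> (real^3 \<Rightarrow> real)"

text \<open>The commutator of the observables labelled by \<open>\<gamma>\<close> and \<open>\<gamma>'\<close> is \<open>\<i>\<close> times this real number.\<close>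

definition commutator_form :: "observable \<Rightarrow> observable \<Rightarrow> real" where
  "commutator_form \<gamma> \<gamma>' = (LINT x|lborel. fst \<gamma> x * snd \<gamma>' x - snd \<gamma> x * fst \<gamma>' x)"

text \<open>A mode is presented by its two generating observables.\<close>

type_synonym mode = "observable \<times> observable"

definition single_mode :: "mode \<Rightarrow> bool" where
  "single_mode A \<longleftrightarrow>
     (\<forall>\<gamma>\<in>{fst A, snd A}. test_function (fst \<gamma>) \<and> test_function (snd \<gamma>)) \<and>
     commutator_form (fst A) (snd A) = 1"

definition mode_support :: "mode \<Rightarrow> (real^3) set" where
  "mode_support A = (\<Union>\<gamma>\<in>{fst A, snd A}. supp (fst \<gamma>) \<union> supp (snd \<gamma>))"

definition scale_observable :: "real \<Rightarrow> observable \<Rightarrow> observable" where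
  "scale_observable R \<gamma> =
     ((\<lambda>x. fst \<gamma> (x /\<^sub>R R) / R), (\<lambda>x. snd \<gamma> (x /\<^sub>R R) / R^2))"

definition scale_mode :: "real \<Rightarrow> mode \<Rightarrow> mode" where
  "scale_mode R A = (scale_observable R (fst A), scale_observable R (snd A))"

section \<open>Hankel functions\<close>

text \<open>
  Bessel functions of complex order on the principal branch (cut along the nonpositive real axis);
  the reciprocal Gamma function makes the series meaningful for every order.
\<close>

definition bessel_J :: "complex \<Rightarrow> complex \<Rightarrow> complex" where
  "bessel_J \<nu> z =
     (z / 2) powr \<nu> * (\<Sum>j. (-1)^j * rGamma (\<nu> + of_nat j + 1) / fact j * (z / 2)^(2 * j))"

definition bessel_Y :: "complex \<Rightarrow> complex \<Rightarrow> complex" where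
  "bessel_Y \<nu> z =
     (let Y = (\<lambda>\<alpha>. (bessel_J \<alpha> z * cos (\<alpha> * of_real pi) - bessel_J (- \<alpha>) z) / sin (\<alpha> * of_real pi))
      in if \<nu> \<in> \<int> then Lim (at \<nu>) Y else Y \<nu>)"

definition hankel1 :: "complex \<Rightarrow> complex \<Rightarrow> complex" where
  "hankel1 \<nu> z = bessel_J \<nu> z + \<i> * bessel_Y \<nu> z"

section \<open>Vacua\<close>

text \<open>
  The index and the mode functions below are those of a light field, \<open>m / H \<le> 3 / 2\<close>. Beyond this
  bound the argument of \<^const>\<open>sqrt\<close> is negative, and the definitions have no physical meaning.
\<close>

definition BD_mu2 :: "real \<Rightarrow> real \<Rightarrow> real" where
  "BD_mu2 m H = 3/2 - sqrt (9/4 - m^2 / H^2)"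

definition BD_index :: "real \<Rightarrow> real \<Rightarrow> real" where
  "BD_index m H = 3/2 - BD_mu2 m H"

definition BD_field :: "real \<Rightarrow> real \<Rightarrow> real \<Rightarrow> complex" where
  "BD_field m H k =
     of_real (sqrt (pi / (4 * H))) * hankel1 (of_real (BD_index m H)) (of_real (k / H))"

definition BD_momentum :: "real \<Rightarrow> real \<Rightarrow> real \<Rightarrow> complex" where
  "BD_momentum m H k =
     - of_real (sqrt (pi * H / 4)) *
       (of_real (BD_mu2 m H) * hankel1 (of_real (BD_index m H)) (of_real (k / H)) +
        of_real (k / H) * hankel1 (of_real (BD_index m H - 1)) (of_real (k / H)))"

definition Mink_field :: "real \<Rightarrow> complex" where
  "Mink_field k = of_real (1 / sqrt (2 * k))"

definition Mink_momentum :: "real \<Rightarrow> complex" where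
  "Mink_momentum k = - \<i> * of_real (sqrt (k / 2))"

text \<open>
  A zero-mean Gaussian state is represented by its symmetrized two-point function, here the
  expectation of the anticommutator (without a factor \<open>1 / 2\<close>) in the vacuum with mode functions
  \<open>\<phi>\<close> and \<open>\<pi>'\<close>.
\<close>

definition two_point ::
    "(real \<Rightarrow> complex) \<Rightarrow> (real \<Rightarrow> complex) \<Rightarrow> observable \<Rightarrow> observable \<Rightarrow> real" where
  "two_point \<phi> \<pi>' \<gamma> \<gamma>' =
     (let a = (\<lambda>\<gamma> k. fourier (snd \<gamma>) k * \<phi> (norm k) - fourier (fst \<gamma>) k * \<pi>' (norm k))
      in 2 * Re (LINT k|lborel. a \<gamma> k * cnj (a \<gamma>' k) / of_real ((2 * pi)^3)))"

section \<open>Logarithmic negativity\<close>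

definition covariance_matrix ::
    "(observable \<Rightarrow> observable \<Rightarrow> real) \<Rightarrow> mode \<Rightarrow> mode \<Rightarrow> real^4^4" where
  "covariance_matrix S A B =
     (let r = (\<lambda>i::4. if i = 1 then fst A else if i = 2 then snd A
                      else if i = 3 then fst B else snd B)
      in \<chi> i j. S (r i) (r j))"

definition block :: "real^4^4 \<Rightarrow> 4 \<Rightarrow> 4 \<Rightarrow> real^2^2" where
  "block \<sigma> i j = vector [vector [\<sigma> $ i $ j, \<sigma> $ i $ (j + 1)],
                         vector [\<sigma> $ (i + 1) $ j, \<sigma> $ (i + 1) $ (j + 1)]]"

definition Delta_PT :: "real^4^4 \<Rightarrow> real" where
  "Delta_PT \<sigma> = det (block \<sigma> 1 1) + det (block \<sigma> 3 3) - 2 * det (block \<sigma> 1 3)"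

definition nu_minus :: "real^4^4 \<Rightarrow> real" where
  "nu_minus \<sigma> = sqrt ((Delta_PT \<sigma> - sqrt ((Delta_PT \<sigma>)^2 - 4 * det \<sigma>)) / 2)"

definition log_negativity :: "(observable \<Rightarrow> observable \<Rightarrow> real) \<Rightarrow> mode \<Rightarrow> mode \<Rightarrow> real" where
  "log_negativity S A B = max 0 (- log 2 (nu_minus (covariance_matrix S A B)))"

definition LN_BD :: "real \<Rightarrow> real \<Rightarrow> mode \<Rightarrow> mode \<Rightarrow> real" where
  "LN_BD m H = log_negativity (two_point (BD_field m H) (BD_momentum m H))"

definition LN_Mink :: "mode \<Rightarrow> mode \<Rightarrow> real" where
  "LN_Mink = log_negativity (two_point Mink_field Mink_momentum)"

end

theory Submission
  imports Defs
begin

text \<open>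
  The Minkowski negativity is nonnegative, so it suffices that the Bunch-Davies negativity vanishes
  for large \<open>L = R H\<close>. In rescaled momenta \<open>q\<close>, an observable \<open>(g, f)\<close> has amplitude
  \<open>u H\<^sub>n(|q|/L) + |q| g H\<^bsub>n-1\<^esub>(|q|/L)\<close> with \<open>u = f + \<mu>\<^sup>2 L g\<close> (Fourier transforms understood).
  Since \<open>H\<^sub>n(s)\<close> behaves like \<open>- \<i> c\<^sub>n s\<^bsup>-n\<^esup>\<close> near \<open>0\<close>, the amplitude divided by \<open>L\<^sup>n\<close> tends to a
  multiple of \<open>|q|\<^bsup>-n\<^esup> (u - \<kappa> \<Delta> w)\<close> with \<open>w = g / L\<close>. In a suitable \<open>L\<close>-dependent basis of the two modes
  these limits are linearly independent, because the modes are disjoint, \<open>\<Delta>\<close> is local, and \<open>\<Delta>\<close> has no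
  compactly supported eigenfunctions. Hence the covariance form is bounded below by a multiple of
  \<open>L\<^bsup>2n-1\<^esup>\<close>, while the change of basis costs at most a factor \<open>L\<close> in the commutator form. As \<open>n > 1\<close>,
  the classical noise eventually dominates the commutator form of each mode, which makes the
  partially transposed covariance matrix physical.
\<close>

section \<open>Hankel functions of real order\<close>

text \<open>The obstacle is that the dominant part \<open>\<mu>\<^sup>2 L g\<close> of
  \<open>u\<close> need not distinguish the two generators of a mode: their functions
  \<open>g\<close> can be proportional, and the functions \<open>f\<close> proportional to them too.
  Then some combination cancels \<open>u\<close> exactly and only the Hankel term of order
  \<open>n - 1\<close> survives. It is smaller by one power of \<open>L\<close> and carries an extra
  \<open>|q|^2\<close>, the symbol of minus the Laplacian; stretching this combination back to size
  one is what costs the factor \<open>L\<close>. The lower bound comes from compactness, without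
  rates, so the threshold on \<open>L\<close> is not explicit. For unit vectors in the adapted
  basis, the product of two covariance values is at least of order \<open>L powr (4 * n - 2)\<close>
  and the squared commutator form at most of order \<open>L^2\<close>, so the surplus
  \<open>L powr (4 * n - 4)\<close> grows when \<open>n > 1\<close>. The bound
  \<open>n < 3/2\<close>, that is \<open>m > 0\<close>, makes \<open>|q| powr (- 2 * n)\<close>
  integrable at the origin in three dimensions. Between these bounds neither \<open>n\<close> nor
  \<open>n - 1\<close> is an integer, so both Hankel functions are given by the quotient with
  \<open>sin (n * pi)\<close>.\<close>

definition bessel_coeff :: "real \<Rightarrow> nat \<Rightarrow> real" where
  "bessel_coeff \<nu> j = (-1)^j * rGamma (\<nu> + real j + 1) / fact j"

text \<open>The entire factor of the Bessel function: \<open>x\<close> stands for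
  \<open>(s / 2)^2\<close>, and the power \<open>(s / 2) powr \<nu>\<close> is split off so that
  termwise differentiation applies at every order.\<close>

definition bessel_series :: "real \<Rightarrow> real \<Rightarrow> real" where
  "bessel_series \<nu> x = (\<Sum>j. bessel_coeff \<nu> j * x^j)"

lemma bessel_coeff_shift: "bessel_coeff \<nu> j = (\<nu> + 1 + real j) * bessel_coeff (\<nu> + 1) j"
  using rGamma_plus1[of "\<nu> + real j + 1"] by (simp add: bessel_coeff_def algebra_simps)

lemma diffs_bessel_coeff: "diffs (bessel_coeff \<nu>) = (\<lambda>j. - bessel_coeff (\<nu> + 1) j)"
  by (rule ext) (simp add: diffs_def bessel_coeff_def algebra_simps del: of_nat_Suc,
      simp add: field_simps)

lemma summable_bessel_series: "summable (\<lambda>j. bessel_coeff \<nu> j * x^j)"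
proof (rule summable_ratio_test[of "1/2" "nat \<lceil>2 * \<bar>x\<bar> + \<bar>\<nu>\<bar>\<rceil>"])
  fix j assume "nat \<lceil>2 * \<bar>x\<bar> + \<bar>\<nu>\<bar>\<rceil> \<le> j"
  then have j: "2 * \<bar>x\<bar> + \<bar>\<nu>\<bar> \<le> real j" by linarith
  \<comment> \<open>\<open>- 1 / d\<close> is the ratio of consecutive coefficients. The threshold
    on \<open>j\<close> makes the factor \<open>\<nu> + real j + 1\<close> at least
    \<open>2 * \<bar>x\<bar> + 1\<close>, hence the ratio of terms at most one half.\<close>
  define d where "d = (real j + 1) * (\<nu> + real j + 1)"
  have "1 * (2 * \<bar>x\<bar> + 1) \<le> d"
    unfolding d_def by (rule mult_mono) (use j in auto)
  then have d: "2 * \<bar>x\<bar> + 1 \<le> d" by simp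
  have "d * bessel_coeff \<nu> (Suc j) = (\<nu> + real j + 1) * ((real j + 1) * bessel_coeff \<nu> (Suc j))"
    by (simp add: d_def)
  also have "(real j + 1) * bessel_coeff \<nu> (Suc j) = - bessel_coeff (\<nu> + 1) j"
    using fun_cong[OF diffs_bessel_coeff, of \<nu> j] by (simp add: diffs_def add.commute)
  also have "(\<nu> + real j + 1) * - bessel_coeff (\<nu> + 1) j = - bessel_coeff \<nu> j"
    by (subst bessel_coeff_shift) (simp add: algebra_simps)
  finally have "d * bessel_coeff \<nu> (Suc j) = - bessel_coeff \<nu> j" .
  then have c: "bessel_coeff \<nu> (Suc j) = - bessel_coeff \<nu> j / d"
    using d by (simp add: field_simps)
  have "norm (bessel_coeff \<nu> (Suc j) * x ^ Suc j) = \<bar>bessel_coeff \<nu> j * x ^ j\<bar> * (\<bar>x\<bar> / d)"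
    using d by (simp add: c abs_mult)
  also have "\<dots> \<le> \<bar>bessel_coeff \<nu> j * x ^ j\<bar> * (1/2)"
    by (rule mult_left_mono) (use d in \<open>auto simp: field_simps\<close>)
  finally show "norm (bessel_coeff \<nu> (Suc j) * x ^ Suc j) \<le> 1/2 * norm (bessel_coeff \<nu> j * x ^ j)"
    by simp
qed auto

lemma bessel_series_deriv:
  "(bessel_series \<nu> has_real_derivative - bessel_series (\<nu> + 1) x) (at x)"
proof -
  have "((\<lambda>x. \<Sum>j. bessel_coeff \<nu> j * x^j) has_real_derivative
      (\<Sum>j. diffs (bessel_coeff \<nu>) j * x^j)) (at x)"
    by (rule termdiffs_strong_converges_everywhere) (rule summable_bessel_series)
  then show ?thesis
    using summable_bessel_series
    by (simp add: bessel_series_def[abs_def] diffs_bessel_coeff suminf_minus)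
qed

text \<open>The three-term recurrence of Bessel functions in series form. The factor
  \<open>\<nu> + 1 + j\<close> from the coefficient shift splits into \<open>\<nu> + 1\<close> and
  \<open>j\<close>; the part with \<open>j\<close> is \<open>x\<close> times the derivative of the
  series of order \<open>\<nu> + 1\<close>.\<close>

lemma bessel_series_rec:
  "bessel_series \<nu> x = (\<nu> + 1) * bessel_series (\<nu> + 1) x - x * bessel_series (\<nu> + 2) x"
proof -
  have d: "real (Suc j) * bessel_coeff (\<nu> + 1) (Suc j) = - bessel_coeff (\<nu> + 2) j" for j
    using fun_cong[OF diffs_bessel_coeff, of "\<nu> + 1" j] by (simp add: diffs_def add.assoc)
  have s: "(\<lambda>j. bessel_coeff (\<nu> + 2) j * x^j) sums bessel_series (\<nu> + 2) x"
    by (simp add: bessel_series_def summable_bessel_series summable_sums)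
  have "(\<lambda>j. real (Suc j) * bessel_coeff (\<nu> + 1) (Suc j) * x^Suc j) sums (- x * bessel_series (\<nu> + 2) x)"
    unfolding d using sums_mult[OF s, of "- x"] by (simp add: algebra_simps)
  then have "(\<lambda>j. real j * bessel_coeff (\<nu> + 1) j * x^j) sums (- x * bessel_series (\<nu> + 2) x)"
    by (subst (asm) sums_Suc_iff) simp
  moreover have "(\<lambda>j. (\<nu> + 1) * (bessel_coeff (\<nu> + 1) j * x^j)) sums ((\<nu> + 1) * bessel_series (\<nu> + 1) x)"
    unfolding bessel_series_def by (intro sums_mult summable_sums summable_bessel_series)
  ultimately have "(\<lambda>j. real j * bessel_coeff (\<nu> + 1) j * x^j + (\<nu> + 1) * (bessel_coeff (\<nu> + 1) j * x^j)) sums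
     (- x * bessel_series (\<nu> + 2) x + (\<nu> + 1) * bessel_series (\<nu> + 1) x)"
    by (rule sums_add)
  then have "(\<lambda>j. bessel_coeff \<nu> j * x^j) sums
     (- x * bessel_series (\<nu> + 2) x + (\<nu> + 1) * bessel_series (\<nu> + 1) x)"
    by (subst bessel_coeff_shift) (simp add: algebra_simps)
  then show ?thesis by (simp add: bessel_series_def sums_iff)
qed

lemma continuous_on_bessel_series: "continuous_on S (bessel_series \<nu>)"
  by (meson DERIV_isCont bessel_series_deriv continuous_at_imp_continuous_on)

definition real_J :: "real \<Rightarrow> real \<Rightarrow> real" where
  "real_J \<nu> s = (s / 2) powr \<nu> * bessel_series \<nu> ((s / 2)^2)"

lemma bessel_J_of_real:
  assumes "s > 0"
  shows "bessel_J (of_real \<nu>) (of_real s) = of_real (real_J \<nu> s)"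
proof -
  have t: "(-1)^j * rGamma (of_real \<nu> + of_nat j + 1) / fact j * (of_real s / 2)^(2 * j)
     = complex_of_real (bessel_coeff \<nu> j * ((s / 2)^2)^j)" for j
  proof -
    have "rGamma (complex_of_real \<nu> + of_nat j + 1) = of_real (rGamma (\<nu> + real j + 1))"
      by (metis of_real_1 of_real_add of_real_of_nat_eq rGamma_complex_of_real)
    then show ?thesis by (simp add: bessel_coeff_def power_mult)
  qed
  have "(complex_of_real s / 2) powr of_real \<nu> = of_real ((s / 2) powr \<nu>)"
    using powr_of_real[of "s/2" \<nu>] assms by simp
  moreover have "(\<Sum>j. complex_of_real (bessel_coeff \<nu> j * ((s / 2)^2)^j)) = of_real (bessel_series \<nu> ((s/2)^2))"
    unfolding bessel_series_def by (rule suminf_of_real[symmetric]) (rule summable_bessel_series)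
  ultimately show ?thesis
    unfolding bessel_J_def t real_J_def by simp
qed

lemma real_J_deriv:
  assumes "s > 0"
  shows "(real_J \<nu> has_real_derivative \<nu> / s * real_J \<nu> s - real_J (\<nu> + 1) s) (at s)"
proof -
  have "(real_J \<nu> has_real_derivative
      \<nu> * (s / 2) powr (\<nu> - 1) * (1 / 2) * bessel_series \<nu> ((s / 2)^2) +
      (s / 2) powr \<nu> * (- bessel_series (\<nu> + 1) ((s / 2)^2) * (s / 2))) (at s)"
    unfolding real_J_def[abs_def]
    by (rule derivative_eq_intros refl DERIV_chain2[OF bessel_series_deriv] | use assms in simp)+
  moreover have p: "(s / 2) powr (\<nu> - 1) = (s / 2) powr \<nu> * (2 / s)" "(s / 2) powr (\<nu> + 1) = (s / 2) powr \<nu> * (s / 2)"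
    using assms by (simp_all add: powr_diff powr_add)
  have "\<nu> * (P * (2 / s)) * (1 / 2) * a + P * (- b * (s / 2)) = \<nu> / s * (P * a) - P * (s / 2) * b" for P a b
    using assms by (simp add: field_simps)
  ultimately show ?thesis
    unfolding real_J_def p by (rule DERIV_cong)
qed

text \<open>Obtained from the previous rule at order \<open>\<nu> + 1\<close> by eliminating order
  \<open>\<nu> + 2\<close> with the recurrence. The orders \<open>\<nu>\<close> and
  \<open>\<nu> + 1\<close> thereby form a closed first-order system, which the energy estimate
  needs.\<close>

lemma real_J_deriv2:
  assumes "s > 0"
  shows "(real_J (\<nu> + 1) has_real_derivative real_J \<nu> s - (\<nu> + 1) / s * real_J (\<nu> + 1) s) (at s)"
proof -
  have "(s / 2) powr 1 = s / 2" using assms by simp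
  then have p: "(s / 2) powr (\<nu> + 1) = (s / 2) powr \<nu> * (s / 2)"
    "(s / 2) powr (\<nu> + 1 + 1) = (s / 2) powr \<nu> * (s / 2) * (s / 2)"
    by (simp_all only: powr_add)
  have "P * (s/2) * (s/2) * d = 2 * (\<nu> + 1) / s * (P * (s/2) * e) - P * ((\<nu> + 1) * e - (s/2)^2 * d)"
    for P d e :: real using assms by (simp add: field_simps power2_eq_square)
  from this[of "(s/2) powr \<nu>" "bessel_series (\<nu> + 2) ((s/2)^2)" "bessel_series (\<nu> + 1) ((s/2)^2)"]
  have "real_J (\<nu> + 1 + 1) s = 2 * (\<nu> + 1) / s * real_J (\<nu> + 1) s - real_J \<nu> s"
    unfolding real_J_def p bessel_series_rec[of \<nu> "(s/2)^2", symmetric] by (simp add: add.assoc)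
  then have "(\<nu> + 1) / s * real_J (\<nu> + 1) s - real_J (\<nu> + 1 + 1) s = real_J \<nu> s - (\<nu> + 1) / s * real_J (\<nu> + 1) s"
    by (simp only: times_divide_eq_left)
  from DERIV_cong[OF real_J_deriv[OF assms, of "\<nu> + 1"] this] show ?thesis .
qed

lemma continuous_on_real_J: "continuous_on {0<..} (real_J \<nu>)"
  by (meson DERIV_isCont continuous_at_imp_continuous_on greaterThan_iff real_J_deriv)

text \<open>The energy \<open>J\<^sub>\<nu>\<^sup>2 + J\<^bsub>\<nu>+1\<^esub>\<^sup>2\<close> grows at most like a power, which the power series does not show.\<close>

lemma real_J_growth:
  "\<exists>C>0. \<forall>s\<ge>1. \<bar>real_J \<nu> s\<bar> \<le> C * s powr (\<bar>\<nu>\<bar> + 1)"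
proof -
  define c where "c = \<bar>\<nu>\<bar> + 1"
  define E where "E s = (real_J \<nu> s)^2 + (real_J (\<nu> + 1) s)^2" for s
  \<comment> \<open>The summand 1 only secures \<open>C > 0\<close> should \<open>E 1\<close>
    vanish.\<close>
  define C where "C = sqrt (E 1) + 1"
  have E0: "E s \<ge> 0" for s by (simp add: E_def)
  have "\<bar>real_J \<nu> s\<bar> \<le> C * s powr c" if s: "s \<ge> 1" for s
  proof -
    have "E s * s powr (- 2 * c) \<le> E 1 * 1 powr (- 2 * c)"
    proof (rule DERIV_nonpos_imp_nonincreasing[OF s])
      fix t assume t: "1 \<le> t" "t \<le> s"
      \<comment> \<open>The cross terms of the derivative cancel. The remaining coefficients
        \<open>2 * \<nu> / t\<close> and \<open>- 2 * (\<nu> + 1) / t\<close> are both at most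
        \<open>2 * c / t\<close>, so \<open>E t * t powr (- 2 * c)\<close> does not
        increase.\<close>
      define D where "D = 2 * real_J \<nu> t * (\<nu> / t * real_J \<nu> t - real_J (\<nu> + 1) t)
          + 2 * real_J (\<nu> + 1) t * (real_J \<nu> t - (\<nu> + 1) / t * real_J (\<nu> + 1) t)"
      have "(E has_real_derivative D) (at t)"
        unfolding E_def D_def
        by (rule DERIV_cong[OF DERIV_add[OF DERIV_power[OF real_J_deriv, of t \<nu> 2]
              DERIV_power[OF real_J_deriv2, of t \<nu> 2]]]) (use t in auto)
      then have "((\<lambda>t. E t * t powr (- 2 * c)) has_real_derivative
          D * t powr (- 2 * c) + E t * (- 2 * c * t powr (- 2 * c - 1))) (at t)"
        using t by (auto intro!: derivative_eq_intros simp: powr_diff algebra_simps)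
      moreover have "D * t powr (- 2 * c) + E t * (- 2 * c * t powr (- 2 * c - 1)) \<le> 0"
      proof -
        have "D = (2 * \<nu> * (real_J \<nu> t)^2 - 2 * (\<nu> + 1) * (real_J (\<nu> + 1) t)^2) / t"
          using t by (simp add: D_def field_simps power2_eq_square)
        moreover have "2 * \<nu> * (real_J \<nu> t)^2 \<le> 2 * c * (real_J \<nu> t)^2"
          "- (2 * (\<nu> + 1)) * (real_J (\<nu> + 1) t)^2 \<le> 2 * c * (real_J (\<nu> + 1) t)^2"
          by (intro mult_right_mono; simp add: c_def; fail)+
        ultimately have "D \<le> 2 * c * E t / t"
          using t by (simp add: E_def divide_right_mono algebra_simps)
        then have "D * t powr (- 2 * c) \<le> 2 * c * E t / t * t powr (- 2 * c)"
          by (rule mult_right_mono) simp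
        then show ?thesis using t by (simp add: powr_diff algebra_simps)
      qed
      ultimately show "\<exists>y. ((\<lambda>t. E t * t powr (- 2 * c)) has_real_derivative y) (at t) \<and> y \<le> 0"
        by blast
    qed
    then have "E s * s powr (- 2 * c) * s powr (2 * c) \<le> E 1 * s powr (2 * c)"
      by (intro mult_right_mono) auto
    moreover have "s powr (- 2 * c) * s powr (2 * c) = 1"
      using s by (simp flip: powr_add)
    moreover have "s powr (2 * c) = (s powr c)^2"
      by (simp only: mult_2 powr_add power2_eq_square)
    ultimately have "E s \<le> E 1 * (s powr c)^2"
      by (simp only: mult.assoc mult_1_right)
    moreover have "(real_J \<nu> s)^2 \<le> E s" by (simp add: E_def)
    ultimately have "(real_J \<nu> s)^2 \<le> (sqrt (E 1) * s powr c)^2"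
      unfolding power_mult_distrib real_sqrt_pow2[OF E0] by (rule order_trans[rotated])
    then have "\<bar>real_J \<nu> s\<bar> \<le> sqrt (E 1) * s powr c"
      by (rule power2_le_imp_le[of "\<bar>real_J \<nu> s\<bar>", unfolded power2_abs]) (simp add: E0)
    also have "\<dots> \<le> C * s powr c" by (simp add: C_def mult_right_mono)
    finally show ?thesis .
  qed
  moreover have "C > 0" using E0[of 1] by (simp add: C_def add_nonneg_pos)
  ultimately show ?thesis unfolding c_def by blast
qed

text \<open>Agrees with \<open>hankel1\<close> at nonintegral order only: at integral order the
  quotient is 0 by the convention on division, whereas \<open>bessel_Y\<close> takes a limit
  there.\<close>

definition real_H :: "real \<Rightarrow> real \<Rightarrow> complex" where
  "real_H \<nu> s = Complex (real_J \<nu> s) ((real_J \<nu> s * cos (\<nu> * pi) - real_J (- \<nu>) s) / sin (\<nu> * pi))"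

lemma hankel1_of_real:
  assumes "s > 0" "\<nu> \<notin> \<int>"
  shows "hankel1 (of_real \<nu>) (of_real s) = real_H \<nu> s"
proof -
  have "complex_of_real \<nu> \<notin> \<int>"
    using assms(2) by (metis Ints_cases Ints_of_int of_real_eq_iff of_real_of_int_eq)
  moreover have "bessel_J (- of_real \<nu>) (of_real s) = of_real (real_J (- \<nu>) s)"
    using bessel_J_of_real[OF assms(1), of "- \<nu>"] by simp
  moreover have "cos (complex_of_real \<nu> * of_real pi) = of_real (cos (\<nu> * pi))"
    "sin (complex_of_real \<nu> * of_real pi) = of_real (sin (\<nu> * pi))"
    by (metis cos_of_real of_real_mult, metis sin_of_real of_real_mult)
  ultimately show ?thesis
    by (simp add: hankel1_def bessel_Y_def real_H_def bessel_J_of_real[OF assms(1)] Complex_eq)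
qed

lemma continuous_on_real_H: "continuous_on {0<..} (real_H \<nu>)"
  unfolding real_H_def[abs_def] Complex_eq
  by (cases "sin (\<nu> * pi) = 0") (auto intro!: continuous_intros continuous_on_real_J)

text \<open>Near 0 the order \<open>- \<nu>\<close> contributes the singularity
  \<open>s powr (- \<nu>)\<close>; for large arguments the growth exponent \<open>\<nu> + 1\<close>
  is at most 3. Cubic growth is far from sharp but harmless against rapidly decaying Fourier
  transforms.\<close>

lemma real_H_bound:
  assumes "0 < \<nu>" "\<nu> \<le> 2"
  shows "\<exists>C>0. \<forall>s>0. cmod (real_H \<nu> s) \<le> C * (s powr (- \<nu>) + s^3)"
proof -
  obtain C1 where C1: "C1 > 0" "\<And>s. s \<ge> 1 \<Longrightarrow> \<bar>real_J \<nu> s\<bar> \<le> C1 * s powr (\<bar>\<nu>\<bar> + 1)"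
    using real_J_growth[of \<nu>] by blast
  obtain C2 where C2: "C2 > 0" "\<And>s. s \<ge> 1 \<Longrightarrow> \<bar>real_J (- \<nu>) s\<bar> \<le> C2 * s powr (\<bar>- \<nu>\<bar> + 1)"
    using real_J_growth[of "- \<nu>"] by blast
  have b: "\<exists>C>0. \<forall>x\<in>{0..1}. \<bar>bessel_series \<alpha> x\<bar> \<le> C" for \<alpha>
  proof -
    have "bounded (bessel_series \<alpha> ` {0..1})"
      by (intro compact_imp_bounded compact_continuous_image continuous_on_bessel_series compact_Icc)
    then show ?thesis by (auto simp: bounded_pos)
  qed
  obtain C3 where C3: "C3 > 0" "\<And>x. x \<in> {0..1} \<Longrightarrow> \<bar>bessel_series \<nu> x\<bar> \<le> C3" using b by blast
  obtain C4 where C4: "C4 > 0" "\<And>x. x \<in> {0..1} \<Longrightarrow> \<bar>bessel_series (- \<nu>) x\<bar> \<le> C4" using b by blast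
  define K where "K = C1 + C2 + C3 + 2 powr \<nu> * C4"
  have K: "K > 0" "C1 \<le> K" "C2 \<le> K" "C3 \<le> K" "2 powr \<nu> * C4 \<le> K"
    using C1(1) C2(1) C3(1) C4(1) by (simp_all add: K_def add_pos_pos)
  have J: "\<bar>real_J \<nu> s\<bar> \<le> K * (s powr (- \<nu>) + s^3)" "\<bar>real_J (- \<nu>) s\<bar> \<le> K * (s powr (- \<nu>) + s^3)"
    if s: "s > 0" for s
  proof -
    have "\<bar>real_J \<nu> s\<bar> \<le> K * (s powr (- \<nu>) + s^3) \<and> \<bar>real_J (- \<nu>) s\<bar> \<le> K * (s powr (- \<nu>) + s^3)"
    proof (cases "s \<ge> 1")
      case True
      have "s powr (\<nu> + 1) \<le> s powr 3" using True assms by (intro powr_mono) auto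
      then have p: "s powr (\<nu> + 1) \<le> s powr (- \<nu>) + s^3" using s by (simp add: add_increasing)
      have "\<bar>real_J \<nu> s\<bar> \<le> C1 * s powr (\<nu> + 1)" "\<bar>real_J (- \<nu>) s\<bar> \<le> C2 * s powr (\<nu> + 1)"
        using C1(2)[OF True] C2(2)[OF True] assms by simp_all
      moreover have "C1 * s powr (\<nu> + 1) \<le> K * (s powr (- \<nu>) + s^3)" "C2 * s powr (\<nu> + 1) \<le> K * (s powr (- \<nu>) + s^3)"
        using K p s by (intro mult_mono; simp)+
      ultimately show ?thesis by linarith
    next
      case False
      have "(s/2)^2 \<le> 1^2" using s False by (intro power_mono) auto
      then have i: "(s/2)^2 \<in> {0..1}" by simp
      have p1: "1 \<le> s powr (- \<nu>)" using s False assms by (simp add: powr_minus one_le_inverse_iff powr_le1)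
      have "(s/2) powr \<nu> \<le> 1" using s False assms by (intro powr_le1) auto
      then have "\<bar>real_J \<nu> s\<bar> \<le> 1 * C3"
        unfolding real_J_def abs_mult using C3(2)[OF i] by (intro mult_mono) auto
      also have "\<dots> \<le> K * (s powr (- \<nu>) + s^3)" using mult_mono[of C3 K 1 "s powr (- \<nu>) + s^3"] K p1 s C3(1) zero_less_power[OF s, of 3] by simp
      finally have 1: "\<bar>real_J \<nu> s\<bar> \<le> K * (s powr (- \<nu>) + s^3)" .
      have "(s/2) powr (- \<nu>) = 2 powr \<nu> * s powr (- \<nu>)" using s by (simp add: powr_divide powr_minus_divide)
      then have "\<bar>real_J (- \<nu>) s\<bar> = 2 powr \<nu> * s powr (- \<nu>) * \<bar>bessel_series (- \<nu>) ((s/2)^2)\<bar>"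
        unfolding real_J_def abs_mult by simp
      also have "\<dots> \<le> 2 powr \<nu> * s powr (- \<nu>) * C4" using C4(2)[OF i] by (intro mult_left_mono) auto
      also have "\<dots> = (2 powr \<nu> * C4) * s powr (- \<nu>)" by simp
      also have "\<dots> \<le> K * (s powr (- \<nu>) + s^3)" using K s by (intro mult_mono) auto
      finally show ?thesis using 1 by simp
    qed
    then show "\<bar>real_J \<nu> s\<bar> \<le> K * (s powr (- \<nu>) + s^3)" "\<bar>real_J (- \<nu>) s\<bar> \<le> K * (s powr (- \<nu>) + s^3)" by (rule conjunct1, rule conjunct2)
  qed
  \<comment> \<open>If the sine is 0, then \<open>A = 0\<close>, and the imaginary part to be
    bounded is 0 as well.\<close>
  define A where "A = 1 / \<bar>sin (\<nu> * pi)\<bar>"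
  have "cmod (real_H \<nu> s) \<le> (1 + 2 * A) * K * (s powr (- \<nu>) + s^3)" if s: "s > 0" for s
  proof -
    let ?B = "K * (s powr (- \<nu>) + s^3)"
    have "\<bar>real_J \<nu> s\<bar> * \<bar>cos (\<nu> * pi)\<bar> \<le> \<bar>real_J \<nu> s\<bar>"
      by (rule mult_left_le) simp_all
    then have "\<bar>real_J \<nu> s * cos (\<nu> * pi)\<bar> \<le> ?B"
      unfolding abs_mult using J(1)[OF s] by (rule order_trans)
    then have "\<bar>real_J \<nu> s * cos (\<nu> * pi) - real_J (- \<nu>) s\<bar> \<le> 2 * ?B"
      unfolding mult_2 using J(2)[OF s] by (rule order_trans[OF abs_triangle_ineq4 add_mono])
    then have "\<bar>(real_J \<nu> s * cos (\<nu> * pi) - real_J (- \<nu>) s) / sin (\<nu> * pi)\<bar> \<le> 2 * ?B * A"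
      unfolding abs_divide A_def times_divide_eq_right mult_1_right by (rule divide_right_mono) simp
    moreover have e: "(1 + 2 * A) * K * X = K * X + 2 * (K * X) * A" for X by (simp add: algebra_simps)
    ultimately show ?thesis
      using cmod_le[of "real_H \<nu> s"] J(1)[OF s] unfolding real_H_def complex.sel unfolding e by linarith
  qed
  moreover have "(1 + 2 * A) * K > 0" using K(1) by (simp add: A_def add_pos_nonneg)
  ultimately show ?thesis by (intro exI[of _ "(1 + 2 * A) * K"] conjI allI impI)
qed

text \<open>By the reflection formula this equals \<open>2 powr \<nu> * Gamma \<nu> / pi\<close> at
  nonintegral order, the usual constant in the small-argument behaviour of the Hankel
  function.\<close>

definition hankel_limit :: "real \<Rightarrow> real" where
  "hankel_limit \<nu> = 2 powr \<nu> * rGamma (1 - \<nu>) / sin (\<nu> * pi)"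

text \<open>Multiplied by \<open>s powr \<nu>\<close>, the order \<open>\<nu>\<close> behaves like
  \<open>s powr (2 * \<nu>)\<close> and disappears, while for the order \<open>- \<nu>\<close> the
  powers cancel and a continuous series remains.\<close>

lemma real_H_limit:
  assumes "\<nu> > 0"
  shows "((\<lambda>s. of_real (s powr \<nu>) * real_H \<nu> s) \<longlongrightarrow> - \<i> * of_real (hankel_limit \<nu>)) (at_right 0)"
proof -
  have sq: "((\<lambda>s::real. (s / 2)^2) \<longlongrightarrow> 0) (at_right 0)"
    by (rule tendsto_eq_intros refl | simp)+
  have e: "((\<lambda>s. bessel_series \<alpha> ((s/2)^2)) \<longlongrightarrow> bessel_series \<alpha> 0) (at_right 0)" for \<alpha>
    by (rule isCont_tendsto_compose[OF DERIV_isCont[OF bessel_series_deriv] sq])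
  have e0: "bessel_series (- \<nu>) 0 = rGamma (1 - \<nu>)"
    by (simp add: bessel_series_def powser_zero) (simp add: bessel_coeff_def)
  have pw: "((\<lambda>s::real. s powr (2 * \<nu>)) \<longlongrightarrow> 0) (at_right 0)"
    using assms by (intro tendsto_zero_powrI[where b = "2 * \<nu>"] tendsto_intros) (auto simp: eventually_at_filter)
  have pos: "eventually (\<lambda>s::real. s > 0) (at_right 0)" by (simp add: eventually_at_right_less)
  have "((\<lambda>s. s powr (2 * \<nu>) * 2 powr (- \<nu>) * bessel_series \<nu> ((s/2)^2)) \<longlongrightarrow> 0 * 2 powr (- \<nu>) * bessel_series \<nu> 0) (at_right 0)"
    by (intro tendsto_intros pw e)
  moreover have "eventually (\<lambda>s. s powr (2 * \<nu>) * 2 powr (- \<nu>) * bessel_series \<nu> ((s/2)^2) = s powr \<nu> * real_J \<nu> s) (at_right 0)"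
    using pos
  proof eventually_elim
    case (elim s)
    have "s powr (2 * \<nu>) = s powr \<nu> * s powr \<nu>" by (simp only: mult_2 powr_add)
    moreover have "(s/2) powr \<nu> = s powr \<nu> * 2 powr (- \<nu>)" using elim by (simp add: powr_divide powr_minus_divide)
    ultimately show ?case by (simp add: real_J_def)
  qed
  ultimately have 1: "((\<lambda>s. s powr \<nu> * real_J \<nu> s) \<longlongrightarrow> 0) (at_right 0)"
    unfolding mult_zero_left by (rule Lim_transform_eventually)
  have "((\<lambda>s. 2 powr \<nu> * bessel_series (- \<nu>) ((s/2)^2)) \<longlongrightarrow> 2 powr \<nu> * bessel_series (- \<nu>) 0) (at_right 0)"
    by (intro tendsto_intros e)
  moreover have "eventually (\<lambda>s. 2 powr \<nu> * bessel_series (- \<nu>) ((s/2)^2) = s powr \<nu> * real_J (- \<nu>) s) (at_right 0)"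
    using pos
  proof eventually_elim
    case (elim s)
    have "s powr \<nu> * (s/2) powr (- \<nu>) = 2 powr \<nu>" using elim by (simp add: powr_divide powr_minus_divide)
    then show ?case by (simp add: real_J_def flip: mult.assoc)
  qed
  ultimately have 2: "((\<lambda>s. s powr \<nu> * real_J (- \<nu>) s) \<longlongrightarrow> 2 powr \<nu> * rGamma (1 - \<nu>)) (at_right 0)"
    unfolding e0 by (rule Lim_transform_eventually)
  have "((\<lambda>s. Complex (s powr \<nu> * real_J \<nu> s)
      (((s powr \<nu> * real_J \<nu> s) * cos (\<nu> * pi) - s powr \<nu> * real_J (- \<nu>) s) * inverse (sin (\<nu> * pi)))) \<longlongrightarrow>
      Complex 0 ((0 * cos (\<nu> * pi) - 2 powr \<nu> * rGamma (1 - \<nu>)) * inverse (sin (\<nu> * pi)))) (at_right 0)"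
    by (intro tendsto_Complex tendsto_intros 1 2)
  moreover have "of_real (s powr \<nu>) * real_H \<nu> s = Complex (s powr \<nu> * real_J \<nu> s)
      (((s powr \<nu> * real_J \<nu> s) * cos (\<nu> * pi) - s powr \<nu> * real_J (- \<nu>) s) * inverse (sin (\<nu> * pi)))" for s
    unfolding real_H_def divide_inverse by (simp add: complex_eq_iff right_diff_distrib mult.assoc)
  moreover have "Complex 0 ((0 * cos (\<nu> * pi) - 2 powr \<nu> * rGamma (1 - \<nu>)) * inverse (sin (\<nu> * pi)))
     = - \<i> * of_real (hankel_limit \<nu>)"
  proof -
    have "(0 * cos (\<nu> * pi) - 2 powr \<nu> * rGamma (1 - \<nu>)) * inverse (sin (\<nu> * pi)) = - hankel_limit \<nu>"
      unfolding hankel_limit_def divide_inverse by simp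
    moreover have "Complex 0 (- x) = - \<i> * of_real x" for x by (simp add: complex_eq_iff)
    ultimately show ?thesis by simp
  qed
  ultimately show ?thesis by (simp only:)
qed

lemma hankel_limit_nonzero:
  assumes "0 < \<nu>" "\<nu> \<notin> \<int>"
  shows "hankel_limit \<nu> \<noteq> 0"
proof -
  have "1 - \<nu> \<notin> \<int>" using assms(2) using Ints_diff[OF Ints_1, of "1 - \<nu>"] by auto
  then have "rGamma (1 - \<nu>) \<noteq> 0" unfolding rGamma_eq_zero_iff using nonpos_Ints_Int by blast
  moreover have "sin (\<nu> * pi) \<noteq> 0" using assms(2) unfolding sin_zero_iff_int2 by auto
  ultimately show ?thesis by (simp add: hankel_limit_def)
qed

section \<open>Fourier transforms of test functions\<close>

lemma lborel_integral_affine: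
  fixes g :: "real^3 \<Rightarrow> complex"
  assumes c: "c \<noteq> 0" and g: "g \<in> borel_measurable borel"
  shows "(LINT x|lborel. g x) = \<bar>c\<bar>^3 *\<^sub>R (LINT x|lborel. g (t + c *\<^sub>R x))"
proof -
  have "(LINT x|lborel. g x) = (LINT x|density (distr lborel borel (\<lambda>x. t + c *\<^sub>R x)) (\<lambda>_. \<bar>c\<bar>^DIM(real^3)). g x)"
    using lborel_affine[OF c, of t] by simp
  also have "\<dots> = (LINT x|density (distr lborel borel (\<lambda>x. t + c *\<^sub>R x)) (\<lambda>_. ennreal (\<bar>c\<bar>^3)). g x)"
    by (simp add: ennreal_power)
  also have "\<dots> = (LINT x|distr lborel borel (\<lambda>x. t + c *\<^sub>R x). \<bar>c\<bar>^3 *\<^sub>R g x)"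
    by (rule integral_density) (use g in auto)
  also have "\<dots> = (LINT x|lborel. \<bar>c\<bar>^3 *\<^sub>R g (t + c *\<^sub>R x))"
    by (rule integral_distr) (use g in auto)
  finally show ?thesis by simp
qed

lemma continuous_AE_zero_imp_zero:
  fixes g :: "'a::euclidean_space \<Rightarrow> 'b::t1_space"
  assumes "open U" "continuous_on U g" "AE x in lborel. x \<in> U \<longrightarrow> g x = c" "x \<in> U"
  shows "g x = c"
proof (rule ccontr)
  assume x: "g x \<noteq> c"
  define V where "V = {x\<in>U. g x \<noteq> c}"
  have V: "V = U \<inter> g -` (- {c})" by (auto simp: V_def)
  have "open V" unfolding V by (rule continuous_open_preimage[OF assms(2,1)]) auto
  then have "V \<in> sets lborel" by simp
  moreover have "AE x in lborel. x \<notin> V" using assms(3) by eventually_elim (auto simp: V_def)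
  ultimately have "V \<in> null_sets lborel" by (simp add: AE_iff_null_sets)
  then have "negligible V" by (simp add: negligible_iff_null_sets null_sets_completionI)
  then show False using open_not_negligible[OF \<open>open V\<close>] x assms(4) by (auto simp: V_def)
qed

section \<open>Supports and closure properties of test functions\<close>

lemma not_in_supp: "x \<notin> supp f \<Longrightarrow> f x = 0"
  using closure_subset[of "support_on UNIV f"] by (auto simp: supp_def support_on_def)

lemma supp_subset:
  assumes "closed S" "\<And>x. x \<notin> S \<Longrightarrow> f x = 0"
  shows "supp f \<subseteq> S"
  unfolding supp_def by (rule closure_minimal[OF _ assms(1)]) (use assms(2) in \<open>auto simp: support_on_def\<close>)

lemma closed_supp: "closed (supp f)"
  by (simp add: supp_def)

lemma test_functionD:
  assumes "test_function f"
  shows test_function_continuous: "continuous_on UNIV f"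
    and test_function_differentiable: "f differentiable (at x)"
    and test_function_compact: "compact (supp f)"
  using assms unfolding test_function_def smooth_def
  by (auto dest: spec[of _ 0], metis higher_differentiable.simps(2))

lemma test_function_continuous_on: "test_function f \<Longrightarrow> continuous_on S f"
  using test_function_continuous continuous_on_subset by blast

lemma supp_deriv_subset: "supp (\<lambda>x. frechet_derivative f (at x) v) \<subseteq> supp f"
proof (rule supp_subset[OF closed_supp])
  fix x assume x: "x \<notin> supp f"
  have "(f has_derivative (\<lambda>_. 0)) (at x)"
    by (rule has_derivative_transform_within_open[of "\<lambda>_. 0" _ _ _ "- supp f"])
      (use x closed_supp not_in_supp in \<open>auto intro!: derivative_eq_intros\<close>)
  then show "frechet_derivative f (at x) v = 0"
    by (metis frechet_derivative_at)
qed

lemma test_function_deriv: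
  assumes "test_function f"
  shows "test_function (\<lambda>x. frechet_derivative f (at x) v)"
proof -
  have "compact (supp (\<lambda>x. frechet_derivative f (at x) v))"
    using compact_Int_closed[OF test_function_compact[OF assms] closed_supp, of "\<lambda>x. frechet_derivative f (at x) v"]
      supp_deriv_subset[of f v] by (simp add: Int_absorb1)
  then show ?thesis
    using assms unfolding test_function_def smooth_def by (metis higher_differentiable.simps(2))
qed

lemma higher_differentiable_lincomb:
  "higher_differentiable n f \<Longrightarrow> higher_differentiable n g \<Longrightarrow> higher_differentiable n (\<lambda>x. a * f x + b * g x)"
proof (induction n arbitrary: f g)
  case 0
  then show ?case by (auto intro!: continuous_intros)
next
  case (Suc n)
  have d: "((\<lambda>x. a * f x + b * g x) has_derivative
      (\<lambda>v. a * frechet_derivative f (at x) v + b * frechet_derivative g (at x) v)) (at x)" for x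
    using Suc.prems by (auto intro!: derivative_intros simp: frechet_derivative_works)
  have "frechet_derivative (\<lambda>x. a * f x + b * g x) (at x) v =
      a * frechet_derivative f (at x) v + b * frechet_derivative g (at x) v" for x v
    using frechet_derivative_at[OF d[of x]] by metis
  then show ?case
    using d Suc by (auto simp: differentiable_def)
qed

lemma test_function_lincomb:
  assumes "test_function f" "test_function g"
  shows "test_function (\<lambda>x. a * f x + b * g x)"
proof -
  have "supp (\<lambda>x. a * f x + b * g x) \<subseteq> supp f \<union> supp g"
    by (rule supp_subset) (auto intro: closed_supp simp: not_in_supp)
  then have "compact (supp (\<lambda>x. a * f x + b * g x))"
    using compact_Int_closed[OF compact_Un[OF test_function_compact test_function_compact] closed_supp] assms
    by (metis Int_absorb1)
  then show ?thesis
    using assms higher_differentiable_lincomb by (auto simp: test_function_def smooth_def)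
qed

lemma test_function_scale: "test_function f \<Longrightarrow> test_function (\<lambda>x. a * f x)"
  using test_function_lincomb[of f f a 0] by simp

lemma test_function_zero: "test_function (\<lambda>x. 0)"
proof -
  have "higher_differentiable n (\<lambda>x. 0)" for n
    by (induction n) (simp_all add: frechet_derivative_const)
  then show ?thesis by (simp add: test_function_def smooth_def supp_def support_on_def)
qed

section \<open>Fourier transform: linearity, boundedness, continuity and scaling\<close>

lemma integrable_test_function:
  fixes h :: "real^3 \<Rightarrow> 'b::{banach, second_countable_topology}"
  assumes "test_function f" "continuous_on UNIV h"
  shows "integrable lborel (\<lambda>x. f x *\<^sub>R h x)"
proof -
  have "integrable lborel (\<lambda>x. indicator (supp f) x *\<^sub>R (f x *\<^sub>R h x))"
    by (intro borel_integrable_compact test_function_compact continuous_on_scaleR test_function_continuous_on assms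
        continuous_on_subset[OF assms(2)]) simp
  moreover have "indicator (supp f) x *\<^sub>R (f x *\<^sub>R h x) = f x *\<^sub>R h x" for x
    using not_in_supp[of x f] by (auto simp: indicator_def)
  ultimately show ?thesis by (simp only:)
qed

lemma integrable_test_function_real: 
  "test_function f \<Longrightarrow> continuous_on UNIV h \<Longrightarrow> integrable lborel (\<lambda>x. f x * h x :: real)"
  using integrable_test_function[of f h] by simp

lemma integrable_fourier:
  assumes "test_function f"
  shows "integrable lborel (\<lambda>x. complex_of_real (f x) * exp (- (\<i> * complex_of_real (k \<bullet> x))))"
  using integrable_test_function[OF assms, of "\<lambda>x. exp (- (\<i> * complex_of_real (k \<bullet> x)))"]
  by (simp add: scaleR_conv_of_real continuous_intros)

lemma fourier_lincomb:
  assumes "test_function f" "test_function g"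
  shows "fourier (\<lambda>x. a * f x + b * g x) k = of_real a * fourier f k + of_real b * fourier g k"
proof -
  have "fourier (\<lambda>x. a * f x + b * g x) k =
    (LINT x|lborel. of_real a * (complex_of_real (f x) * exp (- (\<i> * complex_of_real (k \<bullet> x))))
       + of_real b * (complex_of_real (g x) * exp (- (\<i> * complex_of_real (k \<bullet> x)))))"
    unfolding fourier_def by (simp add: algebra_simps)
  also have "\<dots> = of_real a * fourier f k + of_real b * fourier g k"
    unfolding fourier_def using integrable_fourier[OF assms(1), of k] integrable_fourier[OF assms(2), of k]
    by (subst Bochner_Integration.integral_add) auto
  finally show ?thesis .
qed

lemma fourier_bound:
  assumes "test_function f"
  shows "cmod (fourier f k) \<le> (LINT x|lborel. \<bar>f x\<bar>)"
  unfolding fourier_def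
  by (rule integral_norm_bound[THEN order_trans]) (simp add: norm_mult)

lemma borel_measurable_test_function: "test_function f \<Longrightarrow> f \<in> borel_measurable borel"
  by (rule borel_measurable_continuous_onI) (rule test_function_continuous)

lemma continuous_on_fourier:
  assumes f: "test_function f"
  shows "continuous_on S (fourier f)"
proof (rule continuous_on_sequentiallyI)
  fix u :: "nat \<Rightarrow> real^3" and a assume u: "u \<longlonglongrightarrow> a"
  have [measurable]: "f \<in> borel_measurable borel" by (rule borel_measurable_test_function[OF f])
  show "(\<lambda>n. fourier f (u n)) \<longlonglongrightarrow> fourier f a"
    unfolding fourier_def
  proof (rule integral_dominated_convergence[where w = "\<lambda>x. \<bar>f x\<bar>"])
    show "integrable lborel (\<lambda>x. \<bar>f x\<bar>)"
      using integrable_test_function_real[OF f, of "\<lambda>_. 1"] by simp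
    show "AE x in lborel. (\<lambda>n. complex_of_real (f x) * exp (- (\<i> * complex_of_real (u n \<bullet> x)))) \<longlonglongrightarrow>
       complex_of_real (f x) * exp (- (\<i> * complex_of_real (a \<bullet> x)))"
      using u by (auto intro!: tendsto_intros)
  qed (auto simp: norm_mult)
qed

lemma fourier_scale:
  assumes f: "test_function f" and R: "R > 0"
  shows "fourier (\<lambda>x. f (x /\<^sub>R R)) k = of_real (R^3) * fourier f (R *\<^sub>R k)"
proof -
  have [measurable]: "f \<in> borel_measurable borel" by (rule borel_measurable_test_function[OF f])
  have "fourier (\<lambda>x. f (x /\<^sub>R R)) k = \<bar>R\<bar>^3 *\<^sub>R (LINT x|lborel.
      complex_of_real (f ((0 + R *\<^sub>R x) /\<^sub>R R)) * exp (- (\<i> * complex_of_real (k \<bullet> (0 + R *\<^sub>R x)))))"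
    unfolding fourier_def by (rule lborel_integral_affine) (use R in auto)
  then show ?thesis using R by (simp add: fourier_def scaleR_conv_of_real[where 'a=complex])
qed

text \<open>The derivative is a limit of difference quotients, and a translate has the same
  transform up to a phase. Dominated convergence exchanges limit and integral, so no integration by
  parts occurs.\<close>

lemma fourier_deriv:
  assumes f: "test_function f"
  shows "fourier (\<lambda>x. frechet_derivative f (at x) v) k = \<i> * of_real (k \<bullet> v) * fourier f k"
proof -
  define D where "D x = frechet_derivative f (at x) v" for x
  define E where "E x = exp (- (\<i> * complex_of_real (k \<bullet> x)))" for x
  have [measurable]: "f \<in> borel_measurable borel" by (rule borel_measurable_test_function[OF f])
  have tD: "test_function D" unfolding D_def[abs_def] by (rule test_function_deriv[OF f])
  then have [measurable]: "D \<in> borel_measurable borel" by (rule borel_measurable_test_function)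
  have [measurable]: "E \<in> borel_measurable borel" unfolding E_def by measurable
  have nE: "cmod (E x) = 1" for x by (simp add: E_def)
  have "bounded (D ` supp D)"
    by (intro compact_imp_bounded compact_continuous_image test_function_compact test_function_continuous_on tD)
  then obtain M where M: "M > 0" "\<And>x. x \<in> supp D \<Longrightarrow> \<bar>D x\<bar> \<le> M"
    by (auto simp: bounded_pos)
  have M': "\<bar>D x\<bar> \<le> M" for x using M not_in_supp[of x D] by (cases "x \<in> supp D") auto
  have line: "((\<lambda>s. f (x + s *\<^sub>R v)) has_real_derivative D (x + s *\<^sub>R v)) (at s)" for x s
  proof -
    have "(f has_derivative frechet_derivative f (at (x + s *\<^sub>R v))) (at (x + s *\<^sub>R v))"
      using test_function_differentiable[OF f] frechet_derivative_works by blast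
    moreover have "((\<lambda>s. x + s *\<^sub>R v) has_derivative (\<lambda>h. h *\<^sub>R v)) (at s)"
      by (auto intro!: derivative_eq_intros)
    ultimately have "((\<lambda>s. f (x + s *\<^sub>R v)) has_derivative (\<lambda>h. frechet_derivative f (at (x + s *\<^sub>R v)) (h *\<^sub>R v))) (at s)"
      using has_derivative_compose[where f = "\<lambda>s. x + s *\<^sub>R v" and g = f] by blast
    moreover have "frechet_derivative f (at (x + s *\<^sub>R v)) (h *\<^sub>R v) = D (x + s *\<^sub>R v) * h" for h
      using linear_frechet_derivative[OF test_function_differentiable[OF f]]
      by (simp add: D_def linear_scale)
    ultimately show ?thesis by (simp add: has_field_derivative_def)
  qed
  have lip: "\<bar>f (x + t *\<^sub>R v) - f x\<bar> \<le> M * t" if t: "t > 0" for x t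
  proof -
    obtain z where "f (x + t *\<^sub>R v) - f (x + 0 *\<^sub>R v) = (t - 0) * D (x + z *\<^sub>R v)"
      using MVT2[OF t, of "\<lambda>s. f (x + s *\<^sub>R v)" "\<lambda>s. D (x + s *\<^sub>R v)"] line by blast
    then show ?thesis using t M'[of "x + z *\<^sub>R v"] by (simp add: abs_mult mult.commute)
  qed
  \<comment> \<open>\<open>K\<close> consists of the points \<open>x\<close> such that
    \<open>x + s *\<^sub>R v\<close> lies in the support of \<open>f\<close> for some
    \<open>s\<close> between 0 and 1. Difference quotients with step at most 1 vanish off
    \<open>K\<close>, so \<open>M\<close> times its indicator dominates them all.\<close>
  define K where "K = (\<lambda>p. fst p - snd p *\<^sub>R v) ` (supp f \<times> {0..1})"
  have K: "compact K"
    unfolding K_def using test_function_compact[OF f]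
    by (intro compact_continuous_image compact_Times) (auto intro!: continuous_intros)
  have inK: "x \<in> K" if t: "0 < t" "t \<le> 1" "f (x + t *\<^sub>R v) - f x \<noteq> 0" for x t
  proof -
    consider "x \<in> supp f" | "x + t *\<^sub>R v \<in> supp f"
      using t(3) not_in_supp[of x f] not_in_supp[of "x + t *\<^sub>R v" f] by force
    then show ?thesis
    proof cases
      case 1 then show ?thesis unfolding K_def by (intro image_eqI[of _ _ "(x, 0)"]) auto
    next
      case 2 then show ?thesis unfolding K_def using t by (intro image_eqI[of _ _ "(x + t *\<^sub>R v, t)"]) auto
    qed
  qed
  define t where "t n = inverse (real (Suc n))" for n
  have t: "0 < t n" "t n \<le> 1" for n by (auto simp: t_def inverse_le_1_iff)
  have t0: "t \<longlonglongrightarrow> 0" unfolding t_def by (rule LIMSEQ_inverse_real_of_nat)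
  have t0': "filterlim t (at 0) sequentially"
    using t0 t(1) by (auto simp: filterlim_at intro!: always_eventually) (metis less_irrefl)
  define q where "q n x = complex_of_real ((f (x + t n *\<^sub>R v) - f x) / t n) * E x" for n x
  have "(\<lambda>n. LINT x|lborel. q n x) \<longlonglongrightarrow> (LINT x|lborel. complex_of_real (D x) * E x)"
  proof (rule integral_dominated_convergence[where w = "\<lambda>x. indicator K x * M"])
    show "(\<lambda>x. complex_of_real (D x) * E x) \<in> borel_measurable lborel" by measurable
    show "q n \<in> borel_measurable lborel" for n unfolding q_def by measurable
    show "integrable lborel (\<lambda>x. indicator K x * M)"
      using K by (auto intro!: emeasure_compact_finite borel_compact integrable_mult_left)
    show "AE x in lborel. (\<lambda>n. q n x) \<longlonglongrightarrow> complex_of_real (D x) * E x"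
    proof (rule AE_I2)
      fix x
      have "((\<lambda>h. (f (x + (0 + h) *\<^sub>R v) - f (x + 0 *\<^sub>R v)) / h) \<longlongrightarrow> D (x + 0 *\<^sub>R v)) (at 0)"
        using line[of x 0] unfolding DERIV_def .
      from filterlim_compose[OF this t0']
      have "(\<lambda>n. (f (x + t n *\<^sub>R v) - f x) / t n) \<longlonglongrightarrow> D x" by simp
      then show "(\<lambda>n. q n x) \<longlonglongrightarrow> complex_of_real (D x) * E x"
        unfolding q_def by (intro tendsto_intros)
    qed
    show "AE x in lborel. norm (q n x) \<le> indicator K x * M" for n
    proof (rule AE_I2)
      fix x
      show "norm (q n x) \<le> indicator K x * M"
        using lip[OF t(1), of x n] inK[OF t, of x n] t(1)[of n]
        by (cases "x \<in> K") (auto simp: q_def norm_mult nE abs_divide pos_divide_le_eq simp del: of_real_divide of_real_diff)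
    qed
  qed
  \<comment> \<open>By translation invariance the difference quotient of \<open>f\<close> becomes a
    difference quotient of the phase, multiplied by \<open>fourier f k\<close>.\<close>
  moreover have "(LINT x|lborel. q n x) = (exp (\<i> * of_real (k \<bullet> v) * of_real (t n)) - 1) / of_real (t n) * fourier f k" for n
  proof -
    have i1: "integrable lborel (\<lambda>x. complex_of_real (f x) * E x)"
      unfolding E_def by (rule integrable_fourier[OF f])
    have sh: "complex_of_real (f (x + t n *\<^sub>R v)) * E x
        = exp (\<i> * of_real (k \<bullet> v) * of_real (t n)) * (complex_of_real (f (t n *\<^sub>R v + 1 *\<^sub>R x)) * E (t n *\<^sub>R v + 1 *\<^sub>R x))" for x
      by (simp add: E_def inner_add_right add.commute mult.left_commute flip: exp_add) (simp add: algebra_simps flip: exp_add)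
    have "(LINT x|lborel. complex_of_real (f x) * E x) =
      (LINT x|lborel. complex_of_real (f (t n *\<^sub>R v + 1 *\<^sub>R x)) * E (t n *\<^sub>R v + 1 *\<^sub>R x))"
      using lborel_integral_affine[of 1 "\<lambda>x. complex_of_real (f x) * E x" "t n *\<^sub>R v"] by simp
    then have L: "(LINT x|lborel. complex_of_real (f (x + t n *\<^sub>R v)) * E x)
       = exp (\<i> * of_real (k \<bullet> v) * of_real (t n)) * fourier f k"
      unfolding sh by (simp add: fourier_def E_def)
    have i2: "integrable lborel (\<lambda>x. complex_of_real (f (x + t n *\<^sub>R v)) * E x)"
    proof -
      have "integrable lborel (\<lambda>x. complex_of_real (f (t n *\<^sub>R v + x)) * E (t n *\<^sub>R v + x))"
        using i1 by (subst (asm) lborel_distr_plus[of "t n *\<^sub>R v", symmetric]) (simp add: integrable_distr_eq)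
      then show ?thesis unfolding sh by simp
    qed
    have "q n x = (complex_of_real (f (x + t n *\<^sub>R v)) * E x - complex_of_real (f x) * E x) / of_real (t n)" for x
      by (simp add: q_def field_simps)
    then have "(LINT x|lborel. q n x) = ((LINT x|lborel. complex_of_real (f (x + t n *\<^sub>R v)) * E x) - (LINT x|lborel. complex_of_real (f x) * E x)) / of_real (t n)"
      using i1 i2 by simp
    then show ?thesis unfolding L by (simp add: fourier_def E_def field_simps)
  qed
  moreover have "(\<lambda>n. (exp (\<i> * of_real (k \<bullet> v) * of_real (t n)) - 1) / of_real (t n) * fourier f k) \<longlonglongrightarrow> \<i> * of_real (k \<bullet> v) * fourier f k"
  proof -
    have "((\<lambda>z. exp (\<i> * of_real (k \<bullet> v) * z)) has_field_derivative \<i> * of_real (k \<bullet> v)) (at 0)"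
      by (auto intro!: derivative_eq_intros)
    then have "((\<lambda>h. (exp (\<i> * of_real (k \<bullet> v) * (0 + h)) - exp (\<i> * of_real (k \<bullet> v) * 0)) / h) \<longlongrightarrow> \<i> * of_real (k \<bullet> v)) (at 0)"
      unfolding DERIV_def .
    moreover have "filterlim (\<lambda>n. complex_of_real (t n)) (at 0) sequentially"
    proof -
      have "(\<lambda>n. complex_of_real (t n)) \<longlonglongrightarrow> of_real 0" by (intro tendsto_of_real t0)
      moreover have "t n \<noteq> 0" for n using t(1)[of n] by simp
      ultimately show ?thesis by (simp add: filterlim_at)
    qed
    ultimately have "(\<lambda>n. (exp (\<i> * of_real (k \<bullet> v) * of_real (t n)) - 1) / of_real (t n)) \<longlonglongrightarrow> \<i> * of_real (k \<bullet> v)"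
      using filterlim_compose by fastforce
    then show ?thesis by (intro tendsto_intros)
  qed
  ultimately have "(LINT x|lborel. complex_of_real (D x) * E x) = \<i> * of_real (k \<bullet> v) * fourier f k"
    using LIMSEQ_unique by auto
  then show ?thesis by (simp add: fourier_def D_def E_def)
qed

section \<open>The Laplacian and the decay of Fourier transforms\<close>

definition laplacian :: "(real^3 \<Rightarrow> real) \<Rightarrow> real^3 \<Rightarrow> real" where
  "laplacian f x = (\<Sum>b\<in>Basis. frechet_derivative (\<lambda>y. frechet_derivative f (at y) b) (at x) b)"

lemma test_function_sum:
  assumes "finite I" "\<And>i. i \<in> I \<Longrightarrow> test_function (f i)"
  shows "test_function (\<lambda>x. \<Sum>i\<in>I. f i x)"
  using assms
proof (induction I rule: finite_induct)
  case empty
  then show ?case using test_function_zero by simp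
next
  case (insert i I)
  then show ?case using test_function_lincomb[of "f i" "\<lambda>x. \<Sum>i\<in>I. f i x" 1 1] by simp
qed

lemma fourier_sum:
  assumes "finite I" "\<And>i. i \<in> I \<Longrightarrow> test_function (f i)"
  shows "fourier (\<lambda>x. \<Sum>i\<in>I. f i x) k = (\<Sum>i\<in>I. fourier (f i) k)"
  using assms
proof (induction I rule: finite_induct)
  case empty
  then show ?case by (simp add: fourier_def)
next
  case (insert i I)
  then have "test_function (\<lambda>x. \<Sum>i\<in>I. f i x)" using test_function_sum by blast
  then show ?case using insert fourier_lincomb[of "f i" "\<lambda>x. \<Sum>i\<in>I. f i x" 1 1] by simp
qed

lemma test_function_laplacian: "test_function f \<Longrightarrow> test_function (laplacian f)"
  unfolding laplacian_def[abs_def] by (rule test_function_sum) (auto intro: test_function_deriv)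

lemma supp_laplacian: "supp (laplacian f) \<subseteq> supp f"
proof (rule supp_subset[OF closed_supp])
  fix x assume "x \<notin> supp f"
  then have "frechet_derivative (\<lambda>y. frechet_derivative f (at y) b) (at x) b = 0" for b
    using supp_deriv_subset[of f b] supp_deriv_subset[of "\<lambda>y. frechet_derivative f (at y) b" b] not_in_supp
    by blast
  then show "laplacian f x = 0" by (simp add: laplacian_def)
qed

lemma fourier_laplacian:
  assumes "test_function f"
  shows "fourier (laplacian f) k = - of_real ((norm k)^2) * fourier f k"
proof -
  have "fourier (laplacian f) k = (\<Sum>b\<in>Basis. \<i> * of_real (k \<bullet> b) * (\<i> * of_real (k \<bullet> b) * fourier f k))"
    unfolding laplacian_def[abs_def]
    by (subst fourier_sum) (auto simp: fourier_deriv test_function_deriv assms)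
  also have "\<dots> = - of_real (\<Sum>b\<in>Basis. (k \<bullet> b)^2) * fourier f k"
  proof -
    have "\<i> * of_real a * (\<i> * of_real a * z) = - of_real (a^2) * z" for a and z :: complex
      by (simp add: power2_eq_square algebra_simps)
    then show ?thesis by (simp add: sum_distrib_right sum_negf)
  qed
  also have "(\<Sum>b\<in>Basis. (k \<bullet> b)^2) = (norm k)^2"
    unfolding power2_norm_eq_inner euclidean_inner[of k k] by (simp only: power2_eq_square)
  finally show ?thesis .
qed

text \<open>Each Laplacian yields two more powers of \<open>norm k\<close>; the base case is the
  bound by the integral of \<open>\<bar>f x\<bar>\<close>.\<close>

lemma fourier_decay:
  assumes "test_function f"
  shows "\<exists>C. \<forall>k. norm k ^ (2 * N) * cmod (fourier f k) \<le> C"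
  using assms
proof (induction N arbitrary: f)
  case 0
  then show ?case using fourier_bound by auto
next
  case (Suc N)
  then obtain C where C: "\<And>k. norm k ^ (2 * N) * cmod (fourier (laplacian f) k) \<le> C"
    using test_function_laplacian by blast
  have "norm k ^ (2 * Suc N) * cmod (fourier f k) \<le> C" for k
    using C[of k] unfolding fourier_laplacian[OF Suc.prems] norm_mult norm_minus_cancel
    by (simp add: norm_mult norm_power power2_eq_square mult_ac)
  then show ?case by blast
qed

section \<open>Injectivity of the Fourier transform on test functions\<close>

inductive trig_poly :: "(real^3 \<Rightarrow> complex) \<Rightarrow> bool" where
  char: "trig_poly (\<lambda>x. c * exp (- (\<i> * complex_of_real (k \<bullet> x))))"
| add: "trig_poly f \<Longrightarrow> trig_poly g \<Longrightarrow> trig_poly (\<lambda>x. f x + g x)"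

lemma trig_poly_mult_char:
  "trig_poly g \<Longrightarrow> trig_poly (\<lambda>x. (c * exp (- (\<i> * complex_of_real (k \<bullet> x)))) * g x)"
proof (induction rule: trig_poly.induct)
  case (char d l)
  have "c * exp (- (\<i> * complex_of_real (k \<bullet> x))) * (d * exp (- (\<i> * complex_of_real (l \<bullet> x)))) =
      (c * d) * exp (- (\<i> * complex_of_real ((k + l) \<bullet> x)))" for x
  proof -
    have "exp (- (\<i> * complex_of_real (k \<bullet> x))) * exp (- (\<i> * complex_of_real (l \<bullet> x))) =
        exp (- (\<i> * complex_of_real ((k + l) \<bullet> x)))"
      unfolding mult_exp_exp by (simp add: inner_add_left distrib_left)
    then show ?thesis by (simp add: mult_ac)
  qed
  then show ?case using trig_poly.char[of "c * d" "k + l"] by (simp only:)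
next
  case (add f g)
  then show ?case using trig_poly.add by (simp add: distrib_left)
qed

lemma trig_poly_mult: "trig_poly f \<Longrightarrow> trig_poly g \<Longrightarrow> trig_poly (\<lambda>x. f x * g x)"
proof (induction rule: trig_poly.induct)
  case (char c k)
  then show ?case by (rule trig_poly_mult_char)
next
  case (add f h)
  then show ?case using trig_poly.add[of "\<lambda>x. f x * g x" "\<lambda>x. h x * g x"] by (simp add: distrib_right)
qed

lemma continuous_on_trig_poly: "trig_poly g \<Longrightarrow> continuous_on UNIV g"
  by (induction rule: trig_poly.induct) (auto intro!: continuous_intros)

text \<open>Stone-Weierstrass: the real-valued trigonometric polynomials form an algebra containing
  the constants, and shifted cosines separate points.\<close>

lemma trig_poly_approx:
  assumes "compact S" "continuous_on S f" "e > 0"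
  obtains g where "trig_poly (\<lambda>x. complex_of_real (g x))" "\<And>x. x \<in> S \<Longrightarrow> \<bar>f x - g x\<bar> < e"
proof -
  interpret function_ring_on "{g. trig_poly (\<lambda>x. complex_of_real (g x))}" S
  proof unfold_locales
    show "compact S" by fact
    show "continuous_on S g" if "g \<in> {g. trig_poly (\<lambda>x. complex_of_real (g x))}" for g
    proof -
      have "continuous_on UNIV (\<lambda>x. Re (complex_of_real (g x)))"
        using that by (intro continuous_intros continuous_on_trig_poly) auto
      then show ?thesis using continuous_on_subset by auto
    qed
    show "(\<lambda>x. f x + g x) \<in> {g. trig_poly (\<lambda>x. complex_of_real (g x))}"
      if "f \<in> {g. trig_poly (\<lambda>x. complex_of_real (g x))}" "g \<in> {g. trig_poly (\<lambda>x. complex_of_real (g x))}" for f g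
      using that trig_poly.add by auto
    show "(\<lambda>x. f x * g x) \<in> {g. trig_poly (\<lambda>x. complex_of_real (g x))}"
      if "f \<in> {g. trig_poly (\<lambda>x. complex_of_real (g x))}" "g \<in> {g. trig_poly (\<lambda>x. complex_of_real (g x))}" for f g
      using that trig_poly_mult by auto
    show "(\<lambda>_. c) \<in> {g. trig_poly (\<lambda>x. complex_of_real (g x))}" for c
      using trig_poly.char[of "of_real c" 0] by simp
    show "\<exists>f\<in>{g. trig_poly (\<lambda>x. complex_of_real (g x))}. f x \<noteq> f y" if "x \<noteq> y" for x y
    proof -
      \<comment> \<open>Normalised to make the phase between \<open>x\<close> and \<open>y\<close>
        equal to 1, so that the cosine takes the distinct values \<open>cos 1\<close> and
        \<open>cos 0\<close>.\<close>
      define k where "k = (1 / ((x - y) \<bullet> (x - y))) *\<^sub>R (x - y)"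
      have k: "k \<bullet> (x - y) = 1" using that by (simp add: k_def)
      have "complex_of_real (cos (k \<bullet> (z - y))) =
          (exp (\<i> * (k \<bullet> y)) / 2) * exp (- (\<i> * complex_of_real (k \<bullet> z))) +
          (exp (- (\<i> * (k \<bullet> y))) / 2) * exp (- (\<i> * complex_of_real ((- k) \<bullet> z)))" for z
        by (simp add: cos_of_real[symmetric] cos_exp_eq inner_diff_right algebra_simps add_divide_distrib flip: exp_add)
      then have "trig_poly (\<lambda>z. complex_of_real (cos (k \<bullet> (z - y))))"
        using trig_poly.add[OF trig_poly.char trig_poly.char] by presburger
      moreover have "cos (k \<bullet> (x - y)) \<noteq> cos (k \<bullet> (y - y))"
        unfolding k using cos_monotone_0_pi[of 0 1] pi_gt3 by simp
      ultimately show ?thesis by (intro bexI[of _ "\<lambda>z. cos (k \<bullet> (z - y))"]) auto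
    qed
  qed
  show thesis using Stone_Weierstrass_basic[OF assms(2,3)] that by blast
qed

text \<open>If its transform vanishes, \<open>f\<close> is orthogonal to every trigonometric
  polynomial. Choosing one within \<open>e\<close> of \<open>f\<close> on the support bounds the
  integral of \<open>f x * f x\<close> by \<open>e\<close> times that of
  \<open>\<bar>f x\<bar>\<close>, for every positive \<open>e\<close>.\<close>

lemma fourier_eq_zero_imp:
  assumes f: "test_function f" and zero: "\<And>k. fourier f k = 0"
  shows "f x = 0"
proof -
  have orth: "(LINT x|lborel. complex_of_real (f x) * g x) = 0 \<and> integrable lborel (\<lambda>x. complex_of_real (f x) * g x)"
    if "trig_poly g" for g
    using that
  proof (induction rule: trig_poly.induct)
    case (char c k)
    have "complex_of_real (f x) * (c * exp (- (\<i> * complex_of_real (k \<bullet> x)))) =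
      c * (complex_of_real (f x) * exp (- (\<i> * complex_of_real (k \<bullet> x))))" for x by simp
    then show ?case using integrable_fourier[OF f, of k] zero[of k] unfolding fourier_def
      by (simp only: integral_mult_right_zero integrable_mult_right mult_zero_right simp_thms)
  next
    case (add g h)
    then show ?case by (simp add: distrib_left)
  qed
  have if1: "integrable lborel (\<lambda>x. \<bar>f x\<bar>)"
    using integrable_test_function_real[OF f, of "\<lambda>_. 1"] by simp
  have if2: "integrable lborel (\<lambda>x. f x * f x)"
    by (rule integrable_test_function_real[OF f test_function_continuous[OF f]])
  define I where "I = (LINT x|lborel. \<bar>f x\<bar>)"
  have I0: "I \<ge> 0" unfolding I_def by simp
  have small: "(LINT x|lborel. f x * f x) \<le> e * I" if e: "e > 0" for e
  proof -
    obtain g where g: "trig_poly (\<lambda>x. complex_of_real (g x))" "\<And>x. x \<in> supp f \<Longrightarrow> \<bar>f x - g x\<bar> < e"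
      using trig_poly_approx[OF test_function_compact[OF f] test_function_continuous_on[OF f] e] by blast
    have "integrable lborel (\<lambda>x. complex_of_real (f x * g x))" "(LINT x|lborel. complex_of_real (f x * g x)) = 0"
      using orth[OF g(1)] by auto
    then have fg: "integrable lborel (\<lambda>x. f x * g x)" "(LINT x|lborel. f x * g x) = 0"
      by (simp_all only: complex_of_real_integrable_eq integral_complex_of_real of_real_eq_0_iff)
    have "(LINT x|lborel. f x * f x) = (LINT x|lborel. f x * f x - f x * g x)"
      using fg if2 by simp
    also have "\<dots> \<le> (LINT x|lborel. e * \<bar>f x\<bar>)"
    proof (rule integral_mono)
      fix x
      have "f x * f x - f x * g x \<le> \<bar>f x\<bar> * \<bar>f x - g x\<bar>"
        by (metis abs_ge_self abs_mult right_diff_distrib)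
      also have "\<dots> \<le> \<bar>f x\<bar> * e"
        using g(2)[of x] not_in_supp[of x f] by (cases "x \<in> supp f") (auto intro: mult_left_mono)
      finally show "f x * f x - f x * g x \<le> e * \<bar>f x\<bar>" by (simp add: mult.commute)
    qed (use fg if2 if1 in auto)
    finally show ?thesis by (simp add: I_def)
  qed
  have "(LINT x|lborel. f x * f x) \<le> 0"
  proof (rule field_le_epsilon)
    fix e :: real assume "e > 0"
    then have "(LINT x|lborel. f x * f x) \<le> e / (I + 1) * I" using I0 by (intro small) simp
    also have "\<dots> \<le> e" using I0 \<open>e > 0\<close> by (simp add: field_simps)
    finally show "(LINT x|lborel. f x * f x) \<le> 0 + e" by simp
  qed
  then have "(LINT x|lborel. f x * f x) = 0" by (simp add: antisym)
  then have "AE x in lborel. f x * f x = 0"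
    using integral_nonneg_eq_0_iff_AE[OF if2] by simp
  then have "AE x in lborel. x \<in> UNIV \<longrightarrow> f x = 0" by simp
  from continuous_AE_zero_imp_zero[OF open_UNIV test_function_continuous[OF f] this UNIV_I] show ?thesis .
qed

section \<open>Integrability of powers of the norm\<close>

lemma emeasure_cball_cubed:
  "r \<ge> 0 \<Longrightarrow> emeasure lborel (cball (0::real^3) r) = ennreal (unit_ball_vol 3 * r^3)"
  using emeasure_cball[of r "0::real^3"] by simp

text \<open>A replacement for polar coordinates: \<open>g\<close> is dominated by the sum of
  \<open>a j\<close> times the indicator of the ball of radius \<open>r j\<close>, whose volume is
  proportional to \<open>r j ^ 3\<close>. Full balls instead of shells keep the volumes
  simple.\<close>

lemma nn_integral_dyadic_finite:
  fixes g :: "real^3 \<Rightarrow> real" and a r :: "nat \<Rightarrow> real"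
  assumes "\<And>j. a j \<ge> 0" "\<And>j. r j \<ge> 0" "summable (\<lambda>j. a j * r j ^ 3)"
    and cover: "\<And>q. g q > 0 \<Longrightarrow> \<exists>j. norm q \<le> r j \<and> g q \<le> a j"
  shows "(\<integral>\<^sup>+q. ennreal (g q) \<partial>lborel) < \<infinity>"
proof -
  have "(\<integral>\<^sup>+q. ennreal (g q) \<partial>lborel) \<le> (\<integral>\<^sup>+q. (\<Sum>j. ennreal (a j) * indicator (cball (0::real^3) (r j)) q) \<partial>lborel)"
  proof (rule nn_integral_mono)
    fix q :: "real^3"
    show "ennreal (g q) \<le> (\<Sum>j. ennreal (a j) * indicator (cball 0 (r j)) q)"
    proof (cases "g q > 0")
      case True
      then obtain j where j: "norm q \<le> r j" "g q \<le> a j" using cover by blast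
      have "ennreal (g q) \<le> ennreal (a j) * indicator (cball 0 (r j)) q"
        using j by (simp add: ennreal_leI)
      also have "\<dots> \<le> (\<Sum>j. ennreal (a j) * indicator (cball 0 (r j)) q)"
      proof -
        have "F j \<le> (\<Sum>j. F j)" for F :: "nat \<Rightarrow> ennreal" using sum_le_suminf[of F "{j}"] by simp
        then show ?thesis .
      qed
      finally show ?thesis .
    next
      case False
      then have "ennreal (g q) = 0" by (intro ennreal_neg) simp
      then show ?thesis by simp
    qed
  qed
  also have "\<dots> = (\<Sum>j. ennreal (a j) * emeasure lborel (cball (0::real^3) (r j)))"
  proof (subst nn_integral_suminf)
    show "(\<lambda>q. ennreal (a j) * indicator (cball (0::real^3) (r j)) q) \<in> borel_measurable lborel" for j
      by (intro borel_measurable_times_ennreal borel_measurable_const borel_measurable_indicator) simp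
  qed (simp add: nn_integral_cmult_indicator)
  also have "\<dots> = (\<Sum>j. ennreal (unit_ball_vol 3 * (a j * r j ^ 3)))"
    using assms by (simp add: emeasure_cball_cubed ennreal_mult'[symmetric] mult_ac)
  also have "\<dots> < \<infinity>"
    using assms unit_ball_vol_nonneg[of 3]
    by (subst suminf_ennreal2) (auto intro!: summable_mult)
  finally show ?thesis .
qed

lemma nn_integral_norm_powr_near_zero:
  assumes "0 \<le> p" "p < 3"
  shows "(\<integral>\<^sup>+q. ennreal (indicator (cball 0 1) q * norm (q::real^3) powr (- p)) \<partial>lborel) < \<infinity>"
\<comment> \<open>\<open>a j\<close> bounds the power on the shell from
  \<open>2 powr (- (j + 1))\<close> to \<open>2 powr (- j)\<close>; with the volume factor the terms
  are geometric of ratio \<open>2 powr (p - 3)\<close>.\<close>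
proof (rule nn_integral_dyadic_finite[where a = "\<lambda>j. 2 powr (p * (real j + 1))" and r = "\<lambda>j. 2 powr (- real j)"])
  have "2 powr (p * (real j + 1)) * (2 powr (- real j)) ^ 3 = 2 powr p * (2 powr (p - 3)) ^ j" for j
  proof -
    have "2 powr (p * (real j + 1)) * (2 powr (- real j)) ^ 3 = 2 powr (p * (real j + 1)) * 2 powr (3 * - real j)"
      by (simp add: powr_powr mult.commute flip: powr_realpow)
    also have "\<dots> = 2 powr p * 2 powr ((p - 3) * real j)"
      by (simp add: algebra_simps flip: powr_add)
    finally show ?thesis by (simp add: powr_powr flip: powr_realpow)
  qed
  moreover have "summable (\<lambda>j. 2 powr p * (2 powr (p - 3)) ^ j)"
    using assms powr_less_mono[of "p - 3" 0 2] by (intro summable_mult summable_geometric) simp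
  ultimately show "summable (\<lambda>j. 2 powr (p * (real j + 1)) * (2 powr (- real j)) ^ 3)" by simp
next
  fix q :: "real^3"
  assume "0 < indicator (cball 0 1) q * norm q powr (- p)"
  \<comment> \<open>Positivity of the integrand excludes the origin, because
    \<open>0 powr (- p)\<close> is 0.\<close>
  then have q: "0 < norm q" "norm q \<le> 1" by (cases "norm q \<le> 1"; auto)+
  define j where "j = nat \<lfloor>- log 2 (norm q)\<rfloor>"
  have "0 \<le> - log 2 (norm q)" using q by (simp add: log_le_zero_cancel_iff)
  then have "real j \<le> - log 2 (norm q)" "- log 2 (norm q) \<le> real j + 1" unfolding j_def by linarith+
  then have j: "norm q \<le> 2 powr (- real j)" "2 powr (- (real j + 1)) \<le> norm q"
    using q by (simp_all add: le_powr_iff powr_le_iff)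
  have "norm q powr (- p) \<le> (2 powr (- (real j + 1))) powr (- p)"
    using assms j(2) by (intro powr_mono2') auto
  also have "\<dots> = 2 powr (p * (real j + 1))" by (simp add: powr_powr algebra_simps)
  finally show "\<exists>j. norm q \<le> 2 powr (- real j) \<and>
      indicator (cball 0 1) q * norm q powr (- p) \<le> 2 powr (p * (real j + 1))"
    using j(1) q by auto
qed auto

lemma nn_integral_norm_powr_at_infinity:
  assumes "3 < p"
  shows "(\<integral>\<^sup>+q. ennreal (indicator (- cball 0 1) q * norm (q::real^3) powr (- p)) \<partial>lborel) < \<infinity>"
\<comment> \<open>The shells now run from \<open>2 powr j\<close> to \<open>2 powr (j + 1)\<close>,
  and the ratio of the geometric series is \<open>2 powr (3 - p)\<close>.\<close>
proof (rule nn_integral_dyadic_finite[where a = "\<lambda>j. 2 powr (- p * real j)" and r = "\<lambda>j. 2 powr (real j + 1)"])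
  have "2 powr (- p * real j) * (2 powr (real j + 1)) ^ 3 = 8 * (2 powr (3 - p)) ^ j" for j
  proof -
    have "2 powr (- p * real j) * (2 powr (real j + 1)) ^ 3 = 2 powr (- p * real j) * 2 powr (3 * (real j + 1))"
      by (simp add: powr_powr mult.commute flip: powr_realpow)
    also have "\<dots> = 2 powr (3 + (3 - p) * real j)"
      by (simp add: algebra_simps flip: powr_add)
    also have "\<dots> = 8 * 2 powr ((3 - p) * real j)" by (simp add: powr_add)
    finally show ?thesis by (simp add: powr_powr flip: powr_realpow)
  qed
  moreover have "summable (\<lambda>j. 8 * (2 powr (3 - p)) ^ j)"
    using assms powr_less_mono[of "3 - p" 0 2] by (intro summable_mult summable_geometric) simp
  ultimately show "summable (\<lambda>j. 2 powr (- p * real j) * (2 powr (real j + 1)) ^ 3)" by simp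
next
  fix q :: "real^3"
  assume "0 < indicator (- cball 0 1) q * norm q powr (- p)"
  then have q: "1 < norm q" by (cases "norm q \<le> 1") auto
  define j where "j = nat \<lfloor>log 2 (norm q)\<rfloor>"
  from q have q0: "0 < norm q" by linarith
  have "0 \<le> log 2 (norm q)" using q q0 by (subst zero_le_log_cancel_iff) auto
  then have "real j \<le> log 2 (norm q)" "log 2 (norm q) \<le> real j + 1" unfolding j_def by linarith+
  then have j: "norm q \<le> 2 powr (real j + 1)" "2 powr real j \<le> norm q"
    using q0 by (simp_all add: le_powr_iff powr_le_iff)
  have "norm q powr (- p) \<le> (2 powr real j) powr (- p)"
    using assms j(2) by (intro powr_mono2') auto
  also have "\<dots> = 2 powr (- p * real j)" by (simp add: powr_powr mult.commute)
  finally show "\<exists>j. norm q \<le> 2 powr (real j + 1) \<and>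
      indicator (- cball 0 1) q * norm q powr (- p) \<le> 2 powr (- p * real j)"
    using j(1) q by auto
qed auto

lemma integrable_two_powers:
  assumes "0 \<le> a" "a < 3" "3 < b"
  shows "integrable lborel (\<lambda>q::real^3. indicator (cball 0 1) q * norm q powr (- a) + indicator (- cball 0 1) q * norm q powr (- b))"
proof (rule Bochner_Integration.integrable_add)
  show "integrable lborel (\<lambda>q::real^3. indicator (cball 0 1) q * norm q powr (- a))"
    using nn_integral_norm_powr_near_zero[OF assms(1,2)]
    by (intro integrableI_nonneg) (measurable, auto)
  show "integrable lborel (\<lambda>q::real^3. indicator (- cball 0 1) q * norm q powr (- b))"
    using nn_integral_norm_powr_at_infinity[OF assms(3)]
    by (intro integrableI_nonneg) (measurable, auto)
qed

section \<open>Uniform lower bounds from pointwise limits\<close>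

text \<open>Compactness of the unit sphere and Fatou's lemma turn pointwise convergence to a linearly
  independent family into a uniform lower bound.\<close>

lemma eventually_coercive:
  fixes v :: "real \<Rightarrow> 'n::finite \<Rightarrow> 'a \<Rightarrow> complex" and V :: "'n \<Rightarrow> 'a \<Rightarrow> complex"
  assumes meas: "\<And>L i. L > 0 \<Longrightarrow> v L i \<in> borel_measurable M"
    and lim: "\<And>i. AE q in M. ((\<lambda>L. v L i q) \<longlongrightarrow> V i q) at_top"
    and indep: "\<And>\<theta>::real^'n. AE q in M. (\<Sum>i\<in>UNIV. of_real (\<theta> $ i) * V i q) = 0 \<Longrightarrow> \<theta> = 0"
  shows "\<exists>c>0. \<exists>\<Lambda>>0. \<forall>L\<ge>\<Lambda>. \<forall>\<theta>::real^'n.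
    ennreal (c * (norm \<theta>)^2) \<le> (\<integral>\<^sup>+q. ennreal ((cmod (\<Sum>i\<in>UNIV. of_real (\<theta> $ i) * v L i q))^2) \<partial>M)"
proof (rule ccontr)
  define Q where "Q L \<theta> = (\<integral>\<^sup>+q. ennreal ((cmod (\<Sum>i\<in>UNIV. of_real (\<theta> $ i) * v L i q))^2) \<partial>M)"
    for L and \<theta> :: "real^'n"
  assume "\<not> ?thesis"
  then have neg: "\<exists>L\<ge>\<Lambda>. \<exists>\<theta>. Q L \<theta> < ennreal (c * (norm \<theta>)^2)" if "c > 0" "\<Lambda> > 0" for c \<Lambda> :: real
    unfolding Q_def using that by (meson not_le)
  have "\<exists>L\<ge>real (Suc n). \<exists>\<psi>. norm \<psi> = 1 \<and> Q L \<psi> \<le> ennreal (1 / real (Suc n))" for n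
  proof -
    \<comment> \<open>The negated claim at constant \<open>1 / (n + 1)\<close> and threshold
      \<open>n + 1\<close>. Both sides are quadratic in \<open>\<theta>\<close>, so the witness can
      be moved to the unit sphere.\<close>
    obtain L \<theta> where L: "L \<ge> real (Suc n)" and \<theta>: "Q L \<theta> < ennreal (1 / real (Suc n) * (norm \<theta>)^2)"
      using neg[of "1 / real (Suc n)" "real (Suc n)"] by auto
    have "\<theta> \<noteq> 0"
    proof
      assume "\<theta> = 0" with \<theta> show False by simp
    qed
    then have n0: "norm \<theta> > 0" by simp
    have [measurable]: "v L i \<in> borel_measurable M" for i using meas L by simp
    define \<psi> where "\<psi> = \<theta> /\<^sub>R norm \<theta>"
    have "(\<Sum>i\<in>UNIV. complex_of_real (\<psi> $ i) * v L i q) = of_real (1 / norm \<theta>) * (\<Sum>i\<in>UNIV. of_real (\<theta> $ i) * v L i q)" for q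
      by (simp add: \<psi>_def sum_distrib_left divide_inverse mult.assoc)
    then have sc: "(cmod (\<Sum>i\<in>UNIV. of_real (\<psi> $ i) * v L i q))^2
        = 1 / (norm \<theta>)^2 * (cmod (\<Sum>i\<in>UNIV. of_real (\<theta> $ i) * v L i q))^2" for q
      by (simp add: norm_divide power_divide)
    have "Q L \<psi> = (\<integral>\<^sup>+q. ennreal (1 / (norm \<theta>)^2) * ennreal ((cmod (\<Sum>i\<in>UNIV. of_real (\<theta> $ i) * v L i q))^2) \<partial>M)"
      unfolding Q_def sc by (rule nn_integral_cong) (rule ennreal_mult', simp)
    also have "\<dots> = ennreal (1 / (norm \<theta>)^2) * Q L \<theta>"
      unfolding Q_def by (rule nn_integral_cmult) measurable
    also have "\<dots> \<le> ennreal (1 / (norm \<theta>)^2) * ennreal (1 / real (Suc n) * (norm \<theta>)^2)"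
      using \<theta> by (intro mult_left_mono) auto
    also have "\<dots> = ennreal (1 / real (Suc n))"
      using n0 by (simp add: ennreal_mult'[symmetric] del: of_nat_Suc)
    finally show ?thesis using L n0 by (intro exI[of _ L] conjI exI[of _ \<psi>]) (auto simp: \<psi>_def)
  qed
  then obtain L \<psi> where L: "\<And>n. L n \<ge> real (Suc n)" and \<psi>: "\<And>n. norm (\<psi> n) = 1"
    and Q: "\<And>n. Q (L n) (\<psi> n) \<le> ennreal (1 / real (Suc n))"
    by metis
  have "compact (sphere (0::real^'n) 1)" "\<And>n. \<psi> n \<in> sphere 0 1" using \<psi> by auto
  then obtain \<theta> r where \<theta>: "\<theta> \<in> sphere 0 1" and r: "strict_mono r" and conv: "(\<psi> \<circ> r) \<longlonglongrightarrow> \<theta>"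
    unfolding compact_def by meson
  have Lpos: "L n > 0" for n using L[of n] by simp
  have Linf: "filterlim (\<lambda>n. L (r n)) at_top sequentially"
  proof (rule filterlim_at_top_mono[OF filterlim_real_sequentially])
    have "real n \<le> L (r n)" for n
      using L[of "r n"] seq_suble[OF r, of n] by linarith
    then show "\<forall>\<^sub>F n in sequentially. real n \<le> L (r n)" by simp
  qed
  define u where "u n q = ennreal ((cmod (\<Sum>i\<in>UNIV. of_real (\<psi> (r n) $ i) * v (L (r n)) i q))^2)" for n q
  have um: "u n \<in> borel_measurable M" for n
  proof -
    have [measurable]: "v (L (r n)) i \<in> borel_measurable M" for i using meas[OF Lpos] .
    show ?thesis unfolding u_def by measurable
  qed
  have "AE q in M. \<forall>i. ((\<lambda>L. v L i q) \<longlongrightarrow> V i q) at_top"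
    using lim by (simp add: AE_all_countable)
  then have lm: "AE q in M. liminf (\<lambda>n. u n q) = ennreal ((cmod (\<Sum>i\<in>UNIV. of_real (\<theta> $ i) * V i q))^2)"
  proof eventually_elim
    case (elim q)
    have "(\<lambda>n. u n q) \<longlonglongrightarrow> ennreal ((cmod (\<Sum>i\<in>UNIV. of_real (\<theta> $ i) * V i q))^2)"
      unfolding u_def
      using conv filterlim_compose[OF spec[OF elim] Linf]
      by (intro tendsto_ennrealI tendsto_intros) (auto simp: o_def intro: tendsto_vec_nth)
    then show ?case by (intro lim_imp_Liminf) auto
  qed
  from lm have "(\<integral>\<^sup>+q. ennreal ((cmod (\<Sum>i\<in>UNIV. of_real (\<theta> $ i) * V i q))^2) \<partial>M) = (\<integral>\<^sup>+q. liminf (\<lambda>n. u n q) \<partial>M)"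
    by (intro nn_integral_cong_AE) auto
  also have "\<dots> \<le> liminf (\<lambda>n. \<integral>\<^sup>+q. u n q \<partial>M)"
    by (rule nn_integral_liminf) (rule um)
  also have "\<dots> = 0"
  proof -
    have "(\<lambda>n. \<integral>\<^sup>+q. u n q \<partial>M) \<longlonglongrightarrow> 0"
    proof (rule tendsto_sandwich[OF _ _ tendsto_const])
      have "ennreal (1 / real (Suc (r n))) \<le> ennreal (1 / real (Suc n))" for n
        using seq_suble[OF r, of n] by (intro ennreal_leI divide_left_mono) auto
      then show "\<forall>\<^sub>F n in sequentially. (\<integral>\<^sup>+q. u n q \<partial>M) \<le> ennreal (1 / real (Suc n))"
        using Q unfolding Q_def u_def by (intro always_eventually allI) (meson order_trans)
      have "(\<lambda>n. ennreal (1 / real (Suc n))) \<longlonglongrightarrow> ennreal 0"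
        using LIMSEQ_inverse_real_of_nat by (intro tendsto_ennrealI) (simp add: inverse_eq_divide)
      then show "(\<lambda>n. ennreal (1 / real (Suc n))) \<longlonglongrightarrow> 0" by simp
    qed simp
    then show ?thesis by (intro lim_imp_Liminf) auto
  qed
  finally have z: "(\<integral>\<^sup>+q. liminf (\<lambda>n. u n q) \<partial>M) = 0 \<and> (\<integral>\<^sup>+q. ennreal ((cmod (\<Sum>i\<in>UNIV. of_real (\<theta> $ i) * V i q))^2) \<partial>M) = 0"
    using lm by (simp add: nn_integral_cong_AE)
  \<comment> \<open>\<open>V\<close> carries no measurability hypothesis, so the vanishing is read
    off from the liminf, which is measurable and agrees almost everywhere with the squared
    limit.\<close>
  have "(\<lambda>q. liminf (\<lambda>n. u n q)) \<in> borel_measurable M" using um by measurable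
  then have "AE q in M. liminf (\<lambda>n. u n q) = 0"
    using z by (simp add: nn_integral_0_iff_AE)
  then have "AE q in M. (\<Sum>i\<in>UNIV. of_real (\<theta> $ i) * V i q) = 0"
    using lm by eventually_elim (simp add: ennreal_eq_0_iff)
  then have "\<theta> = 0" by (rule indep)
  then show False using \<theta> by simp
qed

section \<open>Logarithmic negativity of strongly mixed states\<close>

text \<open>The vectors \<open>(1, 0)\<close> and \<open>(- b / a, 1)\<close> are orthogonal for the
  form and span unit area; their values \<open>a\<close> and \<open>d - b^2 / a\<close> multiply to
  the determinant.\<close>

lemma det_2x2_ge_of_form_bound:
  fixes a b d \<delta> :: real
  assumes pos: "\<And>x y. 0 \<le> a * x^2 + 2 * b * x * y + d * y^2"
    and form: "\<And>x y u v. (x * v - y * u)^2 \<le> \<delta> * (a * x^2 + 2 * b * x * y + d * y^2) * (a * u^2 + 2 * b * u * v + d * v^2)"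
  shows "a > 0" "1 \<le> \<delta> * (a * d - b^2)"
proof -
  have "a \<noteq> 0" using form[of 1 1 0 0] by auto
  then show "a > 0" using pos[of 1 0] by simp
  have "a * (a * (b / a)^2 - 2 * b * (b / a) + d) = a * d - b^2"
    using \<open>a \<noteq> 0\<close> by (simp add: field_simps power2_eq_square)
  then show "1 \<le> \<delta> * (a * d - b^2)"
    using form[of 1 1 0 "- (b / a)"] by (simp add: mult.assoc)
qed

lemma mult_le_square_half_sum: "(x::real) * y \<le> ((x + y) / 2)^2"
proof -
  have "((x + y) / 2)^2 = x * y + ((x - y) / 2)^2" by (simp add: power2_eq_square field_simps)
  then show ?thesis by simp
qed

text \<open>In the expansion, the excess over the determinant of \<open>m\<close> is that of
  \<open>s\<close> plus the mixed term \<open>s1 * m2 + s2 * m1 - 2 * (s * m)\<close>, nonnegative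
  by the two determinant hypotheses and the inequality of arithmetic and geometric means.\<close>

lemma det_2x2_add:
  fixes s1 s2 s m1 m2 m :: real
  assumes "s1 \<ge> 0" "s2 \<ge> 0" "s^2 \<le> s1 * s2" "m1 \<ge> 0" "m2 \<ge> 0" "m^2 \<le> m1 * m2"
  shows "m1 * m2 - m^2 \<le> (s1 + m1) * (s2 + m2) - (s + m)^2"
proof -
  have "(s * m)^2 \<le> (s1 * s2) * (m1 * m2)"
    unfolding power_mult_distrib using assms by (intro mult_mono) auto
  also have "\<dots> = (s1 * m2) * (s2 * m1)" by simp
  also have "\<dots> \<le> ((s1 * m2 + s2 * m1) / 2)^2"
    by (rule mult_le_square_half_sum)
  finally have "\<bar>s * m\<bar> \<le> (s1 * m2 + s2 * m1) / 2"
    by (rule power2_le_imp_le[of "\<bar>s * m\<bar>", unfolded power2_abs])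
      (intro divide_nonneg_pos add_nonneg_nonneg mult_nonneg_nonneg assms; simp)
  then have "s * m \<le> (s1 * m2 + s2 * m1) / 2" by (rule abs_le_D1)
  then have "2 * (s * m) \<le> s1 * m2 + s2 * m1" by (simp add: le_divide_eq mult.commute)
  moreover have "(s1 + m1) * (s2 + m2) - (s + m)^2 = (s1 * s2 - s^2) + (m1 * m2 - m^2) + (s1 * m2 + s2 * m1 - 2 * (s * m))"
    by algebra
  ultimately show ?thesis using assms(3) by linarith
qed

text \<open>The form of a symmetric block matrix, spelled out in scalars so that the facts on Schur
  complements become polynomial identities.\<close>

definition quad4 where
  "quad4 a11 a12 a22 b11 b12 b22 c11 c12 c21 c22 (x1::real) x2 x3 x4 =
     a11 * x1^2 + 2 * a12 * x1 * x2 + a22 * x2^2 + b11 * x3^2 + 2 * b12 * x3 * x4 + b22 * x4^2 +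
     2 * (c11 * x1 * x3 + c12 * x1 * x4 + c21 * x2 * x3 + c22 * x2 * x4)"

text \<open>
  The determinant of the symmetric matrix of \<open>quad4\<close>, expanded in the \<open>2 \<times> 2\<close> minors of its diagonal
  blocks \<open>a\<close>, \<open>b\<close> and its off-diagonal block \<open>c\<close>.
\<close>

definition det4 where
  "det4 a11 a12 a22 b11 b12 b22 c11 c12 c21 (c22::real) =
     (a11 * a22 - a12^2) * (b11 * b22 - b12^2) + (c11 * c22 - c12 * c21)^2
     - b22 * (a22 * c11^2 - 2 * a12 * c11 * c21 + a11 * c21^2)
     - b11 * (a22 * c12^2 - 2 * a12 * c12 * c22 + a11 * c22^2)
     + 2 * b12 * (a22 * c11 * c12 - a12 * (c11 * c22 + c12 * c21) + a11 * c21 * c22)"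

text \<open>
  The proof minimises the form over the first two variables: the minimiser is linear in the other two,
  and the minimum is the form of the Schur complement of the first block.
\<close>

lemma schur_bounds:
  fixes a11 a12 a22 b11 b12 b22 c11 c12 c21 c22 \<delta> :: real
  defines "q \<equiv> quad4 a11 a12 a22 b11 b12 b22 c11 c12 c21 c22"
  defines "dA \<equiv> a11 * a22 - a12^2"
  assumes \<delta>: "\<delta> > 0" and pos: "\<And>x1 x2 x3 x4. 0 \<le> q x1 x2 x3 x4"
    and form1: "\<And>x1 x2 x3 x4 y1 y2 y3 y4. (x1 * y2 - x2 * y1)^2 \<le> \<delta> * q x1 x2 x3 x4 * q y1 y2 y3 y4"
    and form2: "\<And>x1 x2 x3 x4 y1 y2 y3 y4. (x3 * y4 - x4 * y3)^2 \<le> \<delta> * q x1 x2 x3 x4 * q y1 y2 y3 y4"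
  shows "1 \<le> \<delta> * dA"
    and "dA \<le> \<delta> * det4 a11 a12 a22 b11 b12 b22 c11 c12 c21 c22"
    and "(c11 * c22 - c12 * c21)^2 \<le> dA * (b11 * b22 - b12^2)"
proof -
  have a: "a11 > 0 \<and> 1 \<le> \<delta> * dA"
    using det_2x2_ge_of_form_bound[of a11 a12 a22 \<delta>] pos[of _ _ 0 0] form1[of _ _ _ _ 0 0 0 0]
    by (simp add: q_def quad4_def dA_def)
  then show "1 \<le> \<delta> * dA" by simp
  then have dA: "dA > 0" using \<delta> zero_less_mult_pos[of \<delta> dA] by linarith
  \<comment> \<open>\<open>m1\<close>, \<open>m\<close>, \<open>m2\<close> are the entries of
    \<open>M\<close>, the product of the transpose of \<open>c\<close>, the inverse of
    \<open>a\<close>, and \<open>c\<close>. The Schur complement is \<open>b - M\<close>, and the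
    determinant of \<open>M\<close> is the square of that of \<open>c\<close> divided by
    \<open>dA\<close>.\<close>
  define m1 where "m1 = (a22 * c11^2 - 2 * a12 * c11 * c21 + a11 * c21^2) / dA"
  define m2 where "m2 = (a22 * c12^2 - 2 * a12 * c12 * c22 + a11 * c22^2) / dA"
  define m where "m = (a22 * c11 * c12 - a12 * (c11 * c22 + c12 * c21) + a11 * c21 * c22) / dA"
  have md: "m1 * m2 - m^2 = (c11 * c22 - c12 * c21)^2 / dA"
  proof -
    have "(a22 * c11^2 - 2 * a12 * c11 * c21 + a11 * c21^2) * (a22 * c12^2 - 2 * a12 * c12 * c22 + a11 * c22^2)
      - (a22 * c11 * c12 - a12 * (c11 * c22 + c12 * c21) + a11 * c21 * c22)^2 = dA * (c11 * c22 - c12 * c21)^2"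
      unfolding dA_def by algebra
    then show ?thesis using dA
      by (simp add: m1_def m2_def m_def power_divide power2_eq_square[of dA] flip: diff_divide_distrib)
  qed
  have S: "q (- (a22 * (c11 * z + c12 * w) - a12 * (c21 * z + c22 * w)) / dA)
       (- (a11 * (c21 * z + c22 * w) - a12 * (c11 * z + c12 * w)) / dA) z w
     = (b11 - m1) * z^2 + 2 * (b12 - m) * z * w + (b22 - m2) * w^2" for z w
  proof -
    define d where "d = 1 / dA"
    have d: "d * (a11 * a22 - a12^2) = 1" using dA by (simp add: d_def dA_def)
    have dd: "x / dA = x * d" for x by (simp add: d_def)
    define X Y E where XY: "X = c11 * z + c12 * w" "Y = c21 * z + c22 * w" "E = a22 * X^2 - 2 * a12 * X * Y + a11 * Y^2"
    have "a11 * (a22 * X - a12 * Y)^2 + 2 * a12 * (a22 * X - a12 * Y) * (a11 * Y - a12 * X) + a22 * (a11 * Y - a12 * X)^2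
        = (a11 * a22 - a12^2) * E"
      unfolding XY(3) by (simp add: power2_eq_square algebra_simps)
    then have "d * d * (a11 * (a22 * X - a12 * Y)^2 + 2 * a12 * (a22 * X - a12 * Y) * (a11 * Y - a12 * X) + a22 * (a11 * Y - a12 * X)^2)
        = d * E"
      using d by (simp add: mult.left_commute[of d] flip: mult.assoc)
    then have e1: "a11 * (- (a22 * X - a12 * Y) * d)^2 + 2 * a12 * (- (a22 * X - a12 * Y) * d) * (- (a11 * Y - a12 * X) * d)
        + a22 * (- (a11 * Y - a12 * X) * d)^2 = d * E"
      by (simp add: power2_eq_square algebra_simps)
    have e2: "2 * (X * (- (a22 * X - a12 * Y) * d) + Y * (- (a11 * Y - a12 * X) * d)) = - 2 * (d * E)"
      unfolding XY(3) by (simp add: power2_eq_square algebra_simps)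
    have e3: "q (- (a22 * X - a12 * Y) * d) (- (a11 * Y - a12 * X) * d) z w =
        (a11 * (- (a22 * X - a12 * Y) * d)^2 + 2 * a12 * (- (a22 * X - a12 * Y) * d) * (- (a11 * Y - a12 * X) * d)
        + a22 * (- (a11 * Y - a12 * X) * d)^2) + 2 * (X * (- (a22 * X - a12 * Y) * d) + Y * (- (a11 * Y - a12 * X) * d))
        + (b11 * z^2 + 2 * b12 * z * w + b22 * w^2)"
    proof -
      have "q s t z w = (a11 * s^2 + 2 * a12 * s * t + a22 * t^2) + 2 * (X * s + Y * t) + (b11 * z^2 + 2 * b12 * z * w + b22 * w^2)" for s t
        unfolding q_def quad4_def XY by (simp add: algebra_simps)
      then show ?thesis .
    qed
    have "q (- (a22 * X - a12 * Y) * d) (- (a11 * Y - a12 * X) * d) z w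
        = (b11 * z^2 + 2 * b12 * z * w + b22 * w^2) - d * E" unfolding e3 e1 e2 by simp
    also have "d * E = m1 * z^2 + 2 * m * z * w + m2 * w^2"
      unfolding XY m1_def m2_def m_def dd
      by (simp add: power2_eq_square algebra_simps)
    finally show ?thesis
      unfolding XY dd
      by (simp add: algebra_simps)
  qed
  \<comment> \<open>The wedge in \<open>form2\<close> does not see the first two variables, so both
    vectors can be placed at their minimisers and the bound descends to the Schur
    complement.\<close>
  have s: "b11 - m1 > 0 \<and> 1 \<le> \<delta> * ((b11 - m1) * (b22 - m2) - (b12 - m)^2)"
  proof -
    have "(x * v - y * u)^2 \<le> \<delta> * ((b11 - m1) * x^2 + 2 * (b12 - m) * x * y + (b22 - m2) * y^2)
        * ((b11 - m1) * u^2 + 2 * (b12 - m) * u * v + (b22 - m2) * v^2)" for x y u v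
      unfolding S[symmetric] by (rule form2)
    moreover have "0 \<le> (b11 - m1) * x^2 + 2 * (b12 - m) * x * y + (b22 - m2) * y^2" for x y
      unfolding S[symmetric] by (rule pos)
    ultimately show ?thesis using det_2x2_ge_of_form_bound by blast
  qed
  have detS: "dA * ((b11 - m1) * (b22 - m2) - (b12 - m)^2) = det4 a11 a12 a22 b11 b12 b22 c11 c12 c21 c22"
  proof -
    have "dA * ((b11 - m1) * (b22 - m2) - (b12 - m)^2)
      = dA * (b11 * b22 - b12^2) - b22 * (dA * m1) - b11 * (dA * m2) + 2 * b12 * (dA * m) + dA * (m1 * m2 - m^2)"
      by (simp add: power2_eq_square algebra_simps)
    then show ?thesis using dA unfolding md
      by (simp add: m1_def m2_def m_def det4_def) (simp add: dA_def)
  qed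
  show "dA \<le> \<delta> * det4 a11 a12 a22 b11 b12 b22 c11 c12 c21 c22"
    using mult_left_mono[OF conjunct2[OF s], of dA] dA
    unfolding detS[symmetric] by (simp add: mult.left_commute)
  have ds: "(b11 - m1) * (b22 - m2) - (b12 - m)^2 > 0"
    using s \<delta> zero_less_mult_pos[of \<delta> "(b11 - m1) * (b22 - m2) - (b12 - m)^2"] by linarith
  have "(b11 - m1) * (b22 - m2) > 0" using ds by (smt (verit) zero_le_power2)
  then have s2: "b22 - m2 > 0" using s by (simp add: zero_less_mult_iff)
  have sq: "0 \<le> a22 * x^2 - 2 * a12 * x * y + a11 * y^2" for x y
  proof -
    have "a11 * (a22 * x^2 - 2 * a12 * x * y + a11 * y^2) = dA * x^2 + (a12 * x - a11 * y)^2"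
      unfolding dA_def by algebra
    also have "\<dots> \<ge> 0" using dA by simp
    finally show ?thesis using a by (simp add: zero_le_mult_iff)
  qed
  \<comment> \<open>The block \<open>b\<close> is the Schur complement plus \<open>M\<close>, both
    positive semidefinite, so its determinant is at least that of \<open>M\<close>.\<close>
  have "m1 * m2 - m^2 \<le> ((b11 - m1) + m1) * ((b22 - m2) + m2) - ((b12 - m) + m)^2"
  proof (rule det_2x2_add)
    show "m1 \<ge> 0" "m2 \<ge> 0" unfolding m1_def m2_def using dA sq[of c11 c21] sq[of c12 c22] by simp_all
    have "0 \<le> (c11 * c22 - c12 * c21)^2 / dA" using dA by simp
    then show "m^2 \<le> m1 * m2" using md by linarith
  qed (use s s2 ds in auto)
  then show "(c11 * c22 - c12 * c21)^2 \<le> dA * (b11 * b22 - b12^2)"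
    unfolding md using dA by (simp add: pos_divide_le_eq mult.commute)
qed

lemma det4_swap:
  "det4 b11 b12 b22 a11 a12 a22 c11 c21 c12 c22 = det4 a11 a12 a22 b11 b12 b22 c11 c12 c21 c22"
  unfolding det4_def by algebra

lemma quad4_swap:
  "quad4 b11 b12 b22 a11 a12 a22 c11 c21 c12 c22 x3 x4 x1 x2 = quad4 a11 a12 a22 b11 b12 b22 c11 c12 c21 c22 x1 x2 x3 x4"
  unfolding quad4_def by algebra

lemma det_4:
  fixes A :: "'a::comm_ring_1^4^4"
  shows "det A =
    A$1$1 * (A$2$2 * (A$3$3 * A$4$4 - A$3$4 * A$4$3) - A$2$3 * (A$3$2 * A$4$4 - A$3$4 * A$4$2) + A$2$4 * (A$3$2 * A$4$3 - A$3$3 * A$4$2))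
  - A$1$2 * (A$2$1 * (A$3$3 * A$4$4 - A$3$4 * A$4$3) - A$2$3 * (A$3$1 * A$4$4 - A$3$4 * A$4$1) + A$2$4 * (A$3$1 * A$4$3 - A$3$3 * A$4$1))
  + A$1$3 * (A$2$1 * (A$3$2 * A$4$4 - A$3$4 * A$4$2) - A$2$2 * (A$3$1 * A$4$4 - A$3$4 * A$4$1) + A$2$4 * (A$3$1 * A$4$2 - A$3$2 * A$4$1))
  - A$1$4 * (A$2$1 * (A$3$2 * A$4$3 - A$3$3 * A$4$2) - A$2$2 * (A$3$1 * A$4$3 - A$3$3 * A$4$1) + A$2$3 * (A$3$1 * A$4$2 - A$3$2 * A$4$1))"
proof -
  have f: "finite {2::4, 3, 4}" "1 \<notin> {2::4, 3, 4}" "finite {3::4, 4}" "2 \<notin> {3::4, 4}" "finite {4::4}" "3 \<notin> {4::4}"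
    by auto
  show ?thesis
    unfolding det_def UNIV_4
    unfolding sum_over_permutations_insert[OF f(1,2)]
    unfolding sum_over_permutations_insert[OF f(3,4)]
    unfolding sum_over_permutations_insert[OF f(5,6)]
    unfolding permutes_sing
    by (simp add: sign_swap_id permutation_swap_id sign_compose sign_id swap_id_eq permutation_compose)
      (simp add: algebra_simps)
qed

text \<open>Partial transposition flips the sign of one commutator form. The factor 4 covers both
  signs, since \<open>(a - b)^2 \<le> 2 * a^2 + 2 * b^2\<close>. The proof works with the
  invariants: the hypotheses give \<open>D \<le> dd\<close>, while
  \<open>sqrt (D^2 - 4 * dd) \<le> D - 2\<close> amounts to \<open>D \<le> dd + 1\<close> once
  \<open>D \<ge> 2\<close> and the root is real.\<close>

lemma nu_minus_ge_1:
  fixes \<sigma> :: "real^4^4"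
  assumes sym: "\<And>i j. \<sigma>$i$j = \<sigma>$j$i"
    and pos: "\<And>x :: real^4. 0 \<le> (\<Sum>i\<in>UNIV. \<Sum>j\<in>UNIV. x$i * x$j * \<sigma>$i$j)"
    and form1: "\<And>x y :: real^4. 4 * (x$1 * y$2 - x$2 * y$1)^2 \<le>
      (\<Sum>i\<in>UNIV. \<Sum>j\<in>UNIV. x$i * x$j * \<sigma>$i$j) * (\<Sum>i\<in>UNIV. \<Sum>j\<in>UNIV. y$i * y$j * \<sigma>$i$j)"
    and form2: "\<And>x y :: real^4. 4 * (x$3 * y$4 - x$4 * y$3)^2 \<le>
      (\<Sum>i\<in>UNIV. \<Sum>j\<in>UNIV. x$i * x$j * \<sigma>$i$j) * (\<Sum>i\<in>UNIV. \<Sum>j\<in>UNIV. y$i * y$j * \<sigma>$i$j)"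
  shows "nu_minus \<sigma> \<ge> 1"
proof -
  define a11 a12 a22 b11 b12 b22 c11 c12 c21 c22 where defs:
    "a11 = \<sigma>$1$1" "a12 = \<sigma>$1$2" "a22 = \<sigma>$2$2" "b11 = \<sigma>$3$3" "b12 = \<sigma>$3$4" "b22 = \<sigma>$4$4"
    "c11 = \<sigma>$1$3" "c12 = \<sigma>$1$4" "c21 = \<sigma>$2$3" "c22 = \<sigma>$2$4"
  have sy: "\<sigma>$2$1 = a12" "\<sigma>$4$3 = b12" "\<sigma>$3$1 = c11" "\<sigma>$4$1 = c12" "\<sigma>$3$2 = c21" "\<sigma>$4$2 = c22"
    using sym by (simp_all add: defs)
  note ent = sy defs[symmetric]
  define q where "q = quad4 a11 a12 a22 b11 b12 b22 c11 c12 c21 c22"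
  have q: "(\<Sum>i\<in>UNIV. \<Sum>j\<in>UNIV. x$i * x$j * \<sigma>$i$j) = q (x$1) (x$2) (x$3) (x$4)" for x :: "real^4"
    unfolding q_def quad4_def sum_4 ent by algebra
  define w where "w x1 x2 x3 x4 = (\<chi> i::4. if i = 1 then x1 else if i = 2 then x2 else if i = 3 then x3 else x4)"
    for x1 x2 x3 x4 :: real
  have w: "w x1 x2 x3 x4 $ 1 = x1" "w x1 x2 x3 x4 $ 2 = x2" "w x1 x2 x3 x4 $ 3 = x3" "w x1 x2 x3 x4 $ 4 = x4"
    for x1 x2 x3 x4 by (simp_all add: w_def)
  have pos': "0 \<le> q x1 x2 x3 x4" for x1 x2 x3 x4
    using pos[of "w x1 x2 x3 x4"] unfolding q w by simp
  have form1': "(x1 * y2 - x2 * y1)^2 \<le> 1 / 4 * q x1 x2 x3 x4 * q y1 y2 y3 y4" for x1 x2 x3 x4 y1 y2 y3 y4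
    using form1[of "w x1 x2 x3 x4" "w y1 y2 y3 y4"] unfolding q w by simp
  have form2': "(x3 * y4 - x4 * y3)^2 \<le> 1 / 4 * q x1 x2 x3 x4 * q y1 y2 y3 y4" for x1 x2 x3 x4 y1 y2 y3 y4
    using form2[of "w x1 x2 x3 x4" "w y1 y2 y3 y4"] unfolding q w by simp
  define dA dB dC dd where d: "dA = a11 * a22 - a12^2" "dB = b11 * b22 - b12^2" "dC = c11 * c22 - c12 * c21"
    "dd = det4 a11 a12 a22 b11 b12 b22 c11 c12 c21 c22"
  have A: "4 \<le> dA" "4 * dA \<le> dd" "dC^2 \<le> dA * dB"
    using schur_bounds[of "1/4" a11 a12 a22 b11 b12 b22 c11 c12 c21 c22] pos' form1' form2'
    unfolding q_def d by simp_all
  \<comment> \<open>The same bounds with the roles of the modes exchanged, which transposes the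
    block \<open>c\<close>.\<close>
  have B: "4 \<le> dB" "4 * dB \<le> dd"
  proof -
    have qs: "quad4 b11 b12 b22 a11 a12 a22 c11 c21 c12 c22 x3 x4 x1 x2 = q x1 x2 x3 x4" for x1 x2 x3 x4
      unfolding q_def by (rule quad4_swap)
    have ds: "det4 b11 b12 b22 a11 a12 a22 c11 c21 c12 c22 = dd" unfolding d by (rule det4_swap)
    note S = schur_bounds[of "1/4" b11 b12 b22 a11 a12 a22 c11 c21 c12 c22, unfolded qs ds d(2)[symmetric],
        OF _ pos' form2' form1']
    show "4 \<le> dB" "4 * dB \<le> dd" using S(1,2) by simp_all
  qed
  have "dA * dB \<le> ((dA + dB) / 2)^2"
    by (rule mult_le_square_half_sum)
  then have "\<bar>dC\<bar> \<le> (dA + dB) / 2"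
    using A(1,3) B(1) by (intro power2_le_imp_le[of "\<bar>dC\<bar>", unfolded power2_abs]) auto
  then have C: "0 \<le> dA + dB - 2 * dC" "dA + dB - 2 * dC \<le> 2 * (dA + dB)" by (auto simp: abs_le_iff)
  have det: "det \<sigma> = dd"
    unfolding det_4 ent d det4_def by algebra
  have D: "Delta_PT \<sigma> = dA + dB - 2 * dC"
    unfolding Delta_PT_def block_def det_2 d by (simp add: ent power2_eq_square)
  define D where "D = dA + dB - 2 * dC"
  have "D \<le> dd"
  proof -
    have "D \<le> 2 * (dA + dB)" unfolding D_def by (rule C(2))
    also have "\<dots> \<le> dd" using A(2) B(2) by simp
    finally show ?thesis .
  qed
  moreover have "16 \<le> dd" using A(1,2) by simp
  ultimately have D0: "0 \<le> D" "D \<le> dd" "16 \<le> dd" using C(1) by (simp_all add: D_def)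
  \<comment> \<open>A negative discriminant is not excluded, and \<open>sqrt\<close> is odd on the
    reals. For \<open>D < 2\<close> the discriminant is below \<open>- 4\<close>, so its root is at
    most \<open>- 2\<close>, which is enough.\<close>
  have "2 \<le> D - sqrt (D^2 - 4 * dd)"
  proof (cases "D^2 - 4 * dd \<ge> 0")
    case True
    then have "4^2 \<le> D^2" using D0 by simp
    then have "4 \<le> D" using D0(1) power2_le_imp_le by blast
    have "sqrt (D^2 - 4 * dd) \<le> sqrt ((D - 2)^2)"
      using D0 by (intro real_sqrt_le_mono) (simp add: power2_eq_square algebra_simps)
    then show ?thesis using \<open>4 \<le> D\<close> by simp
  next
    case False
    show ?thesis
    proof (cases "D \<ge> 2")
      case True
      have "sqrt (D^2 - 4 * dd) \<le> 0" using False by simp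
      then show ?thesis using True by linarith
    next
      case F: False
      have "D^2 \<le> 2^2" using F D0 by (intro power_mono) auto
      then have "sqrt (D^2 - 4 * dd) \<le> sqrt (- (2^2))" using D0 by (intro real_sqrt_le_mono) simp
      also have "\<dots> = - 2" unfolding real_sqrt_minus real_sqrt_abs by simp
      finally show ?thesis using D0 by linarith
    qed
  qed
  then show ?thesis unfolding nu_minus_def D det D_def[symmetric] by simp
qed

lemma log_negativity_eq_0:
  assumes "nu_minus (covariance_matrix S A B) \<ge> 1"
  shows "log_negativity S A B = 0"
  using assms by (simp add: log_negativity_def)

section \<open>Bases of a mode adapted to large scales\<close>

lemma fourier_inj:
  assumes "test_function f" "test_function g" "\<And>k. fourier f k = fourier g k"
  shows "f x = g x"
  using fourier_eq_zero_imp[OF test_function_lincomb[OF assms(1,2), of 1 "-1"], of x]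
    fourier_lincomb[OF assms(1,2), of 1 "-1"] assms(3) by simp

lemma fourier_scale_const: "test_function f \<Longrightarrow> fourier (\<lambda>x. a * f x) k = of_real a * fourier f k"
  using fourier_lincomb[of f f a 0 k] by simp

lemma laplacian_zero: "laplacian (\<lambda>x. 0) x = 0"
proof -
  have "supp (\<lambda>x. 0) = {}" by (simp add: supp_def support_on_def)
  then show ?thesis using supp_laplacian[of "\<lambda>x. 0"] not_in_supp[of x "laplacian (\<lambda>x. 0)"] by simp
qed

text \<open>In Fourier space the relation forces \<open>b + \<kappa> * a * (norm q)^2 = 0\<close>
  wherever the transform of \<open>f\<close> is nonzero. That set is open and nonempty, so it
  contains points of two different norms.\<close>

lemma laplacian_no_eigenfunction:
  assumes f: "test_function f" and nz: "f x0 \<noteq> 0" and \<kappa>: "\<kappa> \<noteq> 0"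
    and eq: "\<And>x. b * f x = \<kappa> * (a * laplacian f x)"
  shows "a = 0 \<and> b = 0"
proof -
  have F: "(b + \<kappa> * a * (norm q)^2) = 0" if "fourier f q \<noteq> 0" for q
  proof -
    have "fourier (\<lambda>x. b * f x) q = fourier (\<lambda>x. (\<kappa> * a) * laplacian f x) q" using eq by (simp add: mult.assoc)
    then have "of_real b * fourier f q = of_real (\<kappa> * a) * (- of_real ((norm q)^2) * fourier f q)"
      by (simp only: fourier_scale_const[OF f] fourier_scale_const[OF test_function_laplacian[OF f]] fourier_laplacian[OF f])
    then have "of_real (b + \<kappa> * a * (norm q)^2) * fourier f q = 0" by (simp add: algebra_simps)
    then show ?thesis using that by (simp only: mult_eq_0_iff of_real_eq_0_iff) simp
  qed
  obtain q where q: "fourier f q \<noteq> 0" using fourier_eq_zero_imp[OF f] nz by blast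
  have "open {q. fourier f q \<noteq> 0}"
    by (intro open_Collect_neq continuous_on_fourier f continuous_intros)
  then obtain r where r: "r > 0" "ball q r \<subseteq> {q. fourier f q \<noteq> 0}" using q openE by blast
  \<comment> \<open>A radial direction: moving by \<open>r / 2\<close> along it increases the norm
    by exactly \<open>r / 2\<close>. At the origin any unit vector serves.\<close>
  define u where "u = (if q = 0 then axis 1 1 else q /\<^sub>R norm q)"
  have u: "norm u = 1" by (simp add: u_def norm_axis_1)
  have "norm (q + (r/2) *\<^sub>R u) = norm q + r / 2"
  proof (cases "q = 0")
    case True then show ?thesis using u r by simp
  next
    case False
    then have "u = (1 / norm q) *\<^sub>R q" unfolding u_def by (simp only: if_False inverse_eq_divide)
    then have e: "q + (r/2) *\<^sub>R u = (1 + r/2 * (1 / norm q)) *\<^sub>R q"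
      by (simp only: scaleR_add_left scaleR_scaleR scaleR_one)
    have "1 + r/2 * (1 / norm q) \<ge> 0" using r by (intro add_nonneg_nonneg mult_nonneg_nonneg) auto
    then have "norm (q + (r/2) *\<^sub>R u) = (1 + r/2 * (1 / norm q)) * norm q"
      unfolding e norm_scaleR by (simp only: abs_of_nonneg)
    also have "\<dots> = norm q + r / 2" using False by (simp add: distrib_right)
    finally show ?thesis .
  qed
  moreover have "q + (r/2) *\<^sub>R u \<in> ball q r" using r u by (simp add: dist_norm)
  ultimately have e: "b + \<kappa> * a * (norm q + r/2)^2 = 0" "b + \<kappa> * a * (norm q)^2 = 0"
    using F[OF q] F[of "q + (r/2) *\<^sub>R u"] r by auto
  from e have "\<kappa> * a * (norm q + r/2)^2 = \<kappa> * a * (norm q)^2" by linarith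
  then have "\<kappa> * a * ((norm q + r/2)^2 - (norm q)^2) = 0"
    by (simp only: right_diff_distrib)
  moreover have "(norm q + r/2)^2 - (norm q)^2 > 0" using power_strict_mono[of "norm q" "norm q + r/2" 2] r by simp
  ultimately have "a = 0" using \<kappa> by simp
  then show ?thesis using e by simp
qed

text \<open>
  Here \<open>\<mu>\<close> is the \<open>\<mu>\<^sup>2\<close> of the paper. The columns of the matrix \<open>s L\<close> are the new basis vectors of
  the mode; \<open>U\<close> and \<open>W\<close> are the limits of \<open>f + \<mu> L g\<close> and \<open>g / L\<close> along them, and the determinant
  is the factor by which the commutator form changes.
\<close>

definition classical_part :: "real \<Rightarrow> real \<Rightarrow> observable \<Rightarrow> real^3 \<Rightarrow> complex" where
  "classical_part \<mu> L \<gamma> q = fourier (snd \<gamma>) q + of_real (\<mu> * L) * fourier (fst \<gamma>) q"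

definition adapted_basis ::
    "real \<Rightarrow> real \<Rightarrow> observable \<Rightarrow> observable \<Rightarrow> (real^3) set \<Rightarrow>
     (real \<Rightarrow> real) \<Rightarrow> (real \<Rightarrow> real) \<Rightarrow> (real \<Rightarrow> real) \<Rightarrow> (real \<Rightarrow> real) \<Rightarrow> real \<Rightarrow>
     (real^3 \<Rightarrow> real) \<Rightarrow> (real^3 \<Rightarrow> real) \<Rightarrow> (real^3 \<Rightarrow> real) \<Rightarrow> (real^3 \<Rightarrow> real) \<Rightarrow> bool" where
  "adapted_basis \<mu> \<kappa> \<gamma>1 \<gamma>2 S s11 s12 s21 s22 C U1 U2 W1 W2 \<longleftrightarrow>
      C > 0 \<and>
      (\<forall>L\<ge>1. s11 L * s22 L - s12 L * s21 L \<noteq> 0 \<and> \<bar>s11 L * s22 L - s12 L * s21 L\<bar> \<le> C * L) \<and>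
      (\<forall>h\<in>{U1, U2, W1, W2}. test_function h \<and> supp h \<subseteq> S) \<and>
      (\<forall>q. ((\<lambda>L. of_real (s11 L) * classical_part \<mu> L \<gamma>1 q + of_real (s21 L) * classical_part \<mu> L \<gamma>2 q) \<longlongrightarrow> fourier U1 q) at_top) \<and>
      (\<forall>q. ((\<lambda>L. of_real (s12 L) * classical_part \<mu> L \<gamma>1 q + of_real (s22 L) * classical_part \<mu> L \<gamma>2 q) \<longlongrightarrow> fourier U2 q) at_top) \<and>
      (\<forall>q. ((\<lambda>L. of_real (s11 L / L) * fourier (fst \<gamma>1) q + of_real (s21 L / L) * fourier (fst \<gamma>2) q) \<longlongrightarrow> fourier W1 q) at_top) \<and>
      (\<forall>q. ((\<lambda>L. of_real (s12 L / L) * fourier (fst \<gamma>1) q + of_real (s22 L / L) * fourier (fst \<gamma>2) q) \<longlongrightarrow> fourier W2 q) at_top) \<and>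
      (\<forall>a b. (\<forall>x. a * U1 x + b * U2 x = \<kappa> * (a * laplacian W1 x + b * laplacian W2 x)) \<longrightarrow> a = 0 \<and> b = 0)"

definition comb :: "real \<Rightarrow> observable \<Rightarrow> real \<Rightarrow> observable \<Rightarrow> observable" where
  "comb a \<gamma> b \<gamma>' = ((\<lambda>x. a * fst \<gamma> x + b * fst \<gamma>' x), (\<lambda>x. a * snd \<gamma> x + b * snd \<gamma>' x))"

definition test_observable :: "observable \<Rightarrow> bool" where
  "test_observable \<gamma> \<longleftrightarrow> test_function (fst \<gamma>) \<and> test_function (snd \<gamma>)"

lemma fourier_comb:
  assumes "test_observable \<gamma>" "test_observable \<gamma>'"
  shows "fourier (fst (comb a \<gamma> b \<gamma>')) q = of_real a * fourier (fst \<gamma>) q + of_real b * fourier (fst \<gamma>') q"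
    and "classical_part \<mu> L (comb a \<gamma> b \<gamma>') q = of_real a * classical_part \<mu> L \<gamma> q + of_real b * classical_part \<mu> L \<gamma>' q"
  using assms by (simp_all add: test_observable_def comb_def fourier_lincomb classical_part_def algebra_simps)

text \<open>A constant change of generators with determinant 1 multiplies the coefficient matrix
  from the left and keeps its determinant, so a mode may first be brought to a normal form.\<close>

lemma adapted_basis_change:
  assumes t: "test_observable \<gamma>1" "test_observable \<gamma>2" and det: "k11 * k22 - k12 * k21 = 1"
    and ad: "adapted_basis \<mu> \<kappa> (comb k11 \<gamma>1 k21 \<gamma>2) (comb k12 \<gamma>1 k22 \<gamma>2) S s11 s12 s21 s22 C U1 U2 W1 W2"
  shows "adapted_basis \<mu> \<kappa> \<gamma>1 \<gamma>2 S (\<lambda>L. k11 * s11 L + k12 * s21 L) (\<lambda>L. k11 * s12 L + k12 * s22 L)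
    (\<lambda>L. k21 * s11 L + k22 * s21 L) (\<lambda>L. k21 * s12 L + k22 * s22 L) C U1 U2 W1 W2"
proof -
  have d: "(k11 * s11 L + k12 * s21 L) * (k21 * s12 L + k22 * s22 L) - (k11 * s12 L + k12 * s22 L) * (k21 * s11 L + k22 * s21 L)
        = s11 L * s22 L - s12 L * s21 L" for L
  proof -
    have "(k11 * s11 L + k12 * s21 L) * (k21 * s12 L + k22 * s22 L) - (k11 * s12 L + k12 * s22 L) * (k21 * s11 L + k22 * s21 L)
        = (k11 * k22 - k12 * k21) * (s11 L * s22 L - s12 L * s21 L)"
      by (simp add: algebra_simps)
    then show ?thesis by (simp add: det)
  qed
  have c: "of_real s * (of_real k11 * x + of_real k21 * y) + of_real s' * (of_real k12 * x + of_real k22 * y)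
      = of_real (k11 * s + k12 * s') * x + of_real (k21 * s + k22 * s') * y" for s s' and x y :: complex
    by (simp add: algebra_simps)
  have e: "k * (s / L) + k' * (s' / L) = (k * s + k' * s') / L" for k s k' s' L :: real
    by (simp add: add_divide_distrib)
  show ?thesis
    using ad unfolding adapted_basis_def fourier_comb[OF t] c d e .
qed

lemma tendsto_of_real_inverse_at_top: "((\<lambda>L::real. complex_of_real (1 / L)) \<longlongrightarrow> 0) at_top"
  using tendsto_of_real[OF tendsto_inverse_0_at_top[OF filterlim_ident], where 'a = complex] by (simp add: inverse_eq_divide)

lemma classical_part_limit:
  "((\<lambda>L. of_real (1 / L) * classical_part \<mu> L (g, f) q) \<longlongrightarrow> of_real \<mu> * fourier g q) at_top"
proof -
  have "((\<lambda>L. of_real (1 / L) * fourier f q + of_real \<mu> * fourier g q) \<longlongrightarrow> 0 * fourier f q + of_real \<mu> * fourier g q) at_top"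
    by (intro tendsto_intros tendsto_of_real_inverse_at_top)
  moreover have "eventually (\<lambda>L. of_real (1 / L) * fourier f q + of_real \<mu> * fourier g q = of_real (1 / L) * classical_part \<mu> L (g, f) q) at_top"
    using eventually_gt_at_top[of "0::real"] by eventually_elim (simp add: classical_part_def field_simps)
  ultimately show ?thesis by (simp add: Lim_transform_eventually)
qed

lemma supp_scale_subset: "supp (\<lambda>x. a * g x) \<subseteq> supp g"
  by (rule supp_subset[OF closed_supp]) (simp add: not_in_supp)

lemma supp_zero: "supp (\<lambda>x. 0) = {}"
  by (simp add: supp_def support_on_def)

lemma fourier_zero: "fourier (\<lambda>x. 0) q = 0"
  by (simp add: fourier_def)

text \<open>With \<open>g1\<close> and \<open>g2\<close> independent, \<open>\<mu> * L * g\<close>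
  dominates \<open>f\<close> in both generators, and division by \<open>L\<close> yields independent
  limits. The \<open>g / L\<close> parts vanish in the limit.\<close>

lemma adapted_basis_independent:
  assumes t: "test_function g1" "test_function f1" "test_function g2" "test_function f2" and \<mu>: "\<mu> > 0"
    and S: "supp g1 \<subseteq> S" "supp g2 \<subseteq> S"
    and indep: "\<And>a b. (\<And>x. a * g1 x + b * g2 x = 0) \<Longrightarrow> a = 0 \<and> b = 0"
  shows "adapted_basis \<mu> \<kappa> (g1, f1) (g2, f2) S (\<lambda>L. 1 / L) (\<lambda>L. 0) (\<lambda>L. 0) (\<lambda>L. 1 / L) 1
    (\<lambda>x. \<mu> * g1 x) (\<lambda>x. \<mu> * g2 x) (\<lambda>x. 0) (\<lambda>x. 0)"
  unfolding adapted_basis_def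
proof (intro conjI allI ballI impI)
  note i = tendsto_of_real_inverse_at_top
  have ii: "((\<lambda>L::real. complex_of_real (1 / L / L)) \<longlongrightarrow> 0) at_top"
    using tendsto_mult[OF i i] by simp
  note c = classical_part_limit
  fix q
  show "((\<lambda>L. of_real (1 / L) * classical_part \<mu> L (g1, f1) q + of_real 0 * classical_part \<mu> L (g2, f2) q) \<longlongrightarrow> fourier (\<lambda>x. \<mu> * g1 x) q) at_top"
    using c[of \<mu> g1 f1 q] by (simp add: fourier_scale_const t)
  show "((\<lambda>L. of_real 0 * classical_part \<mu> L (g1, f1) q + of_real (1 / L) * classical_part \<mu> L (g2, f2) q) \<longlongrightarrow> fourier (\<lambda>x. \<mu> * g2 x) q) at_top"
    using c[of \<mu> g2 f2 q] by (simp add: fourier_scale_const t)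
  show "((\<lambda>L. of_real (1 / L / L) * fourier (fst (g1, f1)) q + of_real (0 / L) * fourier (fst (g2, f2)) q) \<longlongrightarrow> fourier (\<lambda>x. 0) q) at_top"
    using tendsto_mult_left_zero[OF ii, of "fourier g1 q"] by (simp add: fourier_def)
  show "((\<lambda>L. of_real (0 / L) * fourier (fst (g1, f1)) q + of_real (1 / L / L) * fourier (fst (g2, f2)) q) \<longlongrightarrow> fourier (\<lambda>x. 0) q) at_top"
    using tendsto_mult_left_zero[OF ii, of "fourier g2 q"] by (simp add: fourier_def)
next
  fix L :: real assume L: "1 \<le> L"
  show "1 / L * (1 / L) - 0 * 0 \<noteq> 0" using L by simp
  have "1 / L * (1 / L) \<le> 1 * 1" using L by (intro mult_mono) auto
  then have "1 / L * (1 / L) \<le> L" using L by linarith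
  then show "\<bar>1 / L * (1 / L) - 0 * 0\<bar> \<le> 1 * L" using L by simp
next
  fix h assume h: "h \<in> {\<lambda>x. \<mu> * g1 x, \<lambda>x. \<mu> * g2 x, \<lambda>x. 0, \<lambda>x. 0}"
  then show "test_function h" using t test_function_scale test_function_zero by blast
  show "supp h \<subseteq> S" using h S supp_scale_subset[of \<mu> g1] supp_scale_subset[of \<mu> g2] supp_zero by blast
next
  fix a b assume "\<forall>x. a * (\<mu> * g1 x) + b * (\<mu> * g2 x) = \<kappa> * (a * laplacian (\<lambda>x. 0) x + b * laplacian (\<lambda>x. 0) x)"
  then have "\<mu> * (a * g1 x + b * g2 x) = 0" for x by (simp add: laplacian_zero algebra_simps)
  then have "a * g1 x + b * g2 x = 0" for x using \<mu> by (metis less_irrefl mult_eq_0_iff)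
  then have "a = 0 \<and> b = 0" by (rule indep)
  then show "a = 0" "b = 0" by auto
qed simp

text \<open>The second generator has no momentum part and does not grow, so only the first is
  divided by \<open>L\<close>.\<close>

lemma adapted_basis_momentum_field:
  assumes t: "test_function g1" "test_function f1" "test_function f2" and \<mu>: "\<mu> > 0"
    and S: "supp g1 \<subseteq> S" "supp f2 \<subseteq> S"
    and indep: "\<And>a b. (\<And>x. a * g1 x + b * f2 x = 0) \<Longrightarrow> a = 0 \<and> b = 0"
  shows "adapted_basis \<mu> \<kappa> (g1, f1) (\<lambda>x. 0, f2) S (\<lambda>L. 1 / L) (\<lambda>L. 0) (\<lambda>L. 0) (\<lambda>L. 1) 1
    (\<lambda>x. \<mu> * g1 x) f2 (\<lambda>x. 0) (\<lambda>x. 0)"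
  unfolding adapted_basis_def
proof (intro conjI allI ballI impI)
  note i = tendsto_of_real_inverse_at_top
  have ii: "((\<lambda>L::real. complex_of_real (1 / L / L)) \<longlongrightarrow> 0) at_top"
    using tendsto_mult[OF i i] by simp
  fix q
  show "((\<lambda>L. of_real (1 / L) * classical_part \<mu> L (g1, f1) q + of_real 0 * classical_part \<mu> L (\<lambda>x. 0, f2) q) \<longlongrightarrow> fourier (\<lambda>x. \<mu> * g1 x) q) at_top"
    using classical_part_limit[of \<mu> g1 f1 q] by (simp add: fourier_scale_const t)
  show "((\<lambda>L. of_real 0 * classical_part \<mu> L (g1, f1) q + of_real 1 * classical_part \<mu> L (\<lambda>x. 0, f2) q) \<longlongrightarrow> fourier f2 q) at_top"
    by (simp add: classical_part_def fourier_zero)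
  show "((\<lambda>L. of_real (1 / L / L) * fourier (fst (g1, f1)) q + of_real (0 / L) * fourier (fst (\<lambda>x. 0, f2)) q) \<longlongrightarrow> fourier (\<lambda>x. 0) q) at_top"
    using tendsto_mult_left_zero[OF ii, of "fourier g1 q"] by (simp add: fourier_zero)
  show "((\<lambda>L. of_real (0 / L) * fourier (fst (g1, f1)) q + of_real (1 / L) * fourier (fst (\<lambda>x. 0, f2)) q) \<longlongrightarrow> fourier (\<lambda>x. 0) q) at_top"
    by (simp add: fourier_zero)
next
  fix L :: real assume L: "1 \<le> L"
  show "1 / L * 1 - 0 * 0 \<noteq> 0" using L by simp
  have "1 / L \<le> 1" using L by simp
  then have "1 / L \<le> L" using L by linarith
  then show "\<bar>1 / L * 1 - 0 * 0\<bar> \<le> 1 * L" using L by simp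
next
  fix h assume h: "h \<in> {\<lambda>x. \<mu> * g1 x, f2, \<lambda>x. 0, \<lambda>x. 0}"
  then show "test_function h" using t test_function_scale test_function_zero by blast
  show "supp h \<subseteq> S" using h S supp_scale_subset[of \<mu> g1] supp_zero by blast
next
  fix a b assume "\<forall>x. a * (\<mu> * g1 x) + b * f2 x = \<kappa> * (a * laplacian (\<lambda>x. 0) x + b * laplacian (\<lambda>x. 0) x)"
  then have "(a * \<mu>) * g1 x + b * f2 x = 0" for x by (simp add: laplacian_zero algebra_simps)
  then have "a * \<mu> = 0 \<and> b = 0" using indep by blast
  then show "a = 0" "b = 0" using \<mu> by auto
qed simp

text \<open>The dominant part of the first generator is a multiple of the second generator.
  Subtracting it exposes \<open>f\<close>; the coefficient grows with \<open>L\<close>, but the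
  determinant stays \<open>1 / c\<close>.\<close>

lemma adapted_basis_proportional:
  assumes t: "test_function g" "test_function f" and c: "c \<noteq> 0"
    and S: "supp g \<subseteq> S" "supp f \<subseteq> S"
    and indep: "\<And>a b. (\<And>x. a * f x + b * g x = 0) \<Longrightarrow> a = 0 \<and> b = 0"
  shows "adapted_basis \<mu> \<kappa> (g, f) (\<lambda>x. 0, \<lambda>x. c * g x) S (\<lambda>L. 1) (\<lambda>L. 0) (\<lambda>L. - \<mu> * L / c) (\<lambda>L. 1 / c) (1 / \<bar>c\<bar>)
    f g (\<lambda>x. 0) (\<lambda>x. 0)"
  unfolding adapted_basis_def
proof (intro conjI allI ballI impI)
  fix q
  show "((\<lambda>L. of_real 1 * classical_part \<mu> L (g, f) q + of_real (- \<mu> * L / c) * classical_part \<mu> L (\<lambda>x. 0, \<lambda>x. c * g x) q) \<longlongrightarrow> fourier f q) at_top"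
    using c by (simp add: classical_part_def fourier_zero fourier_scale_const t)
  show "((\<lambda>L. of_real 0 * classical_part \<mu> L (g, f) q + of_real (1 / c) * classical_part \<mu> L (\<lambda>x. 0, \<lambda>x. c * g x) q) \<longlongrightarrow> fourier g q) at_top"
    using c by (simp add: classical_part_def fourier_zero fourier_scale_const t)
  show "((\<lambda>L. of_real (1 / L) * fourier (fst (g, f)) q + of_real (- \<mu> * L / c / L) * fourier (fst (\<lambda>x. 0, \<lambda>x. c * g x)) q) \<longlongrightarrow> fourier (\<lambda>x. 0) q) at_top"
    using tendsto_mult_left_zero[OF tendsto_of_real_inverse_at_top, of "fourier g q"] by (simp add: fourier_zero)
  show "((\<lambda>L. of_real (0 / L) * fourier (fst (g, f)) q + of_real (1 / c / L) * fourier (fst (\<lambda>x. 0, \<lambda>x. c * g x)) q) \<longlongrightarrow> fourier (\<lambda>x. 0) q) at_top"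
    by (simp add: fourier_zero)
next
  fix L :: real assume L: "1 \<le> L"
  show "1 * (1 / c) - 0 * (- \<mu> * L / c) \<noteq> 0" using c by simp
  have "1 / \<bar>c\<bar> * 1 \<le> 1 / \<bar>c\<bar> * L" using L by (intro mult_left_mono) auto
  then show "\<bar>1 * (1 / c) - 0 * (- \<mu> * L / c)\<bar> \<le> 1 / \<bar>c\<bar> * L" by simp
next
  fix h assume h: "h \<in> {f, g, \<lambda>x. 0, \<lambda>x. 0}"
  then show "test_function h" using t test_function_zero by blast
  show "supp h \<subseteq> S" using h S supp_zero by blast
next
  fix a b assume "\<forall>x. a * f x + b * g x = \<kappa> * (a * laplacian (\<lambda>x. 0) x + b * laplacian (\<lambda>x. 0) x)"
  then have "a * f x + b * g x = 0" for x by (simp add: laplacian_zero)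
  then have "a = 0 \<and> b = 0" using indep by blast
  then show "a = 0" "b = 0" by auto
qed (use c in simp)

text \<open>Every profile is a multiple of \<open>g\<close>, so removing the dominant part leaves
  nothing of \<open>u\<close>; stretching by \<open>L\<close> brings the remaining
  \<open>g / L\<close> to size one. Of the four cases only this one has a determinant growing with
  \<open>L\<close>, and independence here means that \<open>g\<close> is no eigenfunction of the
  Laplacian.\<close>

lemma adapted_basis_degenerate:
  assumes t: "test_function g" and c: "c \<noteq> 0" and \<kappa>: "\<kappa> \<noteq> 0" and nz: "g x0 \<noteq> 0"
    and S: "supp g \<subseteq> S"
  shows "adapted_basis \<mu> \<kappa> (g, \<lambda>x. d * g x) (\<lambda>x. 0, \<lambda>x. c * g x) S
    (\<lambda>L. L) (\<lambda>L. 0) (\<lambda>L. - L * (d + \<mu> * L) / c) (\<lambda>L. 1 / c) (1 / \<bar>c\<bar>)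
    (\<lambda>x. 0) g g (\<lambda>x. 0)"
  unfolding adapted_basis_def
proof (intro conjI allI ballI impI)
  fix q
  show "((\<lambda>L. of_real L * classical_part \<mu> L (g, \<lambda>x. d * g x) q + of_real (- L * (d + \<mu> * L) / c) * classical_part \<mu> L (\<lambda>x. 0, \<lambda>x. c * g x) q) \<longlongrightarrow> fourier (\<lambda>x. 0) q) at_top"
  proof -
    have "of_real L * (of_real d * z + of_real (\<mu> * L) * z) + of_real (- L * (d + \<mu> * L) / c) * (of_real c * z) = 0"
      for L and z :: complex
    proof -
      have "of_real L * (of_real d * z + of_real (\<mu> * L) * z) + of_real (- L * (d + \<mu> * L) / c) * (of_real c * z)
          = of_real (L * (d + \<mu> * L) + - L * (d + \<mu> * L) / c * c) * z"
        by (simp only: of_real_add of_real_mult distrib_left distrib_right mult.assoc)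
      also have "L * (d + \<mu> * L) + - L * (d + \<mu> * L) / c * c = 0" using c by simp
      finally show ?thesis by simp
    qed
    then show ?thesis by (simp only: classical_part_def fst_conv snd_conv fourier_zero fourier_scale_const[OF t] mult_zero_right add_0_right tendsto_const)
  qed
  show "((\<lambda>L. of_real 0 * classical_part \<mu> L (g, \<lambda>x. d * g x) q + of_real (1 / c) * classical_part \<mu> L (\<lambda>x. 0, \<lambda>x. c * g x) q) \<longlongrightarrow> fourier g q) at_top"
    using c by (simp add: classical_part_def fourier_zero fourier_scale_const t)
  have "eventually (\<lambda>L. fourier g q = of_real (L / L) * fourier (fst (g, \<lambda>x. d * g x)) q + of_real (- L * (d + \<mu> * L) / c / L) * fourier (fst (\<lambda>x. 0, \<lambda>x. c * g x)) q) at_top"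
    using eventually_gt_at_top[of "0::real"] by eventually_elim (simp add: fourier_zero)
  then show "((\<lambda>L. of_real (L / L) * fourier (fst (g, \<lambda>x. d * g x)) q + of_real (- L * (d + \<mu> * L) / c / L) * fourier (fst (\<lambda>x. 0, \<lambda>x. c * g x)) q) \<longlongrightarrow> fourier g q) at_top"
    by (rule Lim_transform_eventually[OF tendsto_const])
  show "((\<lambda>L. of_real (0 / L) * fourier (fst (g, \<lambda>x. d * g x)) q + of_real (1 / c / L) * fourier (fst (\<lambda>x. 0, \<lambda>x. c * g x)) q) \<longlongrightarrow> fourier (\<lambda>x. 0) q) at_top"
    by (simp add: fourier_zero)
next
  fix L :: real assume L: "1 \<le> L"
  show "L * (1 / c) - 0 * (- L * (d + \<mu> * L) / c) \<noteq> 0" using c L by simp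
  show "\<bar>L * (1 / c) - 0 * (- L * (d + \<mu> * L) / c)\<bar> \<le> 1 / \<bar>c\<bar> * L" using L by simp
next
  fix h assume h: "h \<in> {\<lambda>x. 0, g, g, \<lambda>x. 0}"
  then show "test_function h" using t test_function_zero by blast
  show "supp h \<subseteq> S" using h S supp_zero by blast
next
  fix a b assume "\<forall>x. a * 0 + b * g x = \<kappa> * (a * laplacian g x + b * laplacian (\<lambda>x. 0) x)"
  then have "b * g x = \<kappa> * (a * laplacian g x)" for x by (simp add: laplacian_zero)
  from laplacian_no_eigenfunction[OF t nz \<kappa> this] show "a = 0" "b = 0" by auto
qed (use c in simp)

lemma commutator_form_comb:
  "commutator_form (comb k11 \<gamma>1 k21 \<gamma>2) (comb k12 \<gamma>1 k22 \<gamma>2) = (k11 * k22 - k12 * k21) * commutator_form \<gamma>1 \<gamma>2"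
proof -
  have "fst (comb k11 \<gamma>1 k21 \<gamma>2) x * snd (comb k12 \<gamma>1 k22 \<gamma>2) x - snd (comb k11 \<gamma>1 k21 \<gamma>2) x * fst (comb k12 \<gamma>1 k22 \<gamma>2) x
      = (k11 * k22 - k12 * k21) * (fst \<gamma>1 x * snd \<gamma>2 x - snd \<gamma>1 x * fst \<gamma>2 x)" for x
    by (simp add: comb_def algebra_simps)
  then show ?thesis by (simp add: commutator_form_def)
qed

text \<open>The preceding four cases are exhaustive. If \<open>g1\<close> and \<open>g2\<close> are
  dependent, a change of generators removes one of them; what remains is whether the other field
  profile, and then the profile \<open>F\<close>, is a multiple of \<open>G\<close>.\<close>

lemma adapted_basis_exists:
  assumes A: "single_mode A" and \<mu>: "\<mu> > 0" and \<kappa>: "\<kappa> \<noteq> 0"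
  shows "\<exists>s11 s12 s21 s22 C U1 U2 W1 W2. adapted_basis \<mu> \<kappa> (fst A) (snd A) (mode_support A) s11 s12 s21 s22 C U1 U2 W1 W2"
proof -
  obtain g1 f1 g2 f2 where A': "A = ((g1, f1), (g2, f2))" by (metis prod.collapse)
  have t: "test_function g1" "test_function f1" "test_function g2" "test_function f2"
    and comm: "commutator_form (g1, f1) (g2, f2) = 1"
    using A by (auto simp: single_mode_def A')
  define S where "S = mode_support A"
  have S: "supp g1 \<subseteq> S" "supp f1 \<subseteq> S" "supp g2 \<subseteq> S" "supp f2 \<subseteq> S"
    by (auto simp: S_def mode_support_def A')
  have clS: "closed S"
    unfolding S_def mode_support_def by (intro closed_UN closed_Un closed_supp ballI) simp
  show ?thesis
  proof (cases "\<forall>a b. (\<forall>x. a * g1 x + b * g2 x = 0) \<longrightarrow> a = 0 \<and> b = 0")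
    case True
    then have "\<And>a b. (\<And>x. a * g1 x + b * g2 x = 0) \<Longrightarrow> a = 0 \<and> b = 0" by blast
    from adapted_basis_independent[OF t \<mu> S(1,3) this] show ?thesis
      unfolding S_def[symmetric] unfolding A' fst_conv snd_conv by blast
  next
    case False
    then obtain a b where ab: "\<And>x. a * g1 x + b * g2 x = 0" "a \<noteq> 0 \<or> b \<noteq> 0" by blast
    \<comment> \<open>The combination \<open>(a, b)\<close> has no momentum part; division by
      \<open>a^2 + b^2\<close> completes it to a matrix of determinant 1.\<close>
    define k11 k21 where k: "k11 = b / (a^2 + b^2)" "k21 = - a / (a^2 + b^2)"
    have nz: "a^2 + b^2 \<noteq> 0" using ab(2) by (simp add: sum_power2_eq_zero_iff)
    have det: "k11 * b - a * k21 = 1" using nz by (simp add: k power2_eq_square add_divide_distrib[symmetric])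
    define G F F2 where GF: "G = (\<lambda>x. k11 * g1 x + k21 * g2 x)" "F = (\<lambda>x. k11 * f1 x + k21 * f2 x)" "F2 = (\<lambda>x. a * f1 x + b * f2 x)"
    have tG: "test_function G" "test_function F" "test_function F2"
      unfolding GF using t test_function_lincomb by blast+
    have SG: "supp G \<subseteq> S" "supp F \<subseteq> S" "supp F2 \<subseteq> S"
    proof -
      have "g1 x = 0 \<and> f1 x = 0 \<and> g2 x = 0 \<and> f2 x = 0" if "x \<notin> S" for x
        using S that not_in_supp by blast
      then show "supp G \<subseteq> S" "supp F \<subseteq> S" "supp F2 \<subseteq> S"
        by (auto simp: GF intro!: supp_subset[OF clS])
    qed
    have c1: "comb k11 (g1, f1) k21 (g2, f2) = (G, F)" by (simp add: comb_def GF)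
    have c2: "comb a (g1, f1) b (g2, f2) = (\<lambda>x. 0, F2)" by (simp add: comb_def GF ab)
    have "commutator_form (G, F) (\<lambda>x. 0, F2) = 1"
      using commutator_form_comb[of k11 "(g1, f1)" k21 "(g2, f2)" a b] by (simp add: c1 c2 det comm)
    then have GF2: "(LINT x|lborel. G x * F2 x) = 1" by (simp add: commutator_form_def)
    \<comment> \<open>The commutator has become the integral of \<open>G x * F2 x\<close>. A point
      where both factors are nonzero later rules out \<open>b' = 0\<close>, \<open>c = 0\<close> and
      \<open>a'' = 0\<close>.\<close>
    have "\<exists>x. G x * F2 x \<noteq> 0"
    proof (rule ccontr)
      assume "\<not> ?thesis"
      then have "(\<lambda>x. G x * F2 x) = (\<lambda>x. 0)" by blast
      with GF2 show False by simp
    qed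
    then obtain x0 where x0: "G x0 \<noteq> 0" "F2 x0 \<noteq> 0" by auto
    have to: "test_observable (g1, f1)" "test_observable (g2, f2)" by (simp_all add: test_observable_def t)
    have main: "\<exists>s11 s12 s21 s22 C U1 U2 W1 W2. adapted_basis \<mu> \<kappa> (G, F) (\<lambda>x. 0, F2) S s11 s12 s21 s22 C U1 U2 W1 W2"
    proof (cases "\<forall>a b. (\<forall>x. a * G x + b * F2 x = 0) \<longrightarrow> a = 0 \<and> b = 0")
      case True
      then have "\<And>a b. (\<And>x. a * G x + b * F2 x = 0) \<Longrightarrow> a = 0 \<and> b = 0" by blast
      from adapted_basis_momentum_field[OF tG \<mu> SG(1,3) this] show ?thesis by blast
    next
      case False
      then obtain a' b' where 1: "\<And>x. a' * G x + b' * F2 x = 0" "a' \<noteq> 0 \<or> b' \<noteq> 0" by blast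
      have "b' \<noteq> 0" using 1 x0(1) by (metis add.right_neutral mult_eq_0_iff)
      define c where "c = - a' / b'"
      have F2: "F2 = (\<lambda>x. c * G x)"
      proof
        fix x show "F2 x = c * G x" using 1(1)[of x] \<open>b' \<noteq> 0\<close> by (simp add: c_def field_simps)
      qed
      have c: "c \<noteq> 0" using x0(2) F2 by auto
      show ?thesis
      proof (cases "\<forall>a b. (\<forall>x. a * F x + b * G x = 0) \<longrightarrow> a = 0 \<and> b = 0")
        case True
        then have "\<And>a b. (\<And>x. a * F x + b * G x = 0) \<Longrightarrow> a = 0 \<and> b = 0" by blast
        from adapted_basis_proportional[OF tG(1,2) c SG(1,2) this] show ?thesis unfolding F2 by blast
      next
        case False
        then obtain a'' b'' where 2: "\<And>x. a'' * F x + b'' * G x = 0" "a'' \<noteq> 0 \<or> b'' \<noteq> 0" by blast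
        have "a'' \<noteq> 0" using 2 x0(1) by (metis add.left_neutral mult_eq_0_iff)
        have F: "F = (\<lambda>x. (- b'' / a'') * G x)"
        proof
          fix x show "F x = (- b'' / a'') * G x" using 2(1)[of x] \<open>a'' \<noteq> 0\<close> by (simp add: field_simps)
        qed
        from adapted_basis_degenerate[OF tG(1) c \<kappa> x0(1) SG(1), of \<mu> "- b'' / a''"] show ?thesis
          unfolding F2 F by blast
      qed
    qed
    then obtain s11 s12 s21 s22 C U1 U2 W1 W2 where
      "adapted_basis \<mu> \<kappa> (comb k11 (g1, f1) k21 (g2, f2)) (comb a (g1, f1) b (g2, f2)) S s11 s12 s21 s22 C U1 U2 W1 W2"
      unfolding c1 c2 by blast
    from adapted_basis_change[OF to det this] show ?thesis
      unfolding S_def[symmetric] unfolding A' fst_conv snd_conv by blast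
  qed
qed

section \<open>Amplitudes in the Bunch-Davies vacuum\<close>

definition amplitude :: "real \<Rightarrow> real \<Rightarrow> real \<Rightarrow> observable \<Rightarrow> real^3 \<Rightarrow> complex" where
  "amplitude n \<mu> L \<gamma> q = classical_part \<mu> L \<gamma> q * real_H n (norm q / L) +
     of_real (norm q) * fourier (fst \<gamma>) q * real_H (n - 1) (norm q / L)"

lemma borel_measurable_amplitude:
  assumes "test_observable \<gamma>" "L > 0"
  shows "amplitude n \<mu> L \<gamma> \<in> borel_measurable borel"
proof (rule borel_measurable_continuous_countable_exceptions[of "{0}"])
  have "continuous_on (- {0}) (\<lambda>q::real^3. real_H \<nu> (norm q / L))" for \<nu>
    using assms(2) by (intro continuous_on_compose2[OF continuous_on_real_H] continuous_intros) (auto simp: zero_less_divide_iff)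
  then show "continuous_on (- {0}) (amplitude n \<mu> L \<gamma>)"
    using assms unfolding amplitude_def[abs_def] classical_part_def test_observable_def
    by (intro continuous_intros continuous_on_fourier) auto
qed simp

lemma real_H_scaled_bound:
  assumes "0 < \<nu>" "\<nu> \<le> 2" "L > 0"
  shows "\<exists>K>0. \<forall>r>0. cmod (real_H \<nu> (r / L)) \<le> K * (r powr (- \<nu>) + r^3)"
proof -
  obtain C where C: "C > 0" "\<And>s. s > 0 \<Longrightarrow> cmod (real_H \<nu> s) \<le> C * (s powr (- \<nu>) + s^3)"
    using real_H_bound[OF assms(1,2)] by blast
  define K where "K = C * (L powr \<nu> + 1 / L^3)"
  have "cmod (real_H \<nu> (r / L)) \<le> K * (r powr (- \<nu>) + r^3)" if r: "r > 0" for r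
  proof -
    have "(r / L) powr (- \<nu>) = L powr \<nu> * r powr (- \<nu>)"
      using r assms by (simp add: powr_divide powr_minus_divide)
    moreover have "(r / L)^3 = (1 / L^3) * r^3" by (simp add: power_divide)
    moreover have "L powr \<nu> * x + (1 / L^3) * y \<le> (L powr \<nu> + 1 / L^3) * (x + y)" if "x \<ge> 0" "y \<ge> 0" for x y
    proof -
      have "0 \<le> L powr \<nu> * y" "0 \<le> (1 / L^3) * x" using that assms by (simp_all del: times_divide_eq_left)
      then show ?thesis unfolding distrib_left distrib_right by linarith
    qed
    ultimately have "(r / L) powr (- \<nu>) + (r / L)^3 \<le> (L powr \<nu> + 1 / L^3) * (r powr (- \<nu>) + r^3)"
      using r by simp
    then have "C * ((r / L) powr (- \<nu>) + (r / L)^3) \<le> K * (r powr (- \<nu>) + r^3)"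
      using C(1) unfolding K_def mult.assoc by (intro mult_left_mono) auto
    then show ?thesis using C(2)[of "r / L"] r assms by simp
  qed
  moreover have "K > 0" using C(1) assms by (simp add: K_def add_pos_pos)
  ultimately show ?thesis by blast
qed

text \<open>The sixth power is set by the momentum term: \<open>norm q\<close> times cubic Hankel
  growth is of order 4, which leaves an amplitude decaying like
  \<open>norm q powr (- 2)\<close>.\<close>

lemma fourier_bounds:
  assumes "test_function f"
  shows "\<exists>D>0. \<forall>q. cmod (fourier f q) \<le> D \<and> norm q ^ 6 * cmod (fourier f q) \<le> D"
proof -
  obtain C0 where C0: "\<And>q. cmod (fourier f q) \<le> C0" using fourier_decay[OF assms, of 0] by auto
  obtain C6 where C6: "\<And>q. norm q ^ 6 * cmod (fourier f q) \<le> C6" using fourier_decay[OF assms, of 3] by auto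
  have "cmod (fourier f q) \<le> \<bar>C0\<bar> + \<bar>C6\<bar> + 1 \<and> norm q ^ 6 * cmod (fourier f q) \<le> \<bar>C0\<bar> + \<bar>C6\<bar> + 1" for q
    using C0[of q] C6[of q] by linarith
  then show ?thesis by (intro exI[of _ "\<bar>C0\<bar> + \<bar>C6\<bar> + 1"]) simp
qed

text \<open>At the origin the worst singularity of the square is
  \<open>norm q powr (- 2 * n)\<close> with \<open>2 * n < 3\<close>, the infrared finiteness
  provided by the mass; at infinity the square decays with exponent 4.\<close>

lemma amplitude_square_integrable:
  assumes \<gamma>: "test_observable \<gamma>" and L: "L > 0" and n: "1 < n" "n < 3/2"
  shows "integrable lborel (\<lambda>q. (cmod (amplitude n \<mu> L \<gamma> q))^2)"
proof -
  obtain D1 where D1: "D1 > 0" "\<And>q. cmod (fourier (snd \<gamma>) q) \<le> D1" "\<And>q. norm q ^ 6 * cmod (fourier (snd \<gamma>) q) \<le> D1"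
    using fourier_bounds[of "snd \<gamma>"] \<gamma> by (auto simp: test_observable_def)
  obtain D2 where D2: "D2 > 0" "\<And>q. cmod (fourier (fst \<gamma>) q) \<le> D2" "\<And>q. norm q ^ 6 * cmod (fourier (fst \<gamma>) q) \<le> D2"
    using fourier_bounds[of "fst \<gamma>"] \<gamma> by (auto simp: test_observable_def)
  define D where "D = D1 + (\<bar>\<mu> * L\<bar> + 1) * D2"
  have D: "D > 0" using D1(1) D2(1) by (simp add: D_def add_pos_pos)
  have cp: "cmod (classical_part \<mu> L \<gamma> q) \<le> D \<and> norm q ^ 6 * cmod (classical_part \<mu> L \<gamma> q) \<le> D" for q
  proof -
    have 1: "cmod (classical_part \<mu> L \<gamma> q) \<le> cmod (fourier (snd \<gamma>) q) + \<bar>\<mu> * L\<bar> * cmod (fourier (fst \<gamma>) q)"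
      unfolding classical_part_def by (rule norm_triangle_le) (simp add: norm_mult abs_mult)
    have 2: "\<bar>\<mu> * L\<bar> * D2 \<le> (\<bar>\<mu> * L\<bar> + 1) * D2" using D2(1) by (intro mult_right_mono) auto
    have "\<bar>\<mu> * L\<bar> * cmod (fourier (fst \<gamma>) q) \<le> \<bar>\<mu> * L\<bar> * D2" using D2(2) by (intro mult_left_mono) auto
    then have "cmod (classical_part \<mu> L \<gamma> q) \<le> D" using 1 2 D1(2)[of q] unfolding D_def by linarith
    moreover have "norm q ^ 6 * cmod (classical_part \<mu> L \<gamma> q) \<le> norm q ^ 6 * cmod (fourier (snd \<gamma>) q) + \<bar>\<mu> * L\<bar> * (norm q ^ 6 * cmod (fourier (fst \<gamma>) q))"
      using mult_left_mono[OF 1, of "norm q ^ 6"] by (simp add: distrib_left mult.left_commute)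
    moreover have "\<bar>\<mu> * L\<bar> * (norm q ^ 6 * cmod (fourier (fst \<gamma>) q)) \<le> \<bar>\<mu> * L\<bar> * D2" using D2(3) by (intro mult_left_mono) auto
    ultimately show ?thesis using 2 D1(3)[of q] unfolding D_def by linarith
  qed
  have g: "cmod (fourier (fst \<gamma>) q) \<le> D \<and> norm q ^ 6 * cmod (fourier (fst \<gamma>) q) \<le> D" for q
  proof -
    have "1 * D2 \<le> (\<bar>\<mu> * L\<bar> + 1) * D2" using D2(1) by (intro mult_right_mono) auto
    then have "D2 \<le> D" using D1(1) unfolding D_def by linarith
    then show ?thesis using D2(2,3) order_trans by blast
  qed
  obtain K1 where K1: "K1 > 0" "\<And>r. r > 0 \<Longrightarrow> cmod (real_H n (r / L)) \<le> K1 * (r powr (- n) + r^3)"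
    using real_H_scaled_bound[of n L] n L by auto
  obtain K2 where K2: "K2 > 0" "\<And>r. r > 0 \<Longrightarrow> cmod (real_H (n - 1) (r / L)) \<le> K2 * (r powr (- (n - 1)) + r^3)"
    using real_H_scaled_bound[of "n - 1" L] n L by auto
  define K where "K = 2 * D * (K1 + K2)"
  define B where "B r = (if r \<le> 1 then r powr (- n) else r powr (- 2))" for r :: real
  have amp: "cmod (amplitude n \<mu> L \<gamma> q) \<le> K * B (norm q)" if "q \<noteq> 0" for q
  proof -
    define r where "r = norm q"
    have r: "r > 0" using that by (simp add: r_def)
    define x y where "x = cmod (classical_part \<mu> L \<gamma> q)" and "y = cmod (fourier (fst \<gamma>) q)"
    have x0: "x \<ge> 0" "y \<ge> 0" by (simp_all add: x_def y_def)
    have "cmod (amplitude n \<mu> L \<gamma> q) \<le> x * cmod (real_H n (r / L)) + r * y * cmod (real_H (n - 1) (r / L))"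
      unfolding amplitude_def x_def y_def r_def by (rule norm_triangle_le) (simp add: norm_mult)
    also have "\<dots> \<le> x * (K1 * (r powr (- n) + r^3)) + r * y * (K2 * (r powr (- (n - 1)) + r^3))"
      using K1(2)[OF r] K2(2)[OF r] r x0 by (intro add_mono mult_left_mono) auto
    also have "\<dots> = K1 * (x * (r powr (- n) + r^3)) + K2 * (y * (r * (r powr (- (n - 1)) + r^3)))"
      by (simp add: mult_ac)
    also have "\<dots> \<le> K1 * (D * (2 * B r)) + K2 * (D * (2 * B r))"
    proof (cases "r \<le> 1")
      case True
      have p: "1 \<le> r powr (- n)" using r True n by (simp add: powr_minus one_le_inverse_iff powr_le1)
      have r3: "r^3 \<le> 1" "r^4 \<le> 1" using r True by (auto intro: power_le_one)
      have "r * r powr (- (n - 1)) = r powr (2 - n)"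
        using r powr_add[of r 1 "- (n - 1)"] by simp
      also have "\<dots> \<le> r powr (- n)" using r True by (intro powr_mono') auto
      finally have a: "r * r powr (- (n - 1)) \<le> r powr (- n)" .
      have b1: "r powr (- n) + r^3 \<le> 2 * B r" using r3 p True by (simp add: B_def)
      have b2: "r * (r powr (- (n - 1)) + r^3) \<le> 2 * B r"
        using a r3 p True by (simp add: B_def distrib_left power_Suc[symmetric])
      have xy: "x \<le> D" "y \<le> D" using cp[of q] g[of q] by (simp_all add: x_def y_def)
      have 1: "x * (r powr (- n) + r^3) \<le> D * (2 * B r)"
        using b1 xy(1) x0(1) D r by (intro mult_mono) auto
      have 2: "y * (r * (r powr (- (n - 1)) + r^3)) \<le> D * (2 * B r)"
        by (rule mult_mono[OF xy(2) b2]) (use D r in auto)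
      show ?thesis using 1 2 K1(1) K2(1) by (intro add_mono mult_left_mono) auto
    next
      case False
      have p: "r powr (- n) \<le> 1" "r powr (- (n - 1)) \<le> 1"
        using powr_mono[of "- n" 0 r] powr_mono[of "- (n - 1)" 0 r] False n by simp_all
      have r3: "1 \<le> r^3" using False by simp
      have B: "B r = 1 / r^2" using r False by (simp add: B_def powr_minus_divide)
      have x6: "x \<le> D / r^6" "y \<le> D / r^6"
        using cp[of q] g[of q] r unfolding x_def y_def r_def by (auto simp: field_simps)
      have e: "D / r^6 * (2 * r^4) = D * (2 * B r)" unfolding B using r by (simp add: field_simps eval_nat_numeral)
      have "r^3 \<le> r^4" using False by (intro power_increasing) auto
      then have "r powr (- n) + r^3 \<le> 2 * r^4" using p r3 by linarith
      then have 1: "x * (r powr (- n) + r^3) \<le> D / r^6 * (2 * r^4)"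
        using x6 x0 r D by (intro mult_mono) auto
      have "r * (r powr (- (n - 1)) + r^3) \<le> r * (2 * r^3)" using p r3 r by (intro mult_left_mono) auto
      also have "\<dots> = 2 * r^4" by (simp add: eval_nat_numeral)
      finally have b2: "r * (r powr (- (n - 1)) + r^3) \<le> 2 * r^4" .
      have 2: "y * (r * (r powr (- (n - 1)) + r^3)) \<le> D / r^6 * (2 * r^4)"
        by (rule mult_mono[OF x6(2) b2]) (use D r in auto)
      show ?thesis using 1 2 K1(1) K2(1) unfolding e by (intro add_mono mult_left_mono) auto
    qed
    also have "\<dots> = K * B r" by (simp add: K_def algebra_simps)
    finally show ?thesis by (simp add: r_def)
  qed
  have "integrable lborel (\<lambda>q::real^3. K^2 * (indicator (cball 0 1) q * norm q powr (- (2 * n)) + indicator (- cball 0 1) q * norm q powr (- 4)))"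
    using n by (intro integrable_mult_right integrable_two_powers) auto
  then show ?thesis
  proof (rule Bochner_Integration.integrable_bound)
    show "(\<lambda>q. (cmod (amplitude n \<mu> L \<gamma> q))^2) \<in> borel_measurable lborel"
      using borel_measurable_amplitude[OF \<gamma> L] by measurable
    have "AE q in lborel. q \<noteq> (0::real^3)" by (rule AE_lborel_singleton)
    then show "AE q in lborel. norm ((cmod (amplitude n \<mu> L \<gamma> q))^2) \<le>
        norm (K^2 * (indicator (cball 0 1) q * norm q powr (- (2 * n)) + indicator (- cball 0 1) q * norm q powr (- 4)))"
    proof eventually_elim
      case (elim q)
      have "(cmod (amplitude n \<mu> L \<gamma> q))^2 \<le> (K * B (norm q))^2"
        using amp[OF elim] by (intro power_mono) auto
      also have "\<dots> = K^2 * (indicator (cball 0 1) q * norm q powr (- (2 * n)) + indicator (- cball 0 1) q * norm q powr (- 4))"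
        by (cases "norm q \<le> 1") (simp_all add: B_def power_mult_distrib power2_eq_square powr_add[symmetric])
      finally show ?case by simp
    qed
  qed
qed

lemma integrable_mult_cnj:
  fixes a b :: "'a \<Rightarrow> complex"
  assumes [measurable]: "a \<in> borel_measurable M" "b \<in> borel_measurable M"
    and "integrable M (\<lambda>x. (cmod (a x))^2)" "integrable M (\<lambda>x. (cmod (b x))^2)"
  shows "integrable M (\<lambda>x. a x * cnj (b x))"
proof (rule Bochner_Integration.integrable_bound[OF Bochner_Integration.integrable_add[OF assms(3,4)]])
  have [measurable]: "(\<lambda>x. cnj (b x)) \<in> borel_measurable M"
    by (rule measurable_compose[OF assms(2)]) (intro borel_measurable_continuous_onI continuous_intros)
  show "(\<lambda>x. a x * cnj (b x)) \<in> borel_measurable M" by measurable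
  show "AE x in M. norm (a x * cnj (b x)) \<le> norm ((cmod (a x))^2 + (cmod (b x))^2)"
  proof (rule AE_I2)
    fix x
    have "cmod (a x) * cmod (b x) \<le> (cmod (a x))^2 + (cmod (b x))^2"
      using sum_squares_bound[of "cmod (a x)" "cmod (b x)"] mult_nonneg_nonneg[OF norm_ge_zero[of "a x"] norm_ge_zero[of "b x"]]
      by linarith
    then show "norm (a x * cnj (b x)) \<le> norm ((cmod (a x))^2 + (cmod (b x))^2)" by (simp add: norm_mult)
  qed
qed

text \<open>Brings the covariance form into the shape of an integrated square, from which its
  positivity follows and to which the coercivity estimate applies.\<close>

lemma gram_form:
  fixes a :: "'i::finite \<Rightarrow> 'a \<Rightarrow> complex" and x :: "real^'i"
  assumes int: "\<And>i j. integrable M (\<lambda>q. a i q * cnj (a j q))"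
  shows "(\<Sum>i\<in>UNIV. \<Sum>j\<in>UNIV. x$i * x$j * Re (LINT q|M. a i q * cnj (a j q))) =
      (LINT q|M. (cmod (\<Sum>i\<in>UNIV. of_real (x$i) * a i q))^2)"
    and "integrable M (\<lambda>q. (cmod (\<Sum>i\<in>UNIV. of_real (x$i) * a i q))^2)"
proof -
  have e: "(cmod (\<Sum>i\<in>UNIV. of_real (x$i) * a i q))^2 = (\<Sum>i\<in>UNIV. \<Sum>j\<in>UNIV. x$i * x$j * Re (a i q * cnj (a j q)))" for q
  proof -
    have "complex_of_real ((cmod (\<Sum>i\<in>UNIV. of_real (x$i) * a i q))^2) =
      (\<Sum>i\<in>UNIV. \<Sum>j\<in>UNIV. of_real (x$i * x$j) * (a i q * cnj (a j q)))"
      unfolding complex_norm_square by (simp add: sum_product mult_ac)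
    then have "Re (complex_of_real ((cmod (\<Sum>i\<in>UNIV. of_real (x$i) * a i q))^2)) =
      (\<Sum>i\<in>UNIV. \<Sum>j\<in>UNIV. Re (of_real (x$i * x$j) * (a i q * cnj (a j q))))"
      by (simp only: Re_sum)
    moreover have "Re (of_real c * z) = c * Re z" for c z by simp
    ultimately show ?thesis by (simp only: Re_complex_of_real)
  qed
  have i: "integrable M (\<lambda>q. x$i * x$j * Re (a i q * cnj (a j q)))" for i j
    using integrable_Re[OF int[of i j]] by (intro integrable_mult_right)
  show "integrable M (\<lambda>q. (cmod (\<Sum>i\<in>UNIV. of_real (x$i) * a i q))^2)"
    unfolding e by (intro Bochner_Integration.integrable_sum i)
  show "(\<Sum>i\<in>UNIV. \<Sum>j\<in>UNIV. x$i * x$j * Re (LINT q|M. a i q * cnj (a j q))) =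
      (LINT q|M. (cmod (\<Sum>i\<in>UNIV. of_real (x$i) * a i q))^2)"
  proof -
    have "(LINT q|M. x$i * x$j * Re (a i q * cnj (a j q))) = x$i * x$j * Re (LINT q|M. a i q * cnj (a j q))" for i j
      by (simp only: integral_mult_right_zero integral_Re[OF int])
    then show ?thesis
      unfolding e by (simp only: Bochner_Integration.integral_sum[OF Bochner_Integration.integrable_sum[OF i]]
          Bochner_Integration.integral_sum[OF i])
  qed
qed

text \<open>The transform of \<open>f\<close> acquires a factor \<open>R\<close>, that of
  \<open>g\<close> a factor \<open>R^2\<close>, and the momentum prefactor is \<open>H\<close> times
  the field prefactor. Thus \<open>q = R *\<^sub>R k\<close> leaves only \<open>R * H\<close>, and
  the Jacobian turns the common factor into a multiple of \<open>1 / (R * H)\<close>.\<close>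

lemma two_point_BD_scaled:
  fixes \<gamma> \<gamma>' :: observable
  assumes \<gamma>: "test_observable \<gamma>" "test_observable \<gamma>'" and H: "H > 0" and R: "R > 0"
    and n: "BD_index m H = n" "n \<notin> \<int>" "n - 1 \<notin> \<int>" and \<mu>: "BD_mu2 m H = \<mu>"
  shows "two_point (BD_field m H) (BD_momentum m H) (scale_observable R \<gamma>) (scale_observable R \<gamma>') =
    pi / (2 * (R * H)) / (2 * pi)^3 * Re (LINT q|lborel. amplitude n \<mu> (R * H) \<gamma> q * cnj (amplitude n \<mu> (R * H) \<gamma>' q))"
proof -
  define L where "L = R * H"
  have L: "L > 0" using H R by (simp add: L_def)
  define c where "c = R * sqrt (pi / (4 * H))"
  define a where "a \<gamma> k = fourier (snd \<gamma>) k * BD_field m H (norm k) - fourier (fst \<gamma>) k * BD_momentum m H (norm k)" for \<gamma> k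
  define A where "A = amplitude n \<mu> L"
  have sq: "sqrt (pi * H / 4) = H * sqrt (pi / (4 * H))"
  proof -
    have e: "pi * H / 4 = H^2 * (pi / (4 * H))" using H by (simp add: power2_eq_square)
    show ?thesis unfolding e real_sqrt_mult using H by simp
  qed
  have a: "a (scale_observable R \<delta>) k = of_real c * A \<delta> (R *\<^sub>R k)" if \<delta>: "test_observable \<delta>" and k: "k \<noteq> 0" for \<delta> k
  proof -
    define F G where "F = fourier (snd \<delta>) (R *\<^sub>R k)" and "G = fourier (fst \<delta>) (R *\<^sub>R k)"
    have t: "test_function (fst \<delta>)" "test_function (snd \<delta>)" using \<delta> by (auto simp: test_observable_def)
    have s: "norm (R *\<^sub>R k) / L = norm k / H" using R H by (simp add: L_def)
    have pos: "norm k / H > 0" using k H by simp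
    have tR: "fourier (\<lambda>x. f (x /\<^sub>R R) / r) k = of_real (R^3 / r) * fourier f (R *\<^sub>R k)" if "test_function f" for f r
    proof -
      have "fourier (\<lambda>x. f (x /\<^sub>R R) / r) k = (LINT x|lborel. of_real (1 / r) * (complex_of_real (f (x /\<^sub>R R)) * exp (- (\<i> * complex_of_real (k \<bullet> x)))))"
        unfolding fourier_def by (simp add: field_simps)
      also have "\<dots> = of_real (1 / r) * fourier (\<lambda>x. f (x /\<^sub>R R)) k"
        unfolding fourier_def by (simp only: integral_mult_right_zero)
      finally show ?thesis using fourier_scale[OF that R, of k] by simp
    qed
    have f: "fourier (snd (scale_observable R \<delta>)) k = of_real R * F"
      using tR[OF t(2), of "R^2"] R by (simp add: scale_observable_def F_def power2_eq_square power3_eq_cube)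
    have g: "fourier (fst (scale_observable R \<delta>)) k = of_real (R^2) * G"
      using tR[OF t(1), of R] R by (simp add: scale_observable_def G_def power2_eq_square power3_eq_cube)
    have h: "hankel1 (of_real n) (of_real (norm k / H)) = real_H n (norm k / H)"
      "hankel1 (of_real n - 1) (of_real (norm k / H)) = real_H (n - 1) (norm k / H)"
      using hankel1_of_real[OF pos n(2)] hankel1_of_real[OF pos n(3)] by simp_all
    define h1 h2 where "h1 = real_H n (norm k / H)" and "h2 = real_H (n - 1) (norm k / H)"
    define w where "w = complex_of_real (sqrt (pi / (4 * H)))"
    have "a (scale_observable R \<delta>) k = of_real R * F * (w * h1) -
        of_real (R^2) * G * (- of_real (sqrt (pi * H / 4)) * (of_real \<mu> * h1 + of_real (norm k / H) * h2))"
      unfolding a_def f g BD_field_def BD_momentum_def n(1) \<mu> h h1_def h2_def w_def of_real_diff of_real_1 ..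
    also have "of_real (sqrt (pi * H / 4)) = of_real H * w"
      unfolding sq w_def by simp
    also have "of_real R * F * (w * h1) - of_real (R^2) * G * (- (of_real H * w) * (of_real \<mu> * h1 + of_real (norm k / H) * h2))
       = of_real R * w * ((F + of_real (\<mu> * L) * G) * h1 + of_real (R * norm k) * G * h2)"
      using H by (simp add: L_def power2_eq_square field_simps)
    also have "\<dots> = of_real c * A \<delta> (R *\<^sub>R k)"
      using R unfolding A_def amplitude_def classical_part_def s F_def[symmetric] G_def[symmetric] h1_def[symmetric] h2_def[symmetric]
      by (simp add: c_def w_def)
    finally show ?thesis .
  qed
  define g where "g q = A \<gamma> q * cnj (A \<gamma>' q)" for q
  have [measurable]: "A \<gamma> \<in> borel_measurable borel" "A \<gamma>' \<in> borel_measurable borel"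
    unfolding A_def using borel_measurable_amplitude \<gamma> L by blast+
  have [measurable]: "(\<lambda>q. cnj (A \<gamma>' q)) \<in> borel_measurable borel"
    by (rule measurable_compose[of "A \<gamma>'" borel borel]) (measurable, intro borel_measurable_continuous_onI continuous_intros)
  have gm: "g \<in> borel_measurable borel" unfolding g_def by measurable
  have "(LINT k|lborel. a (scale_observable R \<gamma>) k * cnj (a (scale_observable R \<gamma>') k) / of_real ((2 * pi)^3))
      = (LINT k|lborel. of_real (c^2 / (2 * pi)^3) * g (R *\<^sub>R k))"
  proof (rule integral_cong_AE)
    have Rm: "(\<lambda>k::real^3. R *\<^sub>R k) \<in> borel_measurable borel" by measurable
    show gR: "(\<lambda>k. of_real (c^2 / (2 * pi)^3) * g (R *\<^sub>R k)) \<in> borel_measurable lborel"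
      using measurable_compose[OF Rm gm] by measurable
    have "AE k in lborel. k \<noteq> (0::real^3)" by (rule AE_lborel_singleton)
    then show ae: "AE k in lborel. a (scale_observable R \<gamma>) k * cnj (a (scale_observable R \<gamma>') k) / of_real ((2 * pi)^3)
        = of_real (c^2 / (2 * pi)^3) * g (R *\<^sub>R k)"
      by eventually_elim (simp add: a[OF \<gamma>(1)] a[OF \<gamma>(2)] g_def power2_eq_square)
    show "(\<lambda>k. a (scale_observable R \<gamma>) k * cnj (a (scale_observable R \<gamma>') k) / of_real ((2 * pi)^3)) \<in> borel_measurable lborel"
    \<comment> \<open>The identification with the amplitude is available only for
      \<open>k \<noteq> 0\<close>, where the Hankel argument is positive; altering a single point
      preserves measurability.\<close>
    proof (rule measurable_discrete_difference[OF gR, where X = "{0}"])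
    qed (auto simp: a[OF \<gamma>(1)] a[OF \<gamma>(2)] g_def power2_eq_square)
  qed
  also have "\<dots> = of_real (c^2 / (2 * pi)^3) * (LINT k|lborel. g (R *\<^sub>R k))"
    by (simp only: integral_mult_right_zero)
  also have "(LINT k|lborel. g (R *\<^sub>R k)) = of_real (1 / R^3) * (LINT q|lborel. g q)"
    using lborel_integral_affine[of R g 0] gm R by (simp add: scaleR_conv_of_real[where 'a = complex])
  finally have "(LINT k|lborel. a (scale_observable R \<gamma>) k * cnj (a (scale_observable R \<gamma>') k) / of_real ((2 * pi)^3))
      = of_real (c^2 / (2 * pi)^3 / R^3) * (LINT q|lborel. g q)"
    by simp
  moreover have "2 * (c^2 / (2 * pi)^3 / R^3) = pi / (2 * L) / (2 * pi)^3"
  proof -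
    have "c^2 = R^2 * (pi / (4 * H))" using H by (simp add: c_def power_mult_distrib)
    then show ?thesis using R H by (simp add: L_def field_simps power2_eq_square power3_eq_cube)
  qed
  moreover have "Re (of_real x * z) = x * Re z" for x z by simp
  ultimately show ?thesis
    unfolding two_point_def Let_def a_def[symmetric] L_def[symmetric] A_def[symmetric] g_def[symmetric]
    by (simp only: mult.assoc[symmetric])
qed

text \<open>The Hankel function of order \<open>n - 1\<close> grows one power of \<open>L\<close>
  more slowly than that of order \<open>n\<close>; pairing it with \<open>g / L\<close> makes up the
  difference. Its prefactor \<open>norm q\<close> turns the singularity of order
  \<open>n - 1\<close> into \<open>norm q powr (2 - n)\<close>.\<close>

lemma amplitude_family_limit:
  fixes s1 s2 :: "real \<Rightarrow> real"
  assumes n: "1 < n" and q: "q \<noteq> 0"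
    and U: "((\<lambda>L. of_real (s1 L) * classical_part \<mu> L \<gamma>1 q + of_real (s2 L) * classical_part \<mu> L \<gamma>2 q) \<longlongrightarrow> U) at_top"
    and W: "((\<lambda>L. of_real (s1 L / L) * fourier (fst \<gamma>1) q + of_real (s2 L / L) * fourier (fst \<gamma>2) q) \<longlongrightarrow> W) at_top"
  shows "((\<lambda>L. of_real (L powr (- n)) * (of_real (s1 L) * amplitude n \<mu> L \<gamma>1 q + of_real (s2 L) * amplitude n \<mu> L \<gamma>2 q))
    \<longlongrightarrow> - \<i> * (of_real (hankel_limit n * norm q powr (- n)) * U
              + of_real (hankel_limit (n - 1) * norm q powr (2 - n)) * W)) at_top"
proof -
  define r where "r = norm q"
  have r: "r > 0" using q by (simp add: r_def)
  have "((\<lambda>L. r / L) \<longlongrightarrow> 0) at_top"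
    by (rule tendsto_divide_0[OF tendsto_const filterlim_at_top_imp_at_infinity[OF filterlim_ident]])
  moreover have "eventually (\<lambda>L. r / L > 0) at_top"
    using eventually_gt_at_top[of "0::real"] by eventually_elim (use r in simp)
  ultimately have s: "filterlim (\<lambda>L. r / L) (at_right 0) at_top"
    using r by (simp add: filterlim_at eventually_conj_iff eventually_mono)
  have lim: "((\<lambda>L. of_real ((r / L) powr \<nu>) * real_H \<nu> (r / L)) \<longlongrightarrow> - \<i> * of_real (hankel_limit \<nu>)) at_top" if "\<nu> > 0" for \<nu>
    by (rule filterlim_compose[OF real_H_limit[OF that] s])
  define u w where "u L = of_real (s1 L) * classical_part \<mu> L \<gamma>1 q + of_real (s2 L) * classical_part \<mu> L \<gamma>2 q"
    and "w L = of_real (s1 L / L) * fourier (fst \<gamma>1) q + of_real (s2 L / L) * fourier (fst \<gamma>2) q" for L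
  have "((\<lambda>L. of_real (r powr (- n)) * (of_real ((r / L) powr n) * real_H n (r / L)) * u L
      + of_real (r powr (2 - n)) * (of_real ((r / L) powr (n - 1)) * real_H (n - 1) (r / L)) * w L) \<longlongrightarrow>
      of_real (r powr (- n)) * (- \<i> * of_real (hankel_limit n)) * U
      + of_real (r powr (2 - n)) * (- \<i> * of_real (hankel_limit (n - 1))) * W) at_top"
    using U W n unfolding u_def w_def by (intro tendsto_intros lim) auto
  moreover have "eventually (\<lambda>L. of_real (r powr (- n)) * (of_real ((r / L) powr n) * real_H n (r / L)) * u L
      + of_real (r powr (2 - n)) * (of_real ((r / L) powr (n - 1)) * real_H (n - 1) (r / L)) * w L =
      of_real (L powr (- n)) * (of_real (s1 L) * amplitude n \<mu> L \<gamma>1 q + of_real (s2 L) * amplitude n \<mu> L \<gamma>2 q)) at_top"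
    using eventually_gt_at_top[of "0::real"]
  proof eventually_elim
    case (elim L)
    have 1: "r powr (- n) * (r / L) powr n = L powr (- n)"
      using r elim by (simp add: powr_divide powr_minus_divide)
    have 2: "r powr (2 - n) * (r / L) powr (n - 1) * (1 / L) = L powr (- n) * r"
    proof -
      have "r powr (2 - n) * r powr (n - 1) = r" using r by (simp flip: powr_add)
      moreover have "1 / (L powr (n - 1) * L) = L powr (- n)"
        using elim powr_add[of L "n - 1" 1] by (simp add: powr_minus_divide)
      moreover have "r powr (2 - n) * (r / L) powr (n - 1) * (1 / L) = (r powr (2 - n) * r powr (n - 1)) * (1 / (L powr (n - 1) * L))"
        using r elim by (simp add: powr_divide)
      ultimately show ?thesis by (simp only: mult.commute)
    qed
    define h1 h2 where "h1 = real_H n (r / L)" and "h2 = real_H (n - 1) (r / L)"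
    define G where "G = of_real (s1 L) * fourier (fst \<gamma>1) q + of_real (s2 L) * fourier (fst \<gamma>2) q"
    have w: "w L = of_real (1 / L) * G" by (simp add: w_def G_def field_simps add_divide_distrib)
    have "of_real (r powr (- n)) * (of_real ((r / L) powr n) * h1) * u L
      + of_real (r powr (2 - n)) * (of_real ((r / L) powr (n - 1)) * h2) * w L
      = of_real (r powr (- n) * (r / L) powr n) * h1 * u L + of_real (r powr (2 - n) * (r / L) powr (n - 1) * (1 / L)) * h2 * G"
      unfolding w by (simp only: of_real_mult mult_ac)
    also have "\<dots> = of_real (L powr (- n)) * (h1 * u L + of_real r * h2 * G)"
      unfolding 1 2 by (simp add: algebra_simps)
    also have "h1 * u L + of_real r * h2 * G = of_real (s1 L) * amplitude n \<mu> L \<gamma>1 q + of_real (s2 L) * amplitude n \<mu> L \<gamma>2 q"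
      unfolding amplitude_def r_def[symmetric] h1_def[symmetric] h2_def[symmetric] u_def G_def by (simp add: algebra_simps)
    finally show ?case unfolding h1_def h2_def .
  qed
  ultimately show ?thesis
    unfolding r_def[symmetric] by (rule Lim_transform_eventually[THEN tendsto_eq_rhs]) (simp add: algebra_simps)
qed

section \<open>Vanishing of the negativity at large scales\<close>

lemma test_function_sum4:
  assumes "test_function f1" "test_function f2" "test_function f3" "test_function f4"
  shows "test_function (\<lambda>x. a * f1 x + b * f2 x + (c * f3 x + d * f4 x))"
    and "fourier (\<lambda>x. a * f1 x + b * f2 x + (c * f3 x + d * f4 x)) q =
      of_real a * fourier f1 q + of_real b * fourier f2 q + (of_real c * fourier f3 q + of_real d * fourier f4 q)"
proof -
  have t: "test_function (\<lambda>x. a * f1 x + b * f2 x)" "test_function (\<lambda>x. c * f3 x + d * f4 x)"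
    using assms test_function_lincomb by blast+
  show "test_function (\<lambda>x. a * f1 x + b * f2 x + (c * f3 x + d * f4 x))"
    using test_function_lincomb[OF t, of 1 1] by simp
  show "fourier (\<lambda>x. a * f1 x + b * f2 x + (c * f3 x + d * f4 x)) q =
      of_real a * fourier f1 q + of_real b * fourier f2 q + (of_real c * fourier f3 q + of_real d * fourier f4 q)"
    using fourier_lincomb[OF t, of 1 1 q] fourier_lincomb[OF assms(1,2)] fourier_lincomb[OF assms(3,4)] by simp
qed

lemma adapted_basisD:
  assumes "adapted_basis \<mu> \<kappa> \<gamma>1 \<gamma>2 S s11 s12 s21 s22 C U1 U2 W1 W2"
  shows "C > 0"
    and "L \<ge> 1 \<Longrightarrow> s11 L * s22 L - s12 L * s21 L \<noteq> 0"
    and "L \<ge> 1 \<Longrightarrow> \<bar>s11 L * s22 L - s12 L * s21 L\<bar> \<le> C * L"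
    and "test_function U1" "test_function U2" "test_function W1" "test_function W2"
    and "supp U1 \<subseteq> S" "supp U2 \<subseteq> S" "supp W1 \<subseteq> S" "supp W2 \<subseteq> S"
    and "((\<lambda>L. of_real (s11 L) * classical_part \<mu> L \<gamma>1 q + of_real (s21 L) * classical_part \<mu> L \<gamma>2 q) \<longlongrightarrow> fourier U1 q) at_top"
    and "((\<lambda>L. of_real (s12 L) * classical_part \<mu> L \<gamma>1 q + of_real (s22 L) * classical_part \<mu> L \<gamma>2 q) \<longlongrightarrow> fourier U2 q) at_top"
    and "((\<lambda>L. of_real (s11 L / L) * fourier (fst \<gamma>1) q + of_real (s21 L / L) * fourier (fst \<gamma>2) q) \<longlongrightarrow> fourier W1 q) at_top"
    and "((\<lambda>L. of_real (s12 L / L) * fourier (fst \<gamma>1) q + of_real (s22 L / L) * fourier (fst \<gamma>2) q) \<longlongrightarrow> fourier W2 q) at_top"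
    and "(\<And>x. a * U1 x + b * U2 x = \<kappa> * (a * laplacian W1 x + b * laplacian W2 x)) \<Longrightarrow> a = 0 \<and> b = 0"
  using assms unfolding adapted_basis_def by blast+

definition limit_amplitude :: "real \<Rightarrow> complex \<Rightarrow> complex \<Rightarrow> real^3 \<Rightarrow> complex" where
  "limit_amplitude n U W q = - \<i> * (of_real (hankel_limit n * norm q powr (- n)) * U
              + of_real (hankel_limit (n - 1) * norm q powr (2 - n)) * W)"

text \<open>Dividing by the common factor \<open>norm q powr (- n)\<close> leaves polynomial
  coefficients. The bracket on the right is the transform of a Laplacian when \<open>W\<close> is a
  transform.\<close>

lemma limit_amplitude_eq_zero:
  assumes n: "hankel_limit n \<noteq> 0" and q: "q \<noteq> 0" and z: "limit_amplitude n U W q = 0"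
    and \<kappa>: "\<kappa> = hankel_limit (n - 1) / hankel_limit n"
  shows "U = of_real \<kappa> * (- of_real ((norm q)^2) * W)"
proof -
  have p: "norm q powr (2 - n) = norm q powr (- n) * (norm q)^2"
    using q powr_add[of "norm q" "- n" 2] by simp
  define c where "c = hankel_limit n * norm q powr (- n)"
  have c: "c \<noteq> 0" using n q by (simp add: c_def)
  have e: "hankel_limit (n - 1) * norm q powr (2 - n) = c * (\<kappa> * (norm q)^2)"
    using n by (simp add: c_def \<kappa> p)
  have "of_real c * U + of_real (c * (\<kappa> * (norm q)^2)) * W = 0"
    using z unfolding limit_amplitude_def c_def[symmetric] e
    by (simp only: mult_eq_0_iff neg_equal_0_iff_equal complex_i_not_zero simp_thms)
  then have "of_real c * (U + of_real \<kappa> * (of_real ((norm q)^2) * W)) = 0"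
    by (simp add: algebra_simps)
  then have "U + of_real \<kappa> * (of_real ((norm q)^2) * W) = 0" using c by simp
  then show ?thesis by (simp add: eq_neg_iff_add_eq_0)
qed

text \<open>A vanishing combination is a relation \<open>u = \<kappa> \<Delta> w\<close> between compactly supported functions;
  being local, it holds for each of the two disjoint modes separately.\<close>

lemma adapted_bases_independent:
  assumes A: "adapted_basis \<mu> \<kappa> \<alpha>1 \<alpha>2 SA s11 s12 s21 s22 C U1 U2 W1 W2"
    and B: "adapted_basis \<mu> \<kappa> \<beta>1 \<beta>2 SB t11 t12 t21 t22 C' U3 U4 W3 W4"
    and disj: "SA \<inter> SB = {}"
    and n: "hankel_limit n \<noteq> 0" and \<kappa>: "\<kappa> = hankel_limit (n - 1) / hankel_limit n"
    and zero: "AE q in lborel. of_real a * limit_amplitude n (fourier U1 q) (fourier W1 q) q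
      + of_real b * limit_amplitude n (fourier U2 q) (fourier W2 q) q
      + of_real c * limit_amplitude n (fourier U3 q) (fourier W3 q) q
      + of_real d * limit_amplitude n (fourier U4 q) (fourier W4 q) q = 0"
  shows "a = 0 \<and> b = 0 \<and> c = 0 \<and> d = 0"
proof -
  note dA = adapted_basisD[OF A] and dB = adapted_basisD[OF B]
  define u where "u x = a * U1 x + b * U2 x + (c * U3 x + d * U4 x)" for x
  define l where "l x = a * laplacian W1 x + b * laplacian W2 x + (c * laplacian W3 x + d * laplacian W4 x)" for x
  have u: "test_function u" "\<And>q. fourier u q = of_real a * fourier U1 q + of_real b * fourier U2 q + (of_real c * fourier U3 q + of_real d * fourier U4 q)"
    unfolding u_def[abs_def] using test_function_sum4[OF dA(4,5) dB(4,5)] by blast+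
  note tl = dA(6,7)[THEN test_function_laplacian] dB(6,7)[THEN test_function_laplacian]
  have l: "test_function l" "\<And>q. fourier l q = - of_real ((norm q)^2) *
      (of_real a * fourier W1 q + of_real b * fourier W2 q + (of_real c * fourier W3 q + of_real d * fourier W4 q))"
    unfolding l_def[abs_def] using test_function_sum4[OF tl]
    by (simp_all add: fourier_laplacian dA(6,7) dB(6,7) algebra_simps)
  have "AE q in lborel. q \<noteq> (0::real^3)" by (rule AE_lborel_singleton)
  then have ae: "AE q in lborel. q \<in> UNIV \<longrightarrow> fourier u q - of_real \<kappa> * fourier l q = 0"
    using zero
  proof eventually_elim
    case (elim q)
    have "limit_amplitude n (fourier u q)
       (of_real a * fourier W1 q + of_real b * fourier W2 q + (of_real c * fourier W3 q + of_real d * fourier W4 q)) q = 0"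
      using elim(2) unfolding u(2) limit_amplitude_def by (simp add: algebra_simps)
    from limit_amplitude_eq_zero[OF n elim(1) this \<kappa>] show ?case by (simp add: l(2))
  qed
  have cont: "continuous_on UNIV (\<lambda>q. fourier u q - of_real \<kappa> * fourier l q)"
    by (intro continuous_intros continuous_on_fourier u l)
  \<comment> \<open>Both sides are continuous transforms of test functions, so the relation extends
    from almost every \<open>q\<close> to all \<open>q\<close>, and injectivity carries it back to
    position space.\<close>
  have "fourier u q = fourier (\<lambda>x. \<kappa> * l x) q" for q
    using continuous_AE_zero_imp_zero[OF open_UNIV cont ae, of q] by (simp add: fourier_scale_const l(1))
  then have eq: "u x = \<kappa> * l x" for x
    by (rule fourier_inj[OF u(1) test_function_scale[OF l(1)]])
  have zA: "U1 x = 0 \<and> U2 x = 0 \<and> laplacian W1 x = 0 \<and> laplacian W2 x = 0" if "x \<notin> SA" for x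
    using that dA(8-11) supp_laplacian not_in_supp by blast
  have zB: "U3 x = 0 \<and> U4 x = 0 \<and> laplacian W3 x = 0 \<and> laplacian W4 x = 0" if "x \<notin> SB" for x
    using that dB(8-11) supp_laplacian not_in_supp by blast
  have "a * U1 x + b * U2 x = \<kappa> * (a * laplacian W1 x + b * laplacian W2 x)" for x
    using eq[of x] zA[of x] zB[of x] disj by (cases "x \<in> SA"; cases "x \<in> SB") (auto simp: u_def l_def)
  then have 1: "a = 0 \<and> b = 0" by (rule dA(16))
  have "c * U3 x + d * U4 x = \<kappa> * (c * laplacian W3 x + d * laplacian W4 x)" for x
    using eq[of x] zA[of x] zB[of x] disj by (cases "x \<in> SA"; cases "x \<in> SB") (auto simp: u_def l_def)
  then have 2: "c = 0 \<and> d = 0" by (rule dB(16))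
  show ?thesis using 1 2 by blast
qed

section \<open>The covariance form of two modes and its lower bound\<close>

definition mode_observable :: "mode \<Rightarrow> mode \<Rightarrow> 4 \<Rightarrow> observable" where
  "mode_observable A B i = (if i = 1 then fst A else if i = 2 then snd A else if i = 3 then fst B else snd B)"

lemma mode_observable_simps [simp]:
  "mode_observable A B 1 = fst A" "mode_observable A B 2 = snd A"
  "mode_observable A B 3 = fst B" "mode_observable A B 4 = snd B"
  by (simp_all add: mode_observable_def)

definition mode_form :: "real \<Rightarrow> real \<Rightarrow> real \<Rightarrow> mode \<Rightarrow> mode \<Rightarrow> real^4 \<Rightarrow> real" where
  "mode_form n \<mu> L A B x =
     (LINT q|lborel. (cmod (\<Sum>i\<in>UNIV. of_real (x $ i) * amplitude n \<mu> L (mode_observable A B i) q))^2)"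

lemma test_observable_mode:
  assumes "single_mode A" "single_mode B"
  shows "test_observable (mode_observable A B i)"
  using assms by (auto simp: mode_observable_def single_mode_def test_observable_def)

text \<open>Lagrange's identity in the coordinate plane concerned; the other coordinates only
  increase the norms.\<close>

lemma wedge_le_norm:
  fixes x y :: "real^4"
  shows "(x$1 * y$2 - x$2 * y$1)^2 \<le> (norm x)^2 * (norm y)^2"
    and "(x$3 * y$4 - x$4 * y$3)^2 \<le> (norm x)^2 * (norm y)^2"
proof -
  have e: "(p * v - r * u)^2 \<le> (p^2 + r^2) * (u^2 + v^2)" for p r u v :: real
  proof -
    have "(p^2 + r^2) * (u^2 + v^2) = (p * v - r * u)^2 + (p * u + r * v)^2"
      by (simp add: power2_eq_square algebra_simps)
    then show ?thesis by simp
  qed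
  have n: "(norm z)^2 = (z$1)^2 + (z$2)^2 + ((z$3)^2 + (z$4)^2)" for z :: "real^4"
    unfolding power2_norm_eq_inner by (simp add: inner_vec_def sum_4 power2_eq_square)
  show "(x$1 * y$2 - x$2 * y$1)^2 \<le> (norm x)^2 * (norm y)^2"
    unfolding n by (rule order_trans[OF e]) (intro mult_mono; simp)
  show "(x$3 * y$4 - x$4 * y$3)^2 \<le> (norm x)^2 * (norm y)^2"
    unfolding n by (rule order_trans[OF e]) (intro mult_mono; simp)
qed

text \<open>In adapted coordinates the form is at least \<open>c * L powr (2 * n)\<close> times the
  squared norm, while a wedge is multiplied by a determinant of size at most a constant times
  \<open>L\<close>. Two form values and the squared determinant account for the exponent
  \<open>2 - 4 * n\<close>.\<close>

lemma mode_form_coercive: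
  assumes A: "single_mode A" and B: "single_mode B" and disj: "mode_support A \<inter> mode_support B = {}"
    and \<mu>: "\<mu> > 0" and n: "1 < n" "n < 3/2"
  shows "\<exists>K>0. \<exists>\<Lambda>>0. \<forall>L\<ge>\<Lambda>. \<forall>x y.
     (x$1 * y$2 - x$2 * y$1)^2 \<le> K * L powr (2 - 4 * n) * mode_form n \<mu> L A B x * mode_form n \<mu> L A B y \<and>
     (x$3 * y$4 - x$4 * y$3)^2 \<le> K * L powr (2 - 4 * n) * mode_form n \<mu> L A B x * mode_form n \<mu> L A B y"
proof -
  have nZ: "n \<notin> \<int>" "n - 1 \<notin> \<int>"
  proof -
    show "n - 1 \<notin> \<int>" using n by (auto elim!: Ints_cases)
    then show "n \<notin> \<int>" by (metis Ints_1 Ints_diff)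
  qed
  define \<kappa> where "\<kappa> = hankel_limit (n - 1) / hankel_limit n"
  have h: "hankel_limit n \<noteq> 0" "hankel_limit (n - 1) \<noteq> 0" using hankel_limit_nonzero nZ n by simp_all
  then have \<kappa>: "\<kappa> \<noteq> 0" by (simp add: \<kappa>_def)
  obtain s11 s12 s21 s22 C U1 U2 W1 W2 where
    adA: "adapted_basis \<mu> \<kappa> (fst A) (snd A) (mode_support A) s11 s12 s21 s22 C U1 U2 W1 W2"
    using adapted_basis_exists[OF A \<mu> \<kappa>] by blast
  obtain t11 t12 t21 t22 C' U3 U4 W3 W4 where
    adB: "adapted_basis \<mu> \<kappa> (fst B) (snd B) (mode_support B) t11 t12 t21 t22 C' U3 U4 W3 W4"
    using adapted_basis_exists[OF B \<mu> \<kappa>] by blast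
  note dA = adapted_basisD[OF adA] and dB = adapted_basisD[OF adB]
  define a where "a L i = amplitude n \<mu> L (mode_observable A B i)" for L i
  \<comment> \<open>The amplitude along the adapted basis vector \<open>i\<close>, divided by
    \<open>L powr n\<close> so that it converges.\<close>
  define v :: "real \<Rightarrow> 4 \<Rightarrow> real^3 \<Rightarrow> complex" where "v L i q =
    (if i = 1 then of_real (L powr (- n)) * (of_real (s11 L) * a L 1 q + of_real (s21 L) * a L 2 q)
     else if i = 2 then of_real (L powr (- n)) * (of_real (s12 L) * a L 1 q + of_real (s22 L) * a L 2 q)
     else if i = 3 then of_real (L powr (- n)) * (of_real (t11 L) * a L 3 q + of_real (t21 L) * a L 4 q)
     else of_real (L powr (- n)) * (of_real (t12 L) * a L 3 q + of_real (t22 L) * a L 4 q))" for L i q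
  define V :: "4 \<Rightarrow> real^3 \<Rightarrow> complex" where "V i q =
    (if i = 1 then limit_amplitude n (fourier U1 q) (fourier W1 q) q
     else if i = 2 then limit_amplitude n (fourier U2 q) (fourier W2 q) q
     else if i = 3 then limit_amplitude n (fourier U3 q) (fourier W3 q) q
     else limit_amplitude n (fourier U4 q) (fourier W4 q) q)" for i q
  have am: "a L i \<in> borel_measurable lborel" if "L > 0" for L i
    unfolding a_def using borel_measurable_amplitude[OF test_observable_mode[OF A B] that] by simp
  obtain c \<Lambda> where c: "c > 0" and \<Lambda>: "\<Lambda> > 0"
    and coer: "\<And>L \<theta>. L \<ge> \<Lambda> \<Longrightarrow> ennreal (c * (norm (\<theta>::real^4))^2) \<le> (\<integral>\<^sup>+q. ennreal ((cmod (\<Sum>i\<in>UNIV. of_real (\<theta> $ i) * v L i q))^2) \<partial>lborel)"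
  proof -
    have "\<exists>c>0. \<exists>\<Lambda>>0. \<forall>L\<ge>\<Lambda>. \<forall>\<theta>::real^4. ennreal (c * (norm \<theta>)^2) \<le> (\<integral>\<^sup>+q. ennreal ((cmod (\<Sum>i\<in>UNIV. of_real (\<theta> $ i) * v L i q))^2) \<partial>lborel)"
    proof (rule eventually_coercive[where V = V])
      fix L :: real and i :: 4 assume "L > 0"
      note [measurable] = am[OF this]
      show "v L i \<in> borel_measurable lborel" unfolding v_def by measurable
    next
      fix i :: 4
      have "AE q in lborel. q \<noteq> (0::real^3)" by (rule AE_lborel_singleton)
      then show "AE q in lborel. ((\<lambda>L. v L i q) \<longlongrightarrow> V i q) at_top"
      proof eventually_elim
        case (elim q)
        note lim = amplitude_family_limit[OF n(1) elim, folded limit_amplitude_def]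
        show ?case
          unfolding v_def V_def a_def mode_observable_simps
          using lim[OF dA(12,14)] lim[OF dA(13,15)] lim[OF dB(12,14)] lim[OF dB(13,15)] by simp
      qed
    next
      fix \<theta> :: "real^4" assume "AE q in lborel. (\<Sum>i\<in>UNIV. of_real (\<theta> $ i) * V i q) = 0"
      then have "AE q in lborel. of_real (\<theta>$1) * limit_amplitude n (fourier U1 q) (fourier W1 q) q
        + of_real (\<theta>$2) * limit_amplitude n (fourier U2 q) (fourier W2 q) q
        + of_real (\<theta>$3) * limit_amplitude n (fourier U3 q) (fourier W3 q) q
        + of_real (\<theta>$4) * limit_amplitude n (fourier U4 q) (fourier W4 q) q = 0"
        by (simp add: sum_4 V_def)
      from adapted_bases_independent[OF adA adB disj h(1) \<kappa>_def this]
      show "\<theta> = 0" by (simp add: vec_eq_iff forall_4)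
    qed
    then show thesis using that by blast
  qed
  \<comment> \<open>One constant for both modes: the square of either determinant constant is at
    most the sum, and \<open>c\<close> occurs squared because coercivity is applied to both
    vectors.\<close>
  define K where "K = (C^2 + C'^2) / c^2"
  have K: "K > 0" using dA(1) dB(1) c by (simp add: K_def add_pos_pos)
  have main: "\<exists>\<theta>::real^4. x$1 = s11 L * \<theta>$1 + s12 L * \<theta>$2 \<and> x$2 = s21 L * \<theta>$1 + s22 L * \<theta>$2 \<and>
      x$3 = t11 L * \<theta>$3 + t12 L * \<theta>$4 \<and> x$4 = t21 L * \<theta>$3 + t22 L * \<theta>$4 \<and>
      c * (norm \<theta>)^2 \<le> L powr (- 2 * n) * mode_form n \<mu> L A B x"
    if L: "L \<ge> 1" "L \<ge> \<Lambda>" for L and x :: "real^4"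
  proof -
    define p r where "p = s11 L * s22 L - s12 L * s21 L" and "r = t11 L * t22 L - t12 L * t21 L"
    have pr: "p \<noteq> 0" "r \<noteq> 0" using dA(2)[OF L(1)] dB(2)[OF L(1)] by (simp_all add: p_def r_def)
    \<comment> \<open>The coordinates of \<open>x\<close> in the adapted basis by Cramer's rule,
      mode by mode.\<close>
    define \<theta> :: "real^4" where "\<theta> = (\<chi> i. if i = 1 then (s22 L * x$1 - s12 L * x$2) / p
      else if i = 2 then (s11 L * x$2 - s21 L * x$1) / p
      else if i = 3 then (t22 L * x$3 - t12 L * x$4) / r else (t11 L * x$4 - t21 L * x$3) / r)"
    have \<theta>: "\<theta>$1 = (s22 L * x$1 - s12 L * x$2) / p" "\<theta>$2 = (s11 L * x$2 - s21 L * x$1) / p"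
      "\<theta>$3 = (t22 L * x$3 - t12 L * x$4) / r" "\<theta>$4 = (t11 L * x$4 - t21 L * x$3) / r"
      by (simp_all add: \<theta>_def)
    have cramer: "s * ((s' * z - t * w) / e) + t * ((s * w - t' * z) / e) = z \<and> t' * ((s' * z - t * w) / e) + s' * ((s * w - t' * z) / e) = w"
      if "e = s * s' - t * t'" "e \<noteq> 0" for s s' t t' z w e :: real
    proof -
      have "s * (s' * z - t * w) + t * (s * w - t' * z) = e * z" "t' * (s' * z - t * w) + s' * (s * w - t' * z) = e * w"
        by (simp_all add: that(1) algebra_simps)
      then show ?thesis using that(2) by (simp add: add_divide_distrib[symmetric])
    qed
    have x: "s11 L * \<theta>$1 + s12 L * \<theta>$2 = x$1" "s21 L * \<theta>$1 + s22 L * \<theta>$2 = x$2"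
      "t11 L * \<theta>$3 + t12 L * \<theta>$4 = x$3" "t21 L * \<theta>$3 + t22 L * \<theta>$4 = x$4"
      unfolding \<theta> using cramer[OF p_def pr(1)] cramer[OF r_def pr(2)] by blast+
    have Lpos: "L > 0" using L by simp
    have sum: "(\<Sum>i\<in>UNIV. of_real (\<theta> $ i) * v L i q) = of_real (L powr (- n)) * (\<Sum>i\<in>UNIV. of_real (x $ i) * a L i q)" for q
      unfolding sum_4 v_def x[symmetric] by (simp add: algebra_simps)
    have "integrable lborel (\<lambda>q. a L i q * cnj (a L j q))" for i j
      unfolding a_def using test_observable_mode[OF A B] Lpos n
      by (intro integrable_mult_cnj amplitude_square_integrable) (simp_all add: borel_measurable_amplitude)
    from gram_form(2)[OF this]
    have int: "integrable lborel (\<lambda>q. (L powr (- n))^2 * (cmod (\<Sum>i\<in>UNIV. of_real (x $ i) * a L i q))^2)"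
      by (rule integrable_mult_right)
    have "ennreal (c * (norm \<theta>)^2) \<le> (\<integral>\<^sup>+q. ennreal ((L powr (- n))^2 * (cmod (\<Sum>i\<in>UNIV. of_real (x $ i) * a L i q))^2) \<partial>lborel)"
      using coer[OF L(2), of \<theta>] unfolding sum norm_mult power_mult_distrib by simp
    also have "\<dots> = ennreal (LINT q|lborel. (L powr (- n))^2 * (cmod (\<Sum>i\<in>UNIV. of_real (x $ i) * a L i q))^2)"
      by (rule nn_integral_eq_integral[OF int]) simp
    also have "(LINT q|lborel. (L powr (- n))^2 * (cmod (\<Sum>i\<in>UNIV. of_real (x $ i) * a L i q))^2) = L powr (- 2 * n) * mode_form n \<mu> L A B x"
    proof -
      have "(L powr (- n))^2 = L powr (- 2 * n)" by (simp add: power2_eq_square flip: powr_add)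
      then show ?thesis unfolding mode_form_def a_def by (simp only: integral_mult_right_zero)
    qed
    finally have "c * (norm \<theta>)^2 \<le> L powr (- 2 * n) * mode_form n \<mu> L A B x"
      by (subst (asm) ennreal_le_iff) (auto simp: mode_form_def)
    then show ?thesis using x by (intro exI[of _ \<theta>]) simp
  qed
  have "(x$1 * y$2 - x$2 * y$1)^2 \<le> K * L powr (2 - 4 * n) * mode_form n \<mu> L A B x * mode_form n \<mu> L A B y \<and>
     (x$3 * y$4 - x$4 * y$3)^2 \<le> K * L powr (2 - 4 * n) * mode_form n \<mu> L A B x * mode_form n \<mu> L A B y"
    if L: "L \<ge> max 1 \<Lambda>" for L x y
  proof -
    have L1: "L \<ge> 1" "L \<ge> \<Lambda>" using L by auto
    obtain \<theta> where \<theta>: "x$1 = s11 L * \<theta>$1 + s12 L * \<theta>$2" "x$2 = s21 L * \<theta>$1 + s22 L * \<theta>$2"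
      "x$3 = t11 L * \<theta>$3 + t12 L * \<theta>$4" "x$4 = t21 L * \<theta>$3 + t22 L * \<theta>$4"
      "c * (norm (\<theta>::real^4))^2 \<le> L powr (- 2 * n) * mode_form n \<mu> L A B x" using main[OF L1, of x] by blast
    obtain \<tau> where \<tau>: "y$1 = s11 L * \<tau>$1 + s12 L * \<tau>$2" "y$2 = s21 L * \<tau>$1 + s22 L * \<tau>$2"
      "y$3 = t11 L * \<tau>$3 + t12 L * \<tau>$4" "y$4 = t21 L * \<tau>$3 + t22 L * \<tau>$4"
      "c * (norm (\<tau>::real^4))^2 \<le> L powr (- 2 * n) * mode_form n \<mu> L A B y" using main[OF L1, of y] by blast
    define X Y where "X = mode_form n \<mu> L A B x" and "Y = mode_form n \<mu> L A B y"
    have XY: "0 \<le> X" "0 \<le> Y" by (simp_all add: X_def Y_def mode_form_def)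
    have "(c * (norm \<theta>)^2) * (c * (norm \<tau>)^2) \<le> (L powr (- 2 * n) * X) * (L powr (- 2 * n) * Y)"
      unfolding X_def Y_def by (rule mult_mono[OF \<theta>(5) \<tau>(5)])
        (use c XY in \<open>auto simp: X_def intro!: mult_nonneg_nonneg\<close>)
    also have "\<dots> = L powr (- 4 * n) * X * Y" by (simp add: mult_ac flip: powr_add)
    finally have "c^2 * ((norm \<theta>)^2 * (norm \<tau>)^2) \<le> L powr (- 4 * n) * X * Y"
      by (simp add: power2_eq_square mult_ac)
    then have nt: "(norm \<theta>)^2 * (norm \<tau>)^2 \<le> L powr (- 4 * n) * X * Y / c^2"
      using c by (simp add: pos_le_divide_eq mult.commute)
    have fin: "(p * z)^2 \<le> K * L powr (2 - 4 * n) * X * Y"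
      if p: "\<bar>p\<bar> \<le> D * L" "D^2 \<le> C^2 + C'^2" and z: "z^2 \<le> (norm \<theta>)^2 * (norm \<tau>)^2" and D: "D > 0" for p z D
    proof -
      have "p^2 \<le> (D * L)^2" using p(1) by (rule abs_le_square_iff[THEN iffD1, OF order_trans]) simp
      also have "\<dots> \<le> (C^2 + C'^2) * L^2" unfolding power_mult_distrib using p(2) by (rule mult_right_mono) simp
      finally have "(p * z)^2 \<le> ((C^2 + C'^2) * L^2) * (L powr (- 4 * n) * X * Y / c^2)"
        unfolding power_mult_distrib using order_trans[OF z nt] by (intro mult_mono) auto
      also have "\<dots> = K * (L^2 * L powr (- 4 * n)) * X * Y" by (simp add: K_def)
      also have "L^2 * L powr (- 4 * n) = L powr (2 - 4 * n)"
        using L1 powr_add[of L 2 "- 4 * n"] by simp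
      finally show ?thesis .
    qed
    have "x$1 * y$2 - x$2 * y$1 = (s11 L * s22 L - s12 L * s21 L) * (\<theta>$1 * \<tau>$2 - \<theta>$2 * \<tau>$1)"
      unfolding \<theta> \<tau> by (simp add: algebra_simps)
    then have 1: "(x$1 * y$2 - x$2 * y$1)^2 \<le> K * L powr (2 - 4 * n) * X * Y"
      using fin[OF dA(3)[OF L1(1)] _ wedge_le_norm(1) dA(1)] by simp
    have "x$3 * y$4 - x$4 * y$3 = (t11 L * t22 L - t12 L * t21 L) * (\<theta>$3 * \<tau>$4 - \<theta>$4 * \<tau>$3)"
      unfolding \<theta> \<tau> by (simp add: algebra_simps)
    then have 2: "(x$3 * y$4 - x$4 * y$3)^2 \<le> K * L powr (2 - 4 * n) * X * Y"
      using fin[OF dB(3)[OF L1(1)] _ wedge_le_norm(2) dB(1)] by simp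
    show ?thesis using 1 2 unfolding X_def Y_def by blast
  qed
  then show ?thesis using K by (intro exI[of _ K] conjI exI[of _ "max 1 \<Lambda>"]) auto
qed

text \<open>\<open>n\<close> and \<open>\<mu>\<close> are functions of \<open>\<rho>\<close>, and
  the rescaled covariance depends on \<open>H\<close> and \<open>R\<close> only through their
  product, so one threshold serves all \<open>m\<close> and \<open>H\<close> of ratio
  \<open>\<rho>\<close>.\<close>

lemma log_negativity_BD_eq_0:
  assumes A: "single_mode A" and B: "single_mode B" and disj: "mode_support A \<inter> mode_support B = {}"
    and \<rho>: "0 < \<rho>" "\<rho> < 1"
  shows "\<exists>\<Lambda>>0. \<forall>m>0. \<forall>H>0. m / H = \<rho> \<longrightarrow>
    (\<forall>R>0. R * H \<ge> \<Lambda> \<longrightarrow> LN_BD m H (scale_mode R A) (scale_mode R B) = 0)"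
proof -
  define n where "n = sqrt (9/4 - \<rho>^2)"
  define \<mu> where "\<mu> = 3/2 - n"
  have \<rho>2: "0 < \<rho>^2" "\<rho>^2 < 1" using \<rho> by (auto simp: power_less_one_iff)
  have "sqrt (1^2) < n" unfolding n_def using \<rho>2 by (intro real_sqrt_less_mono) simp
  then have n1: "1 < n" by simp
  have "n < sqrt ((3/2)^2)" unfolding n_def using \<rho>2 by (intro real_sqrt_less_mono) (simp add: power2_eq_square)
  then have n2: "n < 3/2" by simp
  have \<mu>: "\<mu> > 0" using n2 by (simp add: \<mu>_def)
  have nZ: "n \<notin> \<int>" "n - 1 \<notin> \<int>"
  proof -
    show "n - 1 \<notin> \<int>" using n1 n2 by (auto elim!: Ints_cases)
    then show "n \<notin> \<int>" by (metis Ints_1 Ints_diff)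
  qed
  obtain K \<Lambda> where K: "K > 0" and \<Lambda>: "\<Lambda> > 0" and form: "\<And>L x y. L \<ge> \<Lambda> \<Longrightarrow>
     (x$1 * y$2 - x$2 * y$1)^2 \<le> K * L powr (2 - 4 * n) * mode_form n \<mu> L A B x * mode_form n \<mu> L A B y \<and>
     (x$3 * y$4 - x$4 * y$3)^2 \<le> K * L powr (2 - 4 * n) * mode_form n \<mu> L A B x * mode_form n \<mu> L A B y"
    using mode_form_coercive[OF A B disj \<mu> n1 n2] by blast
  define k where "k = pi / 2 / (2 * pi)^3"
  have k: "k > 0" by (simp add: k_def)
  \<comment> \<open>Each covariance value carries \<open>k / L\<close>, so the product of two raises
    the exponent \<open>2 - 4 * n\<close> by 2. The result is negative because \<open>n > 1\<close>;
    the 4 is the one demanded by \<open>nu_minus_ge_1\<close>.\<close>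
  have "((\<lambda>L. 4 * K * L powr (4 - 4 * n)) \<longlongrightarrow> 4 * K * 0) at_top"
    using n1 by (intro tendsto_intros tendsto_neg_powr filterlim_ident) simp
  then have "eventually (\<lambda>L. 4 * K * L powr (4 - 4 * n) < k^2) at_top"
    using k by (intro order_tendstoD(2)) auto
  then obtain \<Lambda>' where \<Lambda>': "\<And>L. L \<ge> \<Lambda>' \<Longrightarrow> 4 * K * L powr (4 - 4 * n) < k^2"
    by (auto simp: eventually_at_top_linorder)
  have "LN_BD m H (scale_mode R A) (scale_mode R B) = 0"
    if m: "m > 0" "H > 0" "m / H = \<rho>" and R: "R > 0" "R * H \<ge> max \<Lambda> \<Lambda>'" for m H R
  proof -
    define L where "L = R * H"
    have L: "L > 0" "L \<ge> \<Lambda>" "L \<ge> \<Lambda>'" using R m by (auto simp: L_def)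
    have mu: "BD_mu2 m H = \<mu>" using m(3) by (simp add: BD_mu2_def \<mu>_def n_def flip: power_divide)
    have idx: "BD_index m H = n" by (simp add: BD_index_def mu) (simp add: \<mu>_def)
    define S where "S = two_point (BD_field m H) (BD_momentum m H)"
    define \<sigma> where "\<sigma> = covariance_matrix S (scale_mode R A) (scale_mode R B)"
    define a where "a i = amplitude n \<mu> L (mode_observable A B i)" for i
    have \<sigma>: "\<sigma>$i$j = k / L * Re (LINT q|lborel. a i q * cnj (a j q))" for i j
    proof -
      have "\<sigma>$i$j = S (scale_observable R (mode_observable A B i)) (scale_observable R (mode_observable A B j))"
        unfolding \<sigma>_def covariance_matrix_def Let_def mode_observable_def scale_mode_def
        by (simp only: vec_lambda_beta fst_conv snd_conv if_distrib[of "scale_observable R"])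
      also have "\<dots> = k / L * Re (LINT q|lborel. a i q * cnj (a j q))"
        unfolding S_def a_def L_def k_def
        by (subst two_point_BD_scaled[OF test_observable_mode[OF A B] test_observable_mode[OF A B] m(2) R(1) idx nZ mu]) simp
      finally show ?thesis .
    qed
    have int: "integrable lborel (\<lambda>q. a i q * cnj (a j q))" for i j
      unfolding a_def using test_observable_mode[OF A B] L n1 n2
      by (intro integrable_mult_cnj amplitude_square_integrable) (simp_all add: borel_measurable_amplitude)
    have q: "(\<Sum>i\<in>UNIV. \<Sum>j\<in>UNIV. x$i * x$j * \<sigma>$i$j) = k / L * mode_form n \<mu> L A B x" for x :: "real^4"
    proof -
      have "(\<Sum>i\<in>UNIV. \<Sum>j\<in>UNIV. x$i * x$j * \<sigma>$i$j)
          = k / L * (\<Sum>i\<in>UNIV. \<Sum>j\<in>UNIV. x$i * x$j * Re (LINT q|lborel. a i q * cnj (a j q)))"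
        unfolding \<sigma> sum_distrib_left by (simp only: mult.left_commute)
      then show ?thesis unfolding gram_form(1)[OF int] by (simp add: mode_form_def a_def)
    qed
    have nonneg: "0 \<le> mode_form n \<mu> L A B x" for x by (simp add: mode_form_def)
    have small: "4 * z \<le> (k / L * mode_form n \<mu> L A B x) * (k / L * mode_form n \<mu> L A B y)"
      if z: "z \<le> K * L powr (2 - 4 * n) * mode_form n \<mu> L A B x * mode_form n \<mu> L A B y" for z x y
    proof -
      define M where "M = mode_form n \<mu> L A B x * mode_form n \<mu> L A B y"
      have M: "M \<ge> 0" using nonneg by (simp add: M_def)
      have p: "L powr (2 - 4 * n) = L powr (4 - 4 * n) / L^2"
        using L(1) powr_add[of L "2 - 4 * n" 2] by simp
      have "4 * z \<le> (4 * K * L powr (4 - 4 * n)) * (M / L^2)"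
        using z unfolding p M_def by (simp add: mult.assoc)
      also have "\<dots> \<le> k^2 * (M / L^2)"
        using \<Lambda>'[OF L(3)] M by (intro mult_right_mono) auto
      also have "\<dots> = (k / L * mode_form n \<mu> L A B x) * (k / L * mode_form n \<mu> L A B y)"
        by (simp add: M_def power2_eq_square)
      finally show ?thesis .
    qed
    have "nu_minus \<sigma> \<ge> 1"
    proof (rule nu_minus_ge_1)
      fix i j
      have "(LINT q|lborel. a j q * cnj (a i q)) = cnj (LINT q|lborel. a i q * cnj (a j q))"
        using Bochner_Integration.integral_cnj[of lborel "\<lambda>q. a i q * cnj (a j q)"] by (simp add: mult.commute)
      then show "\<sigma>$i$j = \<sigma>$j$i" unfolding \<sigma> by simp
    next
      fix x :: "real^4"
      show "0 \<le> (\<Sum>i\<in>UNIV. \<Sum>j\<in>UNIV. x$i * x$j * \<sigma>$i$j)"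
        unfolding q using nonneg k L(1) by simp
    next
      fix x y :: "real^4"
      show "4 * (x$1 * y$2 - x$2 * y$1)^2 \<le> (\<Sum>i\<in>UNIV. \<Sum>j\<in>UNIV. x$i * x$j * \<sigma>$i$j) * (\<Sum>i\<in>UNIV. \<Sum>j\<in>UNIV. y$i * y$j * \<sigma>$i$j)"
        unfolding q by (rule small) (use form[OF L(2)] in blast)
      show "4 * (x$3 * y$4 - x$4 * y$3)^2 \<le> (\<Sum>i\<in>UNIV. \<Sum>j\<in>UNIV. x$i * x$j * \<sigma>$i$j) * (\<Sum>i\<in>UNIV. \<Sum>j\<in>UNIV. y$i * y$j * \<sigma>$i$j)"
        unfolding q by (rule small) (use form[OF L(2)] in blast)
    qed
    then show ?thesis unfolding LN_BD_def S_def[symmetric] \<sigma>_def by (rule log_negativity_eq_0)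
  qed
  then show ?thesis using \<Lambda> by (intro exI[of _ "max \<Lambda> \<Lambda>'"]) (simp add: less_max_iff_disj)
qed

text \<open>The ratio is fixed before \<open>m\<close> and \<open>H\<close>, which expresses that
  the threshold depends only on the profiles and on \<open>\<rho>\<close>.\<close>

theorem proposition3:
  "\<exists>\<epsilon>>0. \<forall>\<rho> (A::mode) (B::mode).
     0 < \<rho> \<and> \<rho> < \<epsilon> \<and> single_mode A \<and> single_mode B \<and> mode_support A \<inter> mode_support B = {} \<longrightarrow>
     (\<exists>\<Lambda>>0. \<forall>m>0. \<forall>H>0. m / H = \<rho> \<longrightarrow>
        (\<forall>R>0. R * H \<ge> \<Lambda> \<longrightarrow>
           LN_BD m H (scale_mode R A) (scale_mode R B)
             \<le> LN_Mink (scale_mode R A) (scale_mode R B)))"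
\<comment> \<open>The value 1 is a convenient choice: \<open>n > 1\<close> amounts to
  \<open>\<rho>^2 < 5/4\<close>.\<close>
proof (rule exI[of _ 1], intro conjI allI impI)
  fix \<rho> :: real and A B :: mode
  assume "0 < \<rho> \<and> \<rho> < 1 \<and> single_mode A \<and> single_mode B \<and> mode_support A \<inter> mode_support B = {}"
  then obtain \<Lambda> where "\<Lambda> > 0" and zero: "\<And>m H R. m > 0 \<Longrightarrow> H > 0 \<Longrightarrow> m / H = \<rho> \<Longrightarrow> R > 0 \<Longrightarrow> R * H \<ge> \<Lambda> \<Longrightarrow>
      LN_BD m H (scale_mode R A) (scale_mode R B) = 0"
    using log_negativity_BD_eq_0[of A B \<rho>] by metis
  moreover have "0 \<le> LN_Mink A' B'" for A' B'
    by (simp add: LN_Mink_def log_negativity_def)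
  ultimately show "\<exists>\<Lambda>>0. \<forall>m>0. \<forall>H>0. m / H = \<rho> \<longrightarrow>
        (\<forall>R>0. R * H \<ge> \<Lambda> \<longrightarrow>
           LN_BD m H (scale_mode R A) (scale_mode R B)
             \<le> LN_Mink (scale_mode R A) (scale_mode R B))"
    by (intro exI[of _ \<Lambda>]) simp
qed simp

end
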